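(* Let $\Omega\subset\mathbb{R}^2$ be an open polygonal domain, $\mathcal{T}$ an admissible partition of $\Omega$ into parallelograms, $\mathbf{p}=(p_K)_{K\in\mathcal{T}}$ a vector of polynomial degrees $p_K\ge1$ with comparable degrees on neighboring elements, and $f\in L^2(\Omega)$. Let $\beta=1/2+\delta$ with $0<\delta<\frac14$. Let $u\in H_0^1(\Omega)$ be the solution of $\int_\Omega\nabla u\cdot\nabla v=\int_\Omega fv$ for all $v\in H_0^1(\Omega)$, let $u_N\in S_0^{\mathbf{p}}(\mathcal{T})$ be the solution of $\int_\Omega\nabla u_N\cdot\nabla v=\int_\Omega fv$ for all $v\in S_0^{\mathbf{p}}(\mathcal{T})$, and let $e=u-u_N$. Assume that $u\in H^{1+s}(\Omega)\cap H_0^1(\Omega)$ with $s\ge\frac{1-\beta}{2}$. For $K\in\mathcal{T}$ let $\eta_{B_K}=p_K^{-1}\|f_{p_K}+\Delta u_N\|_{H^{0,\beta}(K)}$. Then there exists a constant $C(K)$, not depending on $p_K$ and $\delta$, such that $$\eta_{B_K}\le C(K)\Big(|||e|||_K+\frac1{p_K}\|f_{p_K}-f\|_{H^{0,\beta}(K)}\Big).$$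
   Context: Let $Q=(-1,1)^2$. For $\beta>-1$ and a multi-index $\alpha=(\alpha_1,\alpha_2)$ put $W_{\beta,\alpha}(x,y)=(1-x^2)^{\beta+\alpha_1}(1-y^2)^{\beta+\alpha_2}$. For integer $k\ge0$: $\|u\|^2_{H^{k,\beta}(Q)}=\sum_{|\alpha|\le k}\int_Q|\partial^\alpha u|^2W_{\beta,\alpha}$, and $H^{k,\beta}(Q)$ is the closure of $C^\infty(\bar Q)$ in this norm. For a parallelogram $K$ with affine bijection $F_K:Q\to K$, $\|u\|_{H^{k,\beta}(K)}=\|u\circ F_K\|_{H^{k,\beta}(Q)}$ and $H^{k,\beta}(K)$ is the corresponding space. An admissible partition $\mathcal{T}$ is a conforming mesh of (closed) parallelograms. Comparability of degrees: there is a fixed constant $C_0>0$ with $p_K\le C_0p_{K'}$ whenever $K,K'\in\mathcal{T}$, $K\cap K'\neq\emptyset$. $\mathcal{Q}_p(Q)$ is the set of polynomials of degree $\le p$ in each variable, $\mathcal{Q}_p(K)=\{u:u\circ F_K\in\mathcal{Q}_p(Q)\}$, and $S_0^{\mathbf{p}}(\mathcal{T})$ is the set of continuous functions on $\bar\Omega$ vanishing on $\partial\Omega$ whose restriction to each $K\in\mathcal{T}$ is in $\mathcal{Q}_{p_K}(K)$. Local error norm: $$|||e|||_K=\sup\Big\{\Big|\int_K\nabla e\cdot\nabla v\Big|:\ v\in H^{1,-\beta}(K),\ \|v\|_{H^{1,-\beta}(K)}=1\Big\}.$$ Data approximation: $f_{p_K}=(\Pi^\beta_{p_K}(f\circ F_K))\circ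 F_K^{-1}$, where $\Pi^\beta_p$ is the Jacobi projection, i.e. the orthogonal projection onto $\mathcal{Q}_p(Q)$ in the weighted $L^2$ space on $Q$ with weight $(1-x^2)^\beta(1-y^2)^\beta$. *)

theory Defs
  imports "HOL-Analysis.Analysis"
begin

type_synonym plane = "real \<times> real"

section \<open>Smooth functions and weak derivatives in the plane\<close>

definition pdiff1 :: "(plane \<Rightarrow> real) \<Rightarrow> plane \<Rightarrow> real" where
  "pdiff1 \<phi> = (\<lambda>(x, y). deriv (\<lambda>t. \<phi> (t, y)) x)"

definition pdiff2 :: "(plane \<Rightarrow> real) \<Rightarrow> plane \<Rightarrow> real" where
  "pdiff2 \<phi> = (\<lambda>(x, y). deriv (\<lambda>t. \<phi> (x, t)) y)"

definition pdiff :: "nat \<times> nat \<Rightarrow> (plane \<Rightarrow> real) \<Rightarrow> plane \<Rightarrow> real" where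
  "pdiff \<alpha> \<phi> = (pdiff1 ^^ fst \<alpha>) ((pdiff2 ^^ snd \<alpha>) \<phi>)"

definition laplacian :: "(plane \<Rightarrow> real) \<Rightarrow> plane \<Rightarrow> real" where
  "laplacian u x = pdiff (2, 0) u x + pdiff (0, 2) u x"

primrec C_k :: "nat \<Rightarrow> (plane \<Rightarrow> real) \<Rightarrow> bool" where
  "C_k 0 \<phi> \<longleftrightarrow> continuous_on UNIV \<phi>"
| "C_k (Suc k) \<phi> \<longleftrightarrow> \<phi> differentiable_on UNIV \<and> C_k k (pdiff1 \<phi>) \<and> C_k k (pdiff2 \<phi>)"

definition smooth :: "(plane \<Rightarrow> real) \<Rightarrow> bool" where
  "smooth \<phi> \<longleftrightarrow> (\<forall>k. C_k k \<phi>)"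

definition test_functions :: "plane set \<Rightarrow> (plane \<Rightarrow> real) set" where
  "test_functions S = {\<phi>. smooth \<phi> \<and> compact (closure {x. \<phi> x \<noteq> 0}) \<and> closure {x. \<phi> x \<noteq> 0} \<subseteq> S}"

definition locally_integrable :: "plane set \<Rightarrow> (plane \<Rightarrow> real) \<Rightarrow> bool" where
  "locally_integrable S u \<longleftrightarrow> (\<forall>C. compact C \<and> C \<subseteq> S \<longrightarrow> integrable (lebesgue_on C) u)"

definition has_weak_deriv ::
    "plane set \<Rightarrow> nat \<times> nat \<Rightarrow> (plane \<Rightarrow> real) \<Rightarrow> (plane \<Rightarrow> real) \<Rightarrow> bool" where
  "has_weak_deriv S \<alpha> u g \<longleftrightarrow>
     locally_integrable S u \<and> locally_integrable S g \<and>
     (\<forall>\<phi>\<in>test_functions S.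
        (LINT x|lebesgue_on S. u x * pdiff \<alpha> \<phi> x) =
        (- 1) ^ (fst \<alpha> + snd \<alpha>) * (LINT x|lebesgue_on S. g x * \<phi> x))"

text \<open>
  A representative of the weak derivative on the open set \<open>S\<close>; it is unique almost everywhere
  in \<open>S\<close>, and it is only ever used under an integral over \<open>S\<close>.
\<close>
definition weak_deriv :: "plane set \<Rightarrow> nat \<times> nat \<Rightarrow> (plane \<Rightarrow> real) \<Rightarrow> plane \<Rightarrow> real" where
  "weak_deriv S \<alpha> u = (if \<alpha> = (0, 0) then u else (SOME g. has_weak_deriv S \<alpha> u g))"

definition weak_grad :: "plane set \<Rightarrow> (plane \<Rightarrow> real) \<Rightarrow> plane \<Rightarrow> plane" where
  "weak_grad S u x = (weak_deriv S (1, 0) u x, weak_deriv S (0, 1) u x)"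

definition weakly_diff :: "nat \<Rightarrow> plane set \<Rightarrow> (plane \<Rightarrow> real) \<Rightarrow> bool" where
  "weakly_diff k S u \<longleftrightarrow> (\<forall>\<alpha>. fst \<alpha> + snd \<alpha> \<le> k \<longrightarrow> (\<exists>g. has_weak_deriv S \<alpha> u g))"

definition energy :: "plane set \<Rightarrow> (plane \<Rightarrow> real) \<Rightarrow> (plane \<Rightarrow> real) \<Rightarrow> real" where
  "energy S u v = (LINT x|lebesgue_on S. inner (weak_grad S u x) (weak_grad S v x))"


section \<open>Sobolev spaces\<close>

text \<open>
  Norms take values in \<open>[0,\<infinity>]\<close>, so that a divergent integral is infinite.
\<close>
definition enn_sqrt :: "ennreal \<Rightarrow> ennreal" where
  "enn_sqrt x = (if x = top then top else ennreal (sqrt (enn2real x)))"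

text \<open>
  The norm of order \<open>k\<close> on \<open>S\<close> in which the derivative of multi-index \<open>\<alpha>\<close> carries
  the weight \<open>W \<alpha>\<close>. It is meaningful for functions with \<^term>\<open>weakly_diff k S u\<close>.
\<close>
definition sobolev_norm ::
    "nat \<Rightarrow> plane set \<Rightarrow> (nat \<times> nat \<Rightarrow> plane \<Rightarrow> real) \<Rightarrow> (plane \<Rightarrow> real) \<Rightarrow> ennreal" where
  "sobolev_norm k S W u =
     enn_sqrt (\<Sum>\<alpha> | fst \<alpha> + snd \<alpha> \<le> k.
       \<integral>\<^sup>+ x. ennreal ((weak_deriv S \<alpha> u x)\<^sup>2 * W \<alpha> x) \<partial>lebesgue_on S)"

definition L2_space :: "plane set \<Rightarrow> (plane \<Rightarrow> real) set" where
  "L2_space S = {f. f \<in> borel_measurable (lebesgue_on S) \<and> integrable (lebesgue_on S) (\<lambda>x. (f x)\<^sup>2)}"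

abbreviation Hk_norm :: "nat \<Rightarrow> plane set \<Rightarrow> (plane \<Rightarrow> real) \<Rightarrow> ennreal" where
  "Hk_norm k S \<equiv> sobolev_norm k S (\<lambda>_ _. 1)"

definition Hk_space :: "nat \<Rightarrow> plane set \<Rightarrow> (plane \<Rightarrow> real) set" where
  "Hk_space k S = {u. weakly_diff k S u \<and> Hk_norm k S u < top}"

definition H01_space :: "plane set \<Rightarrow> (plane \<Rightarrow> real) set" where
  "H01_space S = {u \<in> Hk_space 1 S. \<exists>\<phi>. (\<forall>n. \<phi> n \<in> test_functions S) \<and>
     (\<lambda>n::nat. Hk_norm 1 S (\<lambda>x. u x - \<phi> n x)) \<longlonglongrightarrow> 0}"

text \<open>
  Sobolev--Slobodeckij space of real order \<open>r \<ge> 0\<close>: the derivatives of order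
  \<open>\<lfloor>r\<rfloor>\<close> have a finite Gagliardo seminorm of order \<open>frac r\<close> when \<open>r\<close> is not an integer
  (the exponent is \<open>d + 2 \<sigma>\<close> with \<open>d = 2\<close>).
\<close>
definition Hr_space :: "real \<Rightarrow> plane set \<Rightarrow> (plane \<Rightarrow> real) set" where
  "Hr_space r S = {u \<in> Hk_space (nat \<lfloor>r\<rfloor>) S.
     frac r > 0 \<longrightarrow>
       (\<forall>\<alpha>. fst \<alpha> + snd \<alpha> = nat \<lfloor>r\<rfloor> \<longrightarrow>
          (\<integral>\<^sup>+ x. (\<integral>\<^sup>+ y. ennreal ((weak_deriv S \<alpha> u x - weak_deriv S \<alpha> u y)\<^sup>2
             / dist x y powr (2 + 2 * frac r)) \<partial>lebesgue_on S) \<partial>lebesgue_on S) < top)}"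


section \<open>Jacobi-weighted Sobolev spaces\<close>

definition refQ :: "plane set" where
  "refQ = {- 1<..<1} \<times> {- 1<..<1}"

definition jacobi_weight :: "real \<Rightarrow> nat \<times> nat \<Rightarrow> plane \<Rightarrow> real" where
  "jacobi_weight \<beta> \<alpha> = (\<lambda>(x, y). (1 - x\<^sup>2) powr (\<beta> + real (fst \<alpha>)) * (1 - y\<^sup>2) powr (\<beta> + real (snd \<alpha>)))"

abbreviation Hkb_norm_ref :: "nat \<Rightarrow> real \<Rightarrow> (plane \<Rightarrow> real) \<Rightarrow> ennreal" where
  "Hkb_norm_ref k \<beta> \<equiv> sobolev_norm k refQ (jacobi_weight \<beta>)"

text \<open>
  The closure of the restrictions to the closed square of smooth functions on the plane.
  The weights are bounded below on compact subsets of the open square, so every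
  element of the closure has weak derivatives up to order \<open>k\<close>.
\<close>
definition Hkb_space_ref :: "nat \<Rightarrow> real \<Rightarrow> (plane \<Rightarrow> real) set" where
  "Hkb_space_ref k \<beta> = {u. weakly_diff k refQ u \<and>
     (\<exists>\<phi>. (\<forall>n. smooth (\<phi> n)) \<and>
        (\<lambda>n::nat. Hkb_norm_ref k \<beta> (\<lambda>x. u x - \<phi> n x)) \<longlonglongrightarrow> 0)}"

text \<open>
  Spaces on a parallelogram \<open>K = F ` closure refQ\<close> are given through the affine map \<open>F\<close>.
\<close>
definition Hkb_norm :: "(plane \<Rightarrow> plane) \<Rightarrow> nat \<Rightarrow> real \<Rightarrow> (plane \<Rightarrow> real) \<Rightarrow> ennreal" where
  "Hkb_norm F k \<beta> u = Hkb_norm_ref k \<beta> (u \<circ> F)"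

definition Hkb_space :: "(plane \<Rightarrow> plane) \<Rightarrow> nat \<Rightarrow> real \<Rightarrow> (plane \<Rightarrow> real) set" where
  "Hkb_space F k \<beta> = {u. u \<circ> F \<in> Hkb_space_ref k \<beta>}"


section \<open>Polygonal domains and meshes of parallelograms\<close>

definition polygonal_domain :: "plane set \<Rightarrow> bool" where
  "polygonal_domain \<Omega> \<longleftrightarrow> open \<Omega> \<and> connected \<Omega> \<and> bounded \<Omega> \<and> \<Omega> \<noteq> {} \<and>
     (\<exists>E. finite E \<and> (\<forall>(a, b)\<in>E. a \<noteq> b) \<and> frontier \<Omega> = (\<Union>(a, b)\<in>E. closed_segment a b))"

definition affine_bijection :: "(plane \<Rightarrow> plane) \<Rightarrow> plane set \<Rightarrow> bool" where
  "affine_bijection F K \<longleftrightarrow>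
     (\<exists>c L. linear L \<and> F = (\<lambda>z. c + L z)) \<and> bij F \<and> F ` closure refQ = K"

definition parallelogram :: "plane set \<Rightarrow> bool" where
  "parallelogram K \<longleftrightarrow> (\<exists>F. affine_bijection F K)"

text \<open>
  Conformity: two distinct elements meet in a common face, that is in the empty set, a common
  vertex or a common edge. In particular their interiors are disjoint.
\<close>
definition admissible_partition :: "plane set \<Rightarrow> plane set set \<Rightarrow> bool" where
  "admissible_partition \<Omega> T \<longleftrightarrow>
     finite T \<and> (\<forall>K\<in>T. parallelogram K \<and> interior K \<subseteq> \<Omega>) \<and> \<Union>T = closure \<Omega> \<and>
     (\<forall>K\<in>T. \<forall>K'\<in>T. K \<noteq> K' \<longrightarrow> (K \<inter> K') face_of K \<and> (K \<inter> K') face_of K')"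

definition comparable_degrees :: "plane set set \<Rightarrow> (plane set \<Rightarrow> nat) \<Rightarrow> real \<Rightarrow> bool" where
  "comparable_degrees T p C\<^sub>0 \<longleftrightarrow>
     C\<^sub>0 > 0 \<and> (\<forall>K\<in>T. \<forall>K'\<in>T. K \<inter> K' \<noteq> {} \<longrightarrow> real (p K) \<le> C\<^sub>0 * real (p K'))"


section \<open>Finite element space, data approximation and error measures\<close>

definition Qpoly :: "nat \<Rightarrow> (plane \<Rightarrow> real) set" where
  "Qpoly p = {q. \<exists>c :: nat \<Rightarrow> nat \<Rightarrow> real. q = (\<lambda>(x, y). \<Sum>i\<le>p. \<Sum>j\<le>p. c i j * x ^ i * y ^ j)}"

definition S0_space ::
    "(plane set \<Rightarrow> plane \<Rightarrow> plane) \<Rightarrow> plane set \<Rightarrow> plane set set \<Rightarrow> (plane set \<Rightarrow> nat) \<Rightarrow> (plane \<Rightarrow> real) set" where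
  "S0_space F \<Omega> T p = {v. continuous_on (closure \<Omega>) v \<and> (\<forall>x\<in>frontier \<Omega>. v x = 0) \<and>
     (\<forall>K\<in>T. \<exists>q\<in>Qpoly (p K). \<forall>z\<in>closure refQ. v (F K z) = q z)}"

definition jacobi_projection :: "real \<Rightarrow> nat \<Rightarrow> (plane \<Rightarrow> real) \<Rightarrow> plane \<Rightarrow> real" where
  "jacobi_projection \<beta> p g = (THE q. q \<in> Qpoly p \<and>
     (\<forall>r\<in>Qpoly p. (LINT z|lebesgue_on refQ. (g z - q z) * r z * jacobi_weight \<beta> (0, 0) z) = 0))"

definition data_approx ::
    "(plane \<Rightarrow> plane) \<Rightarrow> real \<Rightarrow> nat \<Rightarrow> (plane \<Rightarrow> real) \<Rightarrow> plane \<Rightarrow> real" where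
  "data_approx F \<beta> p f = jacobi_projection \<beta> p (f \<circ> F) \<circ> inv F"

text \<open>
  The integral over \<open>K\<close> is taken over its interior, which differs from \<open>K\<close> by a null set.
\<close>
definition local_error_norm ::
    "(plane \<Rightarrow> plane) \<Rightarrow> plane set \<Rightarrow> real \<Rightarrow> (plane \<Rightarrow> real) \<Rightarrow> ennreal" where
  "local_error_norm F K \<beta> e =
     (SUP v \<in> {v \<in> Hkb_space F 1 (- \<beta>). Hkb_norm F 1 (- \<beta>) v = 1}.
        ennreal \<bar>energy (interior K) e v\<bar>)"

text \<open>
  On \<open>interior K\<close> the function \<open>u\<^sub>N\<close> is a polynomial, so its Laplacian is the classical one.
\<close>
definition eta_B ::
    "(plane \<Rightarrow> plane) \<Rightarrow> real \<Rightarrow> nat \<Rightarrow> (plane \<Rightarrow> real) \<Rightarrow> (plane \<Rightarrow> real) \<Rightarrow> ennreal" where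
  "eta_B F \<beta> p f u\<^sub>N =
     ennreal (1 / real p) * Hkb_norm F 0 \<beta> (\<lambda>x. data_approx F \<beta> p f x + laplacian u\<^sub>N x)"

end

theory Submission
  imports Defs
begin

text \<open>
  On the reference square let \<open>w = (1 - x\<^sup>2) powr \<beta> * (1 - y\<^sup>2) powr \<beta>\<close>, let \<open>G\<close> be the inverse of the
  affine map of an element \<open>K\<close>, and let \<open>g\<close> be the polynomial that represents the residual
  \<open>f\<^sub>p + \<Delta> u\<^sub>N\<close> in reference coordinates; its weighted norm \<open>\<parallel>g\<parallel>\<close> is the indicator up to the
  factor \<open>1 / p\<close>. The proof tests the error equation with the bubble \<open>V = (g * w) \<circ> G\<close>, extended by
  zero outside \<open>K\<close>. With \<open>J\<close> the Jacobian of the affine map,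

  \<open>J * \<parallel>g\<parallel>\<^sup>2 = \<integral>\<^sub>K (f\<^sub>p + \<Delta> u\<^sub>N) * V = \<integral>\<^sub>K \<nabla>e \<bullet> \<nabla>V + \<integral>\<^sub>K (f\<^sub>p - f) * V\<close>.

  The first term is at most the local error norm of \<open>e\<close> times the norm of \<open>V\<close> in the dual weight
  \<open>- \<beta>\<close>; the second is controlled by the weighted norm of \<open>f\<^sub>p - f\<close> and \<open>\<parallel>g\<parallel>\<close>. Everything rests on
  two facts about the bubble.

  \<^item> Its dual-weight norm is at most \<open>4 * p * \<parallel>g\<parallel>\<close>. In one variable put
  \<open>N g = (1 - x\<^sup>2) * g' - 2 * \<beta> * x * g\<close>, so that \<open>(g * w)' = N g * (1 - x\<^sup>2) powr (\<beta> - 1)\<close>. The weighted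
  square integral of \<open>(g * w)'\<close> is then the quadratic form of the operator \<open>g \<mapsto> - (N g)'\<close>. This operator
  is symmetric for the Jacobi weight and triangular on monomials, with diagonal entries
  \<open>(n + 1) * (n + 2 * \<beta>)\<close>, so on degree at most \<open>p\<close> the form is at most \<open>(p + 1) * (p + 2 * \<beta>)\<close> times
  \<open>\<parallel>g\<parallel>\<^sup>2\<close> (\<open>jacobi_operator_bound\<close>, \<open>weighted_inverse_inequality\<close>). Fubini gives the bound in two
  variables (\<open>bubble_dx_norm_bound\<close>, \<open>bubble_dy_norm_bound\<close>, \<open>bubble_norm\<close>).

  \<^item> It lies in \<open>H\<^sup>1\<^sub>0\<close> of the whole domain and in the weighted space on \<open>K\<close>
  (\<open>cell_bubble_in_H01\<close>, \<open>bubble_in_Hkb\<close>). The derivative of \<open>g * w\<close> behaves like the distance to the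
  boundary to the power \<open>\<beta> - 1\<close>, which is square integrable precisely because \<open>\<beta> > 1/2\<close>. Replacing
  \<open>t powr \<beta>\<close> by \<open>t powr \<beta> * exp (- c / (t - c))\<close> for \<open>t > c\<close>, and by zero otherwise, gives smooth
  functions with compact support in the cell; as \<open>c\<close> tends to zero they and their first derivatives
  converge pointwise, and one integrable function dominates all the squared differences, even after
  multiplication with the weights (\<open>bubble_approx_dominated\<close>).

  Weak derivatives are arbitrary representatives, and the energies over \<open>\<Omega>\<close> and over \<open>K\<close> involve different
  ones. They are compared through the almost everywhere uniqueness of weak derivatives
  (\<open>has_weak_deriv_unique\<close>). The error equation for the bubble is \<open>error_energy_cell_bubble\<close>, and
  \<open>residual_bound\<close> combines the pieces.
\<close>

section \<open>Affine changes of variables in the plane\<close>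

text \<open>
  A matrix with \<open>a \<noteq> 0\<close> is a horizontal affine map followed by a vertical one: for fixed \<open>y\<close> the first
  coordinate is affine in \<open>x\<close>, and in terms of the new first coordinate the second one is affine in \<open>y\<close>
  with slope \<open>(a * d - b * c) / a\<close>. Each step is a one-dimensional change of variables under Fubini.
\<close>
lemma nn_integral_plane_affine_aux:
  fixes a b c d s t :: real and f :: "plane \<Rightarrow> ennreal"
  assumes [measurable]: "f \<in> borel_measurable borel" and a: "a \<noteq> 0" and D: "a * d - b * c \<noteq> 0"
  shows "(\<integral>\<^sup>+ z. f z \<partial>lborel) =
    ennreal \<bar>a * d - b * c\<bar> * (\<integral>\<^sup>+ z. f (a * fst z + b * snd z + s, c * fst z + d * snd z + t) \<partial>lborel)"
proof -
  have [measurable]: "f \<in> borel_measurable (lborel \<Otimes>\<^sub>M lborel)"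
    by (simp add: lborel_prod)
  define e where "e = (a * d - b * c) / a"
  have e: "e \<noteq> 0" using a D by (simp add: e_def)
  have "(\<integral>\<^sup>+ z. f (a * fst z + b * snd z + s, c * fst z + d * snd z + t) \<partial>lborel)
      = (\<integral>\<^sup>+ z. f (a * fst z + b * snd z + s, c * fst z + d * snd z + t) \<partial>(lborel \<Otimes>\<^sub>M lborel))"
    by (simp add: lborel_prod)
  also have "\<dots> = (\<integral>\<^sup>+ y. \<integral>\<^sup>+ x. f (a * x + b * y + s, c * x + d * y + t) \<partial>lborel \<partial>lborel)"
    by (subst lborel_pair.nn_integral_snd[symmetric]) (auto simp: case_prod_beta)
  finally have 1: "(\<integral>\<^sup>+ z. f (a * fst z + b * snd z + s, c * fst z + d * snd z + t) \<partial>lborel)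
      = (\<integral>\<^sup>+ y. \<integral>\<^sup>+ x. f (a * x + b * y + s, c * x + d * y + t) \<partial>lborel \<partial>lborel)" .
  have 2: "(\<integral>\<^sup>+ x. f (x, (c / a) * (x - s) + t + e * y) \<partial>lborel)
      = ennreal \<bar>a\<bar> * (\<integral>\<^sup>+ x. f (a * x + b * y + s, c * x + d * y + t) \<partial>lborel)" for y
  proof -
    have eq: "c / a * (a * x + b * y + s - s) + t + e * y = c * x + d * y + t" for x
    proof -
      have "c / a * (a * x + b * y) + e * y = c * x + d * y"
        using a by (simp add: e_def field_simps)
      moreover have "p + e' = q + r \<Longrightarrow> p + t + e' = q + r + t" for p q r e' :: real by simp
      ultimately show ?thesis unfolding add_diff_cancel_right' by blast
    qed
    have eq': "b * y + s + a * x = a * x + b * y + s" for x by simp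
    have "(\<lambda>x. f (x, (c / a) * (x - s) + t + e * y)) \<in> borel_measurable borel"
      by measurable
    from nn_integral_real_affine[OF this a, where t = "b * y + s"] show ?thesis
      by (simp only: eq eq')
  qed
  have 3: "(\<integral>\<^sup>+ y. f (x, y) \<partial>lborel) = ennreal \<bar>e\<bar> * (\<integral>\<^sup>+ y. f (x, (c / a) * (x - s) + t + e * y) \<partial>lborel)" for x
    by (subst nn_integral_real_affine[OF _ e, where t = "(c / a) * (x - s) + t"]) auto
  have "(\<integral>\<^sup>+ z. f z \<partial>lborel) = (\<integral>\<^sup>+ z. f z \<partial>(lborel \<Otimes>\<^sub>M lborel))"
    by (simp add: lborel_prod)
  also have "\<dots> = (\<integral>\<^sup>+ x. \<integral>\<^sup>+ y. f (x, y) \<partial>lborel \<partial>lborel)"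
    by (rule lborel.nn_integral_fst[symmetric]) auto
  also have "\<dots> = ennreal \<bar>e\<bar> * (\<integral>\<^sup>+ x. \<integral>\<^sup>+ y. f (x, (c / a) * (x - s) + t + e * y) \<partial>lborel \<partial>lborel)"
    by (subst nn_integral_cmult[symmetric]) (auto simp: 3)
  also have "(\<integral>\<^sup>+ x. \<integral>\<^sup>+ y. f (x, (c / a) * (x - s) + t + e * y) \<partial>lborel \<partial>lborel)
     = (\<integral>\<^sup>+ y. \<integral>\<^sup>+ x. f (x, (c / a) * (x - s) + t + e * y) \<partial>lborel \<partial>lborel)"
    by (rule lborel_pair.Fubini') auto
  also have "\<dots> = (\<integral>\<^sup>+ y. ennreal \<bar>a\<bar> * (\<integral>\<^sup>+ x. f (a * x + b * y + s, c * x + d * y + t) \<partial>lborel) \<partial>lborel)"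
    by (simp only: 2)
  also have "\<dots> = ennreal \<bar>a\<bar> * (\<integral>\<^sup>+ y. \<integral>\<^sup>+ x. f (a * x + b * y + s, c * x + d * y + t) \<partial>lborel \<partial>lborel)"
    by (rule nn_integral_cmult) measurable
  finally have 4: "(\<integral>\<^sup>+ z. f z \<partial>lborel) = ennreal (\<bar>e\<bar> * \<bar>a\<bar>) *
      (\<integral>\<^sup>+ y. \<integral>\<^sup>+ x. f (a * x + b * y + s, c * x + d * y + t) \<partial>lborel \<partial>lborel)"
    by (simp add: mult.assoc[symmetric] ennreal_mult')
  have "e * a = a * d - b * c" using a by (simp add: e_def)
  then have "\<bar>e\<bar> * \<bar>a\<bar> = \<bar>a * d - b * c\<bar>" by (simp add: abs_mult[symmetric])
  then show ?thesis using 4 by (simp only: 1)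
qed

lemma nn_integral_plane_swap:
  fixes f :: "plane \<Rightarrow> ennreal"
  assumes [measurable]: "f \<in> borel_measurable borel"
  shows "(\<integral>\<^sup>+ z. f z \<partial>lborel) = (\<integral>\<^sup>+ z. f (snd z, fst z) \<partial>lborel)"
proof -
  have [measurable]: "f \<in> borel_measurable (lborel \<Otimes>\<^sub>M lborel)"
    by (simp add: lborel_prod)
  have "(\<integral>\<^sup>+ z. f z \<partial>(lborel \<Otimes>\<^sub>M lborel)) = (\<integral>\<^sup>+ x. \<integral>\<^sup>+ y. f (x, y) \<partial>lborel \<partial>lborel)"
    by (rule lborel.nn_integral_fst[symmetric]) auto
  also have "\<dots> = (\<integral>\<^sup>+ z. f (snd z, fst z) \<partial>(lborel \<Otimes>\<^sub>M lborel))"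
    by (subst lborel_pair.nn_integral_snd[symmetric]) (auto simp: case_prod_beta)
  finally show ?thesis by (simp add: lborel_prod)
qed

text \<open>
  If \<open>a = 0\<close> then \<open>c \<noteq> 0\<close>, and interchanging the two target coordinates reduces to the previous case.
\<close>
lemma nn_integral_plane_affine:
  fixes a b c d s t :: real and f :: "plane \<Rightarrow> ennreal"
  assumes [measurable]: "f \<in> borel_measurable borel" and D: "a * d - b * c \<noteq> 0"
  shows "(\<integral>\<^sup>+ z. f z \<partial>lborel) =
    ennreal \<bar>a * d - b * c\<bar> * (\<integral>\<^sup>+ z. f (a * fst z + b * snd z + s, c * fst z + d * snd z + t) \<partial>lborel)"
proof (cases "a = 0")
  case False
  then show ?thesis using nn_integral_plane_affine_aux[OF assms(1) _ D] by auto
next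
  case True
  with D have c: "c \<noteq> 0" by auto
  have "(\<lambda>z::plane. (snd z, fst z)) \<in> borel \<rightarrow>\<^sub>M borel"
    by (intro borel_measurable_continuous_onI continuous_intros)
  from measurable_compose[OF this assms(1)]
  have [measurable]: "(\<lambda>z. f (snd z, fst z)) \<in> borel_measurable borel" .
  have D': "c * b - d * a \<noteq> 0" using D by (simp add: algebra_simps)
  have "(\<integral>\<^sup>+ z. f z \<partial>lborel) = (\<integral>\<^sup>+ z. f (snd z, fst z) \<partial>lborel)"
    by (rule nn_integral_plane_swap) simp
  also have "\<dots> = ennreal \<bar>c * b - d * a\<bar> * (\<integral>\<^sup>+ z. f (a * fst z + b * snd z + s, c * fst z + d * snd z + t) \<partial>lborel)"
    by (subst nn_integral_plane_affine_aux[OF _ c D', of _ t s]) simp_all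
  also have "\<bar>c * b - d * a\<bar> = \<bar>a * d - b * c\<bar>" by (simp add: algebra_simps abs_minus_commute)
  finally show ?thesis .
qed

text \<open>
  The affine map of a mesh cell in coordinates. The explicit coefficients of the inverse map enter the
  chain rule for functions that are transplanted from the reference square to the cell.
\<close>
locale affine_chart =
  fixes a b c d s t :: real
  assumes det: "a * d - b * c \<noteq> 0"
begin

definition jac :: real where "jac = \<bar>a * d - b * c\<bar>"

definition fwd :: "plane \<Rightarrow> plane" where
  "fwd z = (a * fst z + b * snd z + s, c * fst z + d * snd z + t)"

definition m11 where "m11 = d / (a * d - b * c)"
definition m12 where "m12 = - b / (a * d - b * c)"
definition m21 where "m21 = - c / (a * d - b * c)"
definition m22 where "m22 = a / (a * d - b * c)"

definition bwd :: "plane \<Rightarrow> plane" where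
  "bwd z = (m11 * (fst z - s) + m12 * (snd z - t), m21 * (fst z - s) + m22 * (snd z - t))"

lemma jac_pos: "jac > 0" using det by (simp add: jac_def)

lemma inverse_coeffs:
  "m11 * a + m12 * c = 1" "m11 * b + m12 * d = 0" "m21 * a + m22 * c = 0" "m21 * b + m22 * d = 1"
  "a * m11 + b * m21 = 1" "a * m12 + b * m22 = 0" "c * m11 + d * m21 = 0" "c * m12 + d * m22 = 1"
proof -
  show "m11 * a + m12 * c = 1" "m11 * b + m12 * d = 0" "m21 * a + m22 * c = 0" "m21 * b + m22 * d = 1"
    "a * m11 + b * m21 = 1" "a * m12 + b * m22 = 0" "c * m11 + d * m21 = 0" "c * m12 + d * m22 = 1"
    unfolding m11_def m12_def m21_def m22_def using det
    by (simp_all add: divide_simps)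
qed

lemma bwd_fwd [simp]: "bwd (fwd z) = z"
proof (cases z)
  case (Pair x y)
  have "m11 * (a * x + b * y) + m12 * (c * x + d * y) = (m11 * a + m12 * c) * x + (m11 * b + m12 * d) * y"
    "m21 * (a * x + b * y) + m22 * (c * x + d * y) = (m21 * a + m22 * c) * x + (m21 * b + m22 * d) * y"
    by (simp_all add: algebra_simps)
  then have "m11 * (a * x + b * y) + m12 * (c * x + d * y) = x" "m21 * (a * x + b * y) + m22 * (c * x + d * y) = y"
    by (simp_all add: inverse_coeffs)
  then show ?thesis by (simp add: Pair bwd_def fwd_def)
qed

lemma fwd_bwd [simp]: "fwd (bwd z) = z"
proof (cases z)
  case (Pair x y)
  have "a * (m11 * u + m12 * v) + b * (m21 * u + m22 * v) = (a * m11 + b * m21) * u + (a * m12 + b * m22) * v"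
    "c * (m11 * u + m12 * v) + d * (m21 * u + m22 * v) = (c * m11 + d * m21) * u + (c * m12 + d * m22) * v" for u v
    by (simp_all add: algebra_simps)
  then have "a * (m11 * u + m12 * v) + b * (m21 * u + m22 * v) = u" "c * (m11 * u + m12 * v) + d * (m21 * u + m22 * v) = v" for u v
    by (simp_all add: inverse_coeffs)
  then show ?thesis by (simp add: Pair bwd_def fwd_def)
qed

lemma inv_fwd: "inv fwd = bwd"
  by (rule inv_unique_comp) (auto simp: fun_eq_iff)

lemma fwd_image: "fwd ` S = bwd -` S"
  proof (intro set_eqI iffI)
  fix z assume "z \<in> bwd -` S"
  then show "z \<in> fwd ` S" by (intro image_eqI[of _ _ "bwd z"]) auto
qed auto

lemma continuous_fwd: "continuous_on S fwd"
  unfolding fwd_def by (intro continuous_intros)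

lemma continuous_bwd: "continuous_on S bwd"
  unfolding bwd_def by (intro continuous_intros)

lemma open_fwd_image: "open S \<Longrightarrow> open (fwd ` S)"
  unfolding fwd_image by (rule open_vimage) (auto intro: continuous_bwd)

lemma borel_fwd [measurable]: "fwd \<in> borel \<rightarrow>\<^sub>M borel"
  by (rule borel_measurable_continuous_onI) (rule continuous_fwd)

lemma borel_bwd [measurable]: "bwd \<in> borel \<rightarrow>\<^sub>M borel"
  by (rule borel_measurable_continuous_onI) (rule continuous_bwd)

lemma lborel_fwd: "lborel = density (distr lborel borel fwd) (\<lambda>_. ennreal jac)"
proof (rule measure_eqI)
  fix A :: "plane set" assume "A \<in> sets lborel"
  then have [measurable]: "A \<in> sets borel" by simp
  have "emeasure lborel A = (\<integral>\<^sup>+ z. indicator A z \<partial>lborel)" by simp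
  also have "\<dots> = ennreal jac * (\<integral>\<^sup>+ z. indicator A (fwd z) \<partial>lborel)"
    using nn_integral_plane_affine[OF _ det, of "indicator A" s t] by (simp add: jac_def fwd_def)
  also have "\<dots> = (\<integral>\<^sup>+ z. ennreal jac * indicator A z \<partial>distr lborel borel fwd)"
    by (simp add: nn_integral_distr nn_integral_cmult del: nn_integral_indicator)
  also have "\<dots> = emeasure (density (distr lborel borel fwd) (\<lambda>_. ennreal jac)) A"
    by (simp add: emeasure_density)
  finally show "emeasure lborel A = \<dots>" .
qed simp

lemma
  shows lebesgue_fwd: "lebesgue = density (distr lebesgue lebesgue fwd) (\<lambda>_. ennreal jac)"
    and measurable_fwd: "fwd \<in> lebesgue \<rightarrow>\<^sub>M lebesgue"
proof -
  { fix A :: "plane set" assume A: "A \<in> sets borel"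
    then have "emeasure lborel A = 0 \<longleftrightarrow> emeasure (density (distr lborel borel fwd) (\<lambda>_. ennreal jac)) A = 0"
      by (subst lborel_fwd[symmetric]) auto
    also have "\<dots> \<longleftrightarrow> emeasure (distr lebesgue lborel fwd) A = 0"
      using A jac_pos by (simp add: distr_completion emeasure_density nn_integral_cmult cong: distr_cong)
    finally have "emeasure lborel A = 0 \<longleftrightarrow> emeasure (distr lebesgue lborel fwd) A = 0" . }
  then have eq: "null_sets lborel = null_sets (distr lebesgue lborel fwd)"
    by (auto simp: null_sets_def)
  show "fwd \<in> lebesgue \<rightarrow>\<^sub>M lebesgue"
    by (simp add: completion.measurable_completion2 eq measurable_completion)
  have "lebesgue = completion (density (distr lborel borel fwd) (\<lambda>_. ennreal jac))"
    by (subst lborel_fwd) simp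
  also have "\<dots> = density (completion (distr lebesgue lborel fwd)) (\<lambda>_. ennreal jac)"
    using jac_pos by (auto intro!: always_eventually completion_density_eq simp: distr_completion cong: distr_cong)
  also have "\<dots> = density (distr lebesgue lebesgue fwd) (\<lambda>_. ennreal jac)"
    by (subst completion.completion_distr_eq) (auto simp: eq measurable_completion)
  finally show "lebesgue = density (distr lebesgue lebesgue fwd) (\<lambda>_. ennreal jac)" .
qed

lemma measurable_comp_fwd:
  "f \<in> borel_measurable lebesgue \<Longrightarrow> (\<lambda>z. f (fwd z)) \<in> borel_measurable lebesgue"
  using measurable_compose[OF measurable_fwd] by blast

lemma nn_integral_fwd:
  assumes [measurable]: "f \<in> borel_measurable lebesgue"
  shows "(\<integral>\<^sup>+ z. f z \<partial>lebesgue) = ennreal jac * (\<integral>\<^sup>+ z. f (fwd z) \<partial>lebesgue)"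
proof -
  note [measurable] = measurable_fwd
  show ?thesis
    by (subst lebesgue_fwd) (simp add: nn_integral_density nn_integral_cmult nn_integral_distr)
qed

lemma integrable_fwd:
  fixes f :: "plane \<Rightarrow> real"
  assumes [measurable]: "f \<in> borel_measurable lebesgue"
  shows "integrable lebesgue f \<longleftrightarrow> integrable lebesgue (\<lambda>z. f (fwd z))"
proof -
  note [measurable] = measurable_fwd
  have "integrable lebesgue f \<longleftrightarrow> (\<integral>\<^sup>+ z. ennreal (norm (f z)) \<partial>lebesgue) < \<infinity>"
    by (simp add: integrable_iff_bounded)
  also have "\<dots> \<longleftrightarrow> (\<integral>\<^sup>+ z. ennreal (norm (f (fwd z))) \<partial>lebesgue) < \<infinity>"
    using jac_pos by (subst nn_integral_fwd) (auto simp: ennreal_mult_less_top ennreal_zero_less_mult_iff)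
  also have "\<dots> \<longleftrightarrow> integrable lebesgue (\<lambda>z. f (fwd z))"
    by (simp add: integrable_iff_bounded)
  finally show ?thesis .
qed

lemma integral_fwd:
  fixes f :: "plane \<Rightarrow> real"
  assumes [measurable]: "f \<in> borel_measurable lebesgue"
  shows "(LINT z|lebesgue. f z) = jac * (LINT z|lebesgue. f (fwd z))"
proof -
  note [measurable] = measurable_fwd
  show ?thesis using jac_pos
    by (subst lebesgue_fwd) (simp add: integral_density integral_distr)
qed

end

lemma linear_plane_form:
  assumes "linear (L :: plane \<Rightarrow> plane)"
  shows "L z = (fst (L (1, 0)) * fst z + fst (L (0, 1)) * snd z, snd (L (1, 0)) * fst z + snd (L (0, 1)) * snd z)"
proof -
  have "L z = L (fst z *\<^sub>R (1, 0) + snd z *\<^sub>R (0, 1))" by (cases z) simp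
  also have "\<dots> = fst z *\<^sub>R L (1, 0) + snd z *\<^sub>R L (0, 1)"
    by (simp only: linear_add[OF assms] linear_scale[OF assms])
  finally have "L z = fst z *\<^sub>R L (1, 0) + snd z *\<^sub>R L (0, 1)" .
  then show ?thesis by (simp add: prod_eq_iff algebra_simps)
qed

text \<open>
  If the determinant vanished, the linear part would send the columns \<open>(d, - c)\<close> and \<open>(- b, a)\<close> of the
  adjugate matrix to zero; by injectivity these columns would vanish, and with them the linear part itself.
\<close>
lemma affine_bijection_chart:
  assumes "affine_bijection F K"
  obtains a b c d s t where "affine_chart a b c d" and "F = affine_chart.fwd a b c d s t"
proof -
  obtain r L where L: "linear L" and F: "F = (\<lambda>z. r + L z)" and bij: "bij F"
    using assms unfolding affine_bijection_def by blast
  define a b c d where "a = fst (L (1, 0))" and "b = fst (L (0, 1))"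
    and "c = snd (L (1, 0))" and "d = snd (L (0, 1))"
  have Lz: "L z = (a * fst z + b * snd z, c * fst z + d * snd z)" for z
    unfolding a_def b_def c_def d_def by (rule linear_plane_form[OF L])
  have inj: "L z = 0 \<Longrightarrow> z = 0" for z
    using bij injD[of F z 0] L by (auto simp: F bij_def linear_0)
  have "a * d - b * c \<noteq> 0"
  proof
    assume D: "a * d - b * c = 0"
    have "L (d, - c) = 0" "L (- b, a) = 0" using D by (simp_all add: Lz prod_eq_iff algebra_simps)
    then have "(d, - c) = 0" "(- b, a) = 0" using inj by blast+
    then have "d = 0" "c = 0" "b = 0" "a = 0" by (auto simp: zero_prod_def)
    then have "L (1, 0) = 0" by (simp add: Lz prod_eq_iff)
    then have "(1, 0) = (0::plane)" by (rule inj)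
    then show False by (simp add: zero_prod_def)
  qed
  then have ch: "affine_chart a b c d" by unfold_locales
  have "F = affine_chart.fwd a b c d (fst r) (snd r)"
    by (rule ext) (simp add: F affine_chart.fwd_def[OF ch] Lz prod_eq_iff)
  with ch show thesis by (rule that)
qed

section \<open>Orthogonal projection onto a finite-dimensional space\<close>

definition square_integrable :: "'a measure \<Rightarrow> ('a \<Rightarrow> real) \<Rightarrow> bool" where
  "square_integrable M f \<longleftrightarrow> f \<in> borel_measurable M \<and> integrable M (\<lambda>x. (f x)\<^sup>2)"

lemma square_integrable_mult:
  assumes "square_integrable M f" "square_integrable M g"
  shows "integrable M (\<lambda>x. f x * g x)"
proof (rule Bochner_Integration.integrable_bound)
  show "integrable M (\<lambda>x. (f x)\<^sup>2 + (g x)\<^sup>2)"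
    using assms by (auto simp: square_integrable_def)
  show "(\<lambda>x. f x * g x) \<in> borel_measurable M"
    using assms by (auto simp: square_integrable_def)
  have "\<bar>f x * g x\<bar> \<le> (f x)\<^sup>2 + (g x)\<^sup>2" for x
  proof -
    have "2 * (\<bar>f x\<bar> * \<bar>g x\<bar>) \<le> (f x)\<^sup>2 + (g x)\<^sup>2"
      using sum_squares_bound[of "\<bar>f x\<bar>" "\<bar>g x\<bar>"] by simp
    moreover have "0 \<le> \<bar>f x\<bar> * \<bar>g x\<bar>" by simp
    ultimately show ?thesis unfolding abs_mult by linarith
  qed
  then show "AE x in M. norm (f x * g x) \<le> norm ((f x)\<^sup>2 + (g x)\<^sup>2)" by simp
qed

lemma square_integrable_add:
  assumes "square_integrable M f" "square_integrable M g"
  shows "square_integrable M (\<lambda>x. f x + r * g x)"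
proof -
  have "(f x + r * g x)\<^sup>2 = (f x)\<^sup>2 + (2 * r) * (f x * g x) + r\<^sup>2 * (g x)\<^sup>2" for x
    by (simp add: power2_eq_square algebra_simps)
  then show ?thesis
    using assms square_integrable_mult[OF assms] by (auto simp: square_integrable_def)
qed

lemma square_integrable_zero: "square_integrable M (\<lambda>_. 0)"
  by (simp add: square_integrable_def)

lemma square_integrable_sum:
  assumes "\<And>i. i \<in> I \<Longrightarrow> square_integrable M (b i)"
  shows "square_integrable M (\<lambda>x. \<Sum>i\<in>I. r i * b i x)"
  using assms
proof (induction I rule: infinite_finite_induct)
  case (insert i I)
  then have "square_integrable M (\<lambda>x. (\<Sum>i\<in>I. r i * b i x) + r i * b i x)"
    by (intro square_integrable_add) auto
  then show ?case using insert by (simp add: add.commute)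
qed (auto simp: square_integrable_zero)

text \<open>
  Gram--Schmidt: adding the vector \<open>b i\<close> to a family that already has projections only needs the
  component \<open>e\<close> of \<open>b i\<close> orthogonal to the family. If \<open>e\<close> is null then, by vanishing of its square
  integral, it is orthogonal to everything and the old projection still works.
\<close>
lemma orthogonal_projection_exists:
  assumes "finite I" and "\<And>i. i \<in> I \<Longrightarrow> square_integrable M (b i)" and "square_integrable M f"
  shows "\<exists>r. \<forall>j\<in>I. (LINT x|M. (f x - (\<Sum>i\<in>I. r i * b i x)) * b j x) = 0"
  using assms
proof (induction I arbitrary: f rule: finite_induct)
  case empty
  then show ?case by simp
next
  case (insert k I)
  have bk: "square_integrable M (b k)" and bI: "\<And>i. i \<in> I \<Longrightarrow> square_integrable M (b i)"
    using insert by auto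
  obtain r where r: "\<And>j. j \<in> I \<Longrightarrow> (LINT x|M. (f x - (\<Sum>i\<in>I. r i * b i x)) * b j x) = 0"
    using insert.IH[OF bI insert.prems(2)] by blast
  obtain q where q: "\<And>j. j \<in> I \<Longrightarrow> (LINT x|M. (b k x - (\<Sum>i\<in>I. q i * b i x)) * b j x) = 0"
    using insert.IH[OF bI bk] by blast
  define g where "g x = f x - (\<Sum>i\<in>I. r i * b i x)" for x
  define e where "e x = b k x - (\<Sum>i\<in>I. q i * b i x)" for x
  have sum_sq: "square_integrable M (\<lambda>x. \<Sum>i\<in>I. r i * b i x)" "square_integrable M (\<lambda>x. \<Sum>i\<in>I. q i * b i x)"
    by (intro square_integrable_sum bI; simp)+
  have g: "square_integrable M g"
    using square_integrable_add[OF insert.prems(2) sum_sq(1), of "-1"] by (simp add: g_def[abs_def])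
  have e: "square_integrable M e"
    using square_integrable_add[OF bk sum_sq(2), of "-1"] by (simp add: e_def[abs_def])
  define E where "E = (LINT x|M. (e x)\<^sup>2)"
  \<comment> \<open>the coefficient of the component of \<open>g\<close> along \<open>e\<close>; any value works when \<open>e\<close> is null\<close>
  define \<alpha> where "\<alpha> = (if E = 0 then 0 else (LINT x|M. g x * e x) / E)"
  have null: "(LINT x|M. g x * e x) = 0" if "E = 0"
  proof -
    have "AE x in M. (e x)\<^sup>2 = 0"
      using that e integral_nonneg_eq_0_iff_AE[of M "\<lambda>x. (e x)\<^sup>2"] by (auto simp: E_def square_integrable_def)
    then have "(LINT x|M. g x * e x) = (LINT x|M. 0)"
      using g e by (intro integral_cong_AE) (auto simp: square_integrable_def)
    then show ?thesis by simp
  qed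
  have I: "integrable M (\<lambda>x. g x * b j x)" "integrable M (\<lambda>x. e x * b j x)" if "j \<in> insert k I" for j
    using that bk bI by (auto intro: square_integrable_mult g e)
  have ge: "integrable M (\<lambda>x. g x * e x)" "integrable M (\<lambda>x. (e x)\<^sup>2)"
    using square_integrable_mult[OF g e] e by (auto simp: square_integrable_def)
  have orthI: "(LINT x|M. (g x - \<alpha> * e x) * b j x) = 0" if "j \<in> I" for j
    using that I[of j] r[OF that] q[OF that] by (simp add: left_diff_distrib mult.assoc g_def[symmetric] e_def[symmetric])
  have orthe: "(LINT x|M. (g x - \<alpha> * e x) * e x) = 0"
  proof -
    have "(g x - \<alpha> * e x) * e x = g x * e x - \<alpha> * (e x)\<^sup>2" for x
      by (simp add: power2_eq_square algebra_simps)
    then show ?thesis using ge null by (auto simp: \<alpha>_def E_def)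
  qed
  have orthk: "(LINT x|M. (g x - \<alpha> * e x) * b k x) = 0"
  proof -
    have "(g x - \<alpha> * e x) * b k x = (g x - \<alpha> * e x) * e x + (\<Sum>i\<in>I. q i * ((g x - \<alpha> * e x) * b i x))" for x
    proof -
      have "b k x = e x + (\<Sum>i\<in>I. q i * b i x)" by (simp add: e_def)
      moreover have "w * (\<Sum>i\<in>I. q i * b i x) = (\<Sum>i\<in>I. q i * (w * b i x))" for w
        by (simp add: sum_distrib_left mult.left_commute)
      ultimately show ?thesis by (metis distrib_left)
    qed
    moreover have "integrable M (\<lambda>x. (g x - \<alpha> * e x) * e x)"
      using square_integrable_mult[OF square_integrable_add[OF g e, of "- \<alpha>"] e] by simp
    moreover have "integrable M (\<lambda>x. (g x - \<alpha> * e x) * b i x)" if "i \<in> I" for i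
      using square_integrable_mult[OF square_integrable_add[OF g e, of "- \<alpha>"] bI[OF that]] by simp
    ultimately show ?thesis using orthe orthI by simp
  qed
  define r' where "r' i = (if i = k then \<alpha> else r i - \<alpha> * q i)" for i
  have "f x - (\<Sum>i\<in>insert k I. r' i * b i x) = g x - \<alpha> * e x" for x
  proof -
    have "(\<Sum>i\<in>I. r' i * b i x) = (\<Sum>i\<in>I. r i * b i x) - \<alpha> * (\<Sum>i\<in>I. q i * b i x)"
      using insert.hyps by (auto simp: r'_def sum_distrib_left sum_subtractf[symmetric] algebra_simps intro!: sum.cong)
    then show ?thesis using insert.hyps by (simp add: g_def e_def r'_def algebra_simps)
  qed
  then show ?case using orthI orthk by (intro exI[of _ r']) auto
qed

section \<open>Calculus of smooth functions in the plane\<close>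

text \<open>
  Total differentiability with named partial derivatives. Unlike \<^const>\<open>pdiff1\<close> and \<^const>\<open>pdiff2\<close>, which
  are defined for every function, it supports derivation rules.
\<close>
definition has_partials :: "(plane \<Rightarrow> real) \<Rightarrow> real \<Rightarrow> real \<Rightarrow> plane \<Rightarrow> bool" where
  "has_partials \<phi> p q z \<longleftrightarrow> (\<phi> has_derivative (\<lambda>h. fst h * p + snd h * q)) (at z)"

lemma has_partials_pdiff:
  assumes "has_partials \<phi> p q z"
  shows "pdiff1 \<phi> z = p" and "pdiff2 \<phi> z = q"
proof -
  obtain x y where z: "z = (x, y)" by (cases z)
  have D: "(\<phi> has_derivative (\<lambda>h. fst h * p + snd h * q)) (at (x, y))"
    using assms by (simp add: has_partials_def z)
  have "((\<lambda>t. \<phi> (t, y)) has_derivative (\<lambda>h. fst (h, 0::real) * p + snd (h, 0::real) * q)) (at x)"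
    by (rule has_derivative_compose[of "\<lambda>t. (t, y)" "\<lambda>h. (h, 0)" x UNIV \<phi> "\<lambda>h. fst h * p + snd h * q", OF _ D])
       (auto intro!: derivative_eq_intros)
  then have "DERIV (\<lambda>t. \<phi> (t, y)) x :> p"
    unfolding has_field_derivative_def by (rule has_derivative_eq_rhs) (auto simp: mult.commute)
  then show "pdiff1 \<phi> z = p" by (simp add: pdiff1_def z DERIV_imp_deriv)
  have "((\<lambda>t. \<phi> (x, t)) has_derivative (\<lambda>h. fst (0::real, h) * p + snd (0::real, h) * q)) (at y)"
    by (rule has_derivative_compose[of "\<lambda>t. (x, t)" "\<lambda>h. (0, h)" y UNIV \<phi> "\<lambda>h. fst h * p + snd h * q", OF _ D])
       (auto intro!: derivative_eq_intros)
  then have "DERIV (\<lambda>t. \<phi> (x, t)) y :> q"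
    unfolding has_field_derivative_def by (rule has_derivative_eq_rhs) (auto simp: mult.commute)
  then show "pdiff2 \<phi> z = q" by (simp add: pdiff2_def z DERIV_imp_deriv)
qed

lemma differentiable_has_partials:
  assumes "\<phi> differentiable (at z)"
  shows "has_partials \<phi> (pdiff1 \<phi> z) (pdiff2 \<phi> z) z"
proof -
  obtain D where D: "(\<phi> has_derivative D) (at z)"
    using assms by (auto simp: differentiable_def)
  then have "linear D" by (rule has_derivative_linear)
  have "D h = fst h * D (1, 0) + snd h * D (0, 1)" for h
  proof -
    have "D h = D (fst h *\<^sub>R (1, 0) + snd h *\<^sub>R (0, 1))" by (cases h) simp
    then show ?thesis
      by (simp only: linear_add[OF \<open>linear D\<close>] linear_scale[OF \<open>linear D\<close>]) simp
  qed
  then have "D = (\<lambda>h. fst h * D (1, 0) + snd h * D (0, 1))" by (rule ext)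
  with D have *: "has_partials \<phi> (D (1, 0)) (D (0, 1)) z" by (simp add: has_partials_def)
  show ?thesis using has_partials_pdiff[OF *] * by simp
qed

lemma has_partials_const: "has_partials (\<lambda>_. k) 0 0 z"
  by (simp add: has_partials_def)

lemma has_partials_fst: "has_partials fst 1 0 z"
  unfolding has_partials_def by (auto intro!: derivative_eq_intros)

lemma has_partials_snd: "has_partials snd 0 1 z"
  unfolding has_partials_def by (auto intro!: derivative_eq_intros)

lemma has_partials_add:
  "has_partials f p q z \<Longrightarrow> has_partials g p' q' z \<Longrightarrow> has_partials (\<lambda>z. f z + g z) (p + p') (q + q') z"
  unfolding has_partials_def by (auto intro!: derivative_eq_intros simp: algebra_simps)

lemma has_partials_mult:
  "has_partials f p q z \<Longrightarrow> has_partials g p' q' z \<Longrightarrow>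
    has_partials (\<lambda>z. f z * g z) (p * g z + f z * p') (q * g z + f z * q') z"
  unfolding has_partials_def by (auto intro!: derivative_eq_intros simp: algebra_simps)

lemma has_partials_real_comp:
  assumes "DERIV h (f z) :> h'" and "has_partials f p q z"
  shows "has_partials (\<lambda>z. h (f z)) (h' * p) (h' * q) z"
proof -
  have "((\<lambda>z. h (f z)) has_derivative (\<lambda>k. h' * (fst k * p + snd k * q))) (at z)"
    by (rule has_derivative_compose[OF assms(2)[unfolded has_partials_def] assms(1)[unfolded has_field_derivative_def]])
  then show ?thesis by (simp add: has_partials_def algebra_simps)
qed

lemma has_partials_plane_comp:
  assumes "has_partials f p q (g1 z, g2 z)" and "has_partials g1 a b z" and "has_partials g2 c d z"
  shows "has_partials (\<lambda>z. f (g1 z, g2 z)) (a * p + c * q) (b * p + d * q) z"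
proof -
  have "((\<lambda>z. (g1 z, g2 z)) has_derivative (\<lambda>h. (fst h * a + snd h * b, fst h * c + snd h * d))) (at z)"
    using assms(2,3) unfolding has_partials_def by (rule has_derivative_Pair)
  from has_derivative_compose[OF this assms(1)[unfolded has_partials_def]] show ?thesis
    by (simp add: has_partials_def algebra_simps)
qed

declare C_k.simps(2) [simp del]

text \<open>
  The introduction rule turns each closure property of the classes \<^const>\<open>C_k\<close> into an induction on \<open>k\<close>
  in which the candidates for the partial derivatives come from a differentiation rule.
\<close>
lemma C_k_SucI:
  assumes "\<And>z. has_partials \<phi> (p z) (q z) z" and "C_k k p" and "C_k k q"
  shows "C_k (Suc k) \<phi>"
proof -
  have "\<phi> differentiable_on UNIV"
    using assms(1) by (auto simp: has_partials_def differentiable_on_def differentiable_def)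
  moreover have "pdiff1 \<phi> = p" "pdiff2 \<phi> = q"
    using has_partials_pdiff[OF assms(1)] by auto
  ultimately show ?thesis using assms(2,3) by (simp add: C_k.simps(2))
qed

lemma C_k_SucD:
  assumes "C_k (Suc k) \<phi>"
  shows "has_partials \<phi> (pdiff1 \<phi> z) (pdiff2 \<phi> z) z" and "C_k k (pdiff1 \<phi>)" and "C_k k (pdiff2 \<phi>)"
proof -
  have "\<phi> differentiable (at z)"
    using assms differentiable_on_eq_differentiable_at[of UNIV \<phi>] unfolding C_k.simps(2) by blast
  then show "has_partials \<phi> (pdiff1 \<phi> z) (pdiff2 \<phi> z) z" by (rule differentiable_has_partials)
  show "C_k k (pdiff1 \<phi>)" "C_k k (pdiff2 \<phi>)" using assms by (simp_all add: C_k.simps(2))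
qed

lemma C_k_SucD': "C_k (Suc k) \<phi> \<Longrightarrow> C_k k \<phi>"
proof (induction k arbitrary: \<phi>)
  case 0
  then show ?case by (auto simp: C_k.simps(2) intro: differentiable_imp_continuous_on)
next
  case (Suc k)
  have "C_k k (pdiff1 \<phi>)" "C_k k (pdiff2 \<phi>)"
    by (auto intro: Suc.IH C_k_SucD(2,3)[OF Suc.prems])
  then show ?case by (rule C_k_SucI[OF C_k_SucD(1)[OF Suc.prems]])
qed

lemma C_k_continuous: "C_k k \<phi> \<Longrightarrow> continuous_on S \<phi>"
proof (induction k)
  case 0
  then show ?case by (auto intro: continuous_on_subset)
next
  case (Suc k)
  then show ?case using C_k_SucD'[of k \<phi>] by blast
qed

lemma C_k_const: "C_k k (\<lambda>_. r)"
  by (induction k arbitrary: r) (auto intro!: continuous_intros C_k_SucI[of _ "\<lambda>_. 0" "\<lambda>_. 0"] has_partials_const)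

lemma C_k_fst: "C_k k fst"
  by (cases k) (auto intro!: C_k_SucI[of _ "\<lambda>_. 1" "\<lambda>_. 0"] has_partials_fst C_k_const continuous_intros)

lemma C_k_snd: "C_k k snd"
  by (cases k) (auto intro!: C_k_SucI[of _ "\<lambda>_. 0" "\<lambda>_. 1"] has_partials_snd C_k_const continuous_intros)

lemma C_k_add: "C_k k f \<Longrightarrow> C_k k g \<Longrightarrow> C_k k (\<lambda>z. f z + g z)"
proof (induction k arbitrary: f g)
  case 0
  then show ?case by (auto intro: continuous_intros)
next
  case (Suc k)
  note f = C_k_SucD[OF Suc.prems(1)] and g = C_k_SucD[OF Suc.prems(2)]
  show ?case
    by (rule C_k_SucI[OF has_partials_add[OF f(1) g(1)]]) (intro Suc.IH f(2,3) g(2,3))+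
qed

lemma C_k_mult: "C_k k f \<Longrightarrow> C_k k g \<Longrightarrow> C_k k (\<lambda>z. f z * g z)"
proof (induction k arbitrary: f g)
  case 0
  then show ?case by (auto intro: continuous_intros)
next
  case (Suc k)
  note f = C_k_SucD[OF Suc.prems(1)] C_k_SucD'[OF Suc.prems(1)]
  note g = C_k_SucD[OF Suc.prems(2)] C_k_SucD'[OF Suc.prems(2)]
  show ?case
    by (rule C_k_SucI[OF has_partials_mult[OF f(1) g(1)]]) (intro C_k_add Suc.IH f(2,3,4) g(2,3,4))+
qed

lemma C_k_affine_comp:
  "C_k k f \<Longrightarrow> C_k k (\<lambda>z. f (a * fst z + b * snd z + s, c * fst z + d * snd z + t))"
proof (induction k arbitrary: f)
  case 0
  then have f: "continuous_on UNIV f" by simp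
  have "continuous_on UNIV (\<lambda>z::plane. (a * fst z + b * snd z + s, c * fst z + d * snd z + t))"
    by (intro continuous_intros)
  then have "continuous_on UNIV (\<lambda>z::plane. f (a * fst z + b * snd z + s, c * fst z + d * snd z + t))"
    by (rule continuous_on_compose2[OF f]) simp
  then show ?case by simp
next
  case (Suc k)
  have 1: "has_partials (\<lambda>z. a * fst z + b * snd z + s) a b z" for a b s z
    unfolding has_partials_def by (auto intro!: derivative_eq_intros)
  show ?case
    by (rule C_k_SucI[OF has_partials_plane_comp[OF C_k_SucD(1)[OF Suc.prems] 1 1]])
       (intro C_k_add C_k_mult C_k_const Suc.IH C_k_SucD(2,3)[OF Suc.prems])+
qed

lemma smooth_const: "smooth (\<lambda>_. r)" and smooth_fst: "smooth fst" and smooth_snd: "smooth snd"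
  by (simp_all add: smooth_def C_k_const C_k_fst C_k_snd)

lemma smooth_add: "smooth f \<Longrightarrow> smooth g \<Longrightarrow> smooth (\<lambda>z. f z + g z)"
  and smooth_mult: "smooth f \<Longrightarrow> smooth g \<Longrightarrow> smooth (\<lambda>z. f z * g z)"
  by (simp_all add: smooth_def C_k_add C_k_mult)

lemma smooth_sum: "(\<And>i. i \<in> I \<Longrightarrow> smooth (f i)) \<Longrightarrow> smooth (\<lambda>z. \<Sum>i\<in>I. f i z)"
  by (induction I rule: infinite_finite_induct) (auto intro: smooth_const smooth_add)

lemma smooth_power: "smooth f \<Longrightarrow> smooth (\<lambda>z. f z ^ n)"
  by (induction n) (auto intro: smooth_const smooth_mult)

lemma smooth_diff: "smooth f \<Longrightarrow> smooth g \<Longrightarrow> smooth (\<lambda>z. f z - g z)"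
  using smooth_add[OF _ smooth_mult[OF smooth_const[of "-1"], of g], of f] by simp

lemma smooth_partials: "smooth \<phi> \<Longrightarrow> has_partials \<phi> (pdiff1 \<phi> z) (pdiff2 \<phi> z) z"
  unfolding smooth_def using C_k_SucD(1) by blast

lemma smooth_pdiff1: "smooth \<phi> \<Longrightarrow> smooth (pdiff1 \<phi>)"
  and smooth_pdiff2: "smooth \<phi> \<Longrightarrow> smooth (pdiff2 \<phi>)"
  unfolding smooth_def using C_k_SucD(2,3) by blast+

lemma smooth_continuous: "smooth \<phi> \<Longrightarrow> continuous_on S \<phi>"
  unfolding smooth_def using C_k_continuous by blast

lemma smooth_pdiff_mult:
  assumes "smooth f" "smooth g"
  shows "pdiff1 (\<lambda>z. f z * g z) z = pdiff1 f z * g z + f z * pdiff1 g z"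
    and "pdiff2 (\<lambda>z. f z * g z) z = pdiff2 f z * g z + f z * pdiff2 g z"
  using has_partials_pdiff[OF has_partials_mult[OF smooth_partials[OF assms(1)] smooth_partials[OF assms(2)]]] by auto

lemma pdiff_local:
  assumes "open S" "z \<in> S" "\<And>w. w \<in> S \<Longrightarrow> f w = g w"
  shows "pdiff1 f z = pdiff1 g z" and "pdiff2 f z = pdiff2 g z"
proof -
  obtain x y where z: "z = (x, y)" by (cases z)
  have "open ((\<lambda>t. (t, y)) -` S)" "open ((\<lambda>t. (x, t)) -` S)"
    using assms(1) by (auto intro!: open_vimage continuous_intros)
  then have "eventually (\<lambda>t. f (t, y) = g (t, y)) (nhds x)" "eventually (\<lambda>t. f (x, t) = g (x, t)) (nhds y)"
    using assms(2,3) by (auto simp: eventually_nhds z)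
  then show "pdiff1 f z = pdiff1 g z" "pdiff2 f z = pdiff2 g z"
    by (auto simp: pdiff1_def pdiff2_def z intro: deriv_cong_ev)
qed

lemma test_function_smooth: "\<phi> \<in> test_functions S \<Longrightarrow> smooth \<phi>"
  by (simp add: test_functions_def)

lemma test_function_mono: "S \<subseteq> T \<Longrightarrow> test_functions S \<subseteq> test_functions T"
  by (auto simp: test_functions_def)

lemma test_functionI:
  assumes "smooth \<phi>" "compact C" "C \<subseteq> S" "\<And>z. z \<notin> C \<Longrightarrow> \<phi> z = 0"
  shows "\<phi> \<in> test_functions S"
proof -
  have "closure {x. \<phi> x \<noteq> 0} \<subseteq> C"
    using assms by (intro closure_minimal compact_imp_closed) auto
  then show ?thesis
    using assms by (auto simp: test_functions_def compact_eq_bounded_closed intro: bounded_subset)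
qed

lemma test_function_support:
  assumes "\<phi> \<in> test_functions S"
  obtains C where "compact C" "C \<subseteq> S"
    "\<And>z. z \<notin> C \<Longrightarrow> \<phi> z = 0" "\<And>z. z \<notin> C \<Longrightarrow> pdiff1 \<phi> z = 0" "\<And>z. z \<notin> C \<Longrightarrow> pdiff2 \<phi> z = 0"
proof -
  define C where "C = closure {x. \<phi> x \<noteq> 0}"
  have C: "compact C" "C \<subseteq> S" using assms by (auto simp: test_functions_def C_def)
  have 0: "\<phi> z = 0" if "z \<notin> C" for z
    using that closure_subset[of "{x. \<phi> x \<noteq> 0}"] unfolding C_def by blast
  have pd0: "pdiff1 (\<lambda>_. 0) z = 0" "pdiff2 (\<lambda>_. 0) z = 0" for z
    by (rule has_partials_pdiff[OF has_partials_const[of 0]])+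
  have *: "open (- C)" using C by (simp add: compact_imp_closed open_Compl)
  have "pdiff1 \<phi> z = 0" "pdiff2 \<phi> z = 0" if "z \<notin> C" for z
    using pdiff_local[OF *, of z \<phi> "\<lambda>_. 0"] that by (simp_all add: pd0 0)
  then show thesis using that C 0 by blast
qed

section \<open>Smooth cutoffs of powers\<close>

text \<open>
  The family is closed under differentiation up to linear combinations, and each member vanishes
  to infinite order at \<open>c\<close>; this makes all of them smooth.
\<close>
definition cutoff :: "real \<Rightarrow> real \<Rightarrow> nat \<Rightarrow> real \<Rightarrow> real" where
  "cutoff c \<gamma> m t = (if t > c then t powr \<gamma> * exp (- (c / (t - c))) / (t - c) ^ m else 0)"

lemma exp_minus_le_power:
  fixes x :: real
  assumes "x > 0"
  shows "exp (- (1 / x)) \<le> fact n * x ^ n"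
proof -
  have "sum (\<lambda>n. (1 / x) ^ n /\<^sub>R fact n) {n} \<le> (\<Sum>n. (1 / x) ^ n /\<^sub>R fact n)"
    using assms by (intro sum_le_suminf summable_exp_generic) auto
  then have "(1 / x) ^ n / fact n \<le> exp (1 / x)" by (simp add: exp_def divide_inverse mult.commute)
  then show ?thesis using assms by (simp add: exp_minus field_simps)
qed

text \<open>
  Away from \<open>c\<close> this is calculus. At \<open>c\<close> the difference quotient tends to zero because
  \<open>exp (- (c / h))\<close> is at most a constant times \<open>h ^ (m + 2)\<close>.
\<close>
lemma cutoff_deriv:
  assumes c: "c > 0"
  shows "DERIV (cutoff c \<gamma> m) t :>
    \<gamma> * cutoff c (\<gamma> - 1) m t - real m * cutoff c \<gamma> (m + 1) t + c * cutoff c \<gamma> (m + 2) t"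
proof -
  consider "t > c" | "t < c" | "t = c" by linarith
  then show ?thesis
  proof cases
    case 1
    have ev: "eventually (\<lambda>x. t > c \<longrightarrow> x > c) (nhds t)"
      using eventually_nhds_in_open[of "{c<..}" t] 1 by (auto elim: eventually_mono)
    define r where "r = 1 / (t - c)"
    have r: "DERIV (\<lambda>x. 1 / (x - c)) t :> - (r ^ 2)"
      using 1 by (auto intro!: derivative_eq_intros simp: r_def power2_eq_square)
    have p: "DERIV (\<lambda>x. x powr \<gamma>) t :> \<gamma> * t powr (\<gamma> - 1)"
      using 1 c by (intro has_real_derivative_powr) auto
    have e: "DERIV (\<lambda>x. exp (- (c * (1 / (x - c))))) t :> exp (- (c * r)) * (c * r ^ 2)"
      by (rule derivative_eq_intros r refl | simp add: r_def)+
    have m: "DERIV (\<lambda>x. (1 / (x - c)) ^ m) t :> - real m * r ^ (m + 1)"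
    proof (cases m)
      case (Suc n)
      have "DERIV (\<lambda>x. (1 / (x - c)) ^ m) t :> real m * (- (r ^ 2) * r ^ (m - Suc 0))"
        using DERIV_power[OF r, of m] by (simp add: r_def)
      moreover have "real m * (- (r ^ 2) * r ^ (m - Suc 0)) = - real m * r ^ (m + 1)"
        by (simp add: Suc power2_eq_square algebra_simps)
      ultimately show ?thesis by (simp only:)
    qed simp
    have *: "DERIV (\<lambda>x. x powr \<gamma> * exp (- (c * (1 / (x - c)))) * (1 / (x - c)) ^ m) t :>
      (\<gamma> * t powr (\<gamma> - 1) * exp (- (c * r)) + (exp (- (c * r)) * (c * r ^ 2)) * t powr \<gamma>) * r ^ m
        + (- real m * r ^ (m + 1)) * (t powr \<gamma> * exp (- (c * r)))"
      using DERIV_mult[OF DERIV_mult[OF p e] m] by (simp add: r_def)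
    have "DERIV (\<lambda>x. x powr \<gamma> * exp (- (c / (x - c))) / (x - c) ^ m) t :>
      \<gamma> * cutoff c (\<gamma> - 1) m t - real m * cutoff c \<gamma> (m + 1) t + c * cutoff c \<gamma> (m + 2) t"
    proof -
      have v: "cutoff c g k t = t powr g * exp (- (c * r)) * r ^ k" for g k
        using 1 by (simp add: cutoff_def r_def power_one_over)
      have "(\<gamma> * t powr (\<gamma> - 1) * exp (- (c * r)) + (exp (- (c * r)) * (c * r ^ 2)) * t powr \<gamma>) * r ^ m
        + (- real m * r ^ (m + 1)) * (t powr \<gamma> * exp (- (c * r)))
        = \<gamma> * cutoff c (\<gamma> - 1) m t - real m * cutoff c \<gamma> (m + 1) t + c * cutoff c \<gamma> (m + 2) t"
        by (simp add: v power2_eq_square algebra_simps)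
      moreover have "(\<lambda>x. x powr \<gamma> * exp (- (c / (x - c))) / (x - c) ^ m) =
          (\<lambda>x. x powr \<gamma> * exp (- (c * (1 / (x - c)))) * (1 / (x - c)) ^ m)"
        by (auto simp: power_one_over)
      ultimately show ?thesis using * by (simp only:)
    qed
    moreover have "eventually (\<lambda>x. cutoff c \<gamma> m x = x powr \<gamma> * exp (- (c / (x - c))) / (x - c) ^ m) (nhds t)"
      using ev 1 by (auto elim!: eventually_mono simp: cutoff_def)
    ultimately show ?thesis by (subst DERIV_cong_ev[OF refl _ refl])
  next
    case 2
    have "eventually (\<lambda>x. x < c) (nhds t)"
      using eventually_nhds_in_open[of "{..<c}" t] 2 by auto
    then have "eventually (\<lambda>x. cutoff c \<gamma> m x = 0) (nhds t)"
      by (auto elim!: eventually_mono simp: cutoff_def)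
    then show ?thesis using 2 by (subst DERIV_cong_ev[OF refl _ refl]) (auto simp: cutoff_def)
  next
    case 3
    have "((\<lambda>h. cutoff c \<gamma> m (c + h) / h) \<longlongrightarrow> 0) (at 0)"
    proof (rule Lim_null_comparison)
      show "eventually (\<lambda>h. norm (cutoff c \<gamma> m (c + h) / h) \<le>
          (c + h) powr \<gamma> * (fact (m + 2) / c ^ (m + 2)) * \<bar>h\<bar>) (at 0)"
      proof (intro always_eventually allI)
        fix h :: real
        show "norm (cutoff c \<gamma> m (c + h) / h) \<le> (c + h) powr \<gamma> * (fact (m + 2) / c ^ (m + 2)) * \<bar>h\<bar>"
        proof (cases "h > 0")
          case True
          have "exp (- (c / h)) \<le> fact (m + 2) * (h / c) ^ (m + 2)"
            using exp_minus_le_power[of "h / c" "m + 2"] True c by simp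
          then have "(c + h) powr \<gamma> * exp (- (c / h)) / (h ^ m * h) \<le>
              (c + h) powr \<gamma> * (fact (m + 2) * (h / c) ^ (m + 2)) / (h ^ m * h)"
            using True by (intro divide_right_mono mult_left_mono) auto
          also have "\<dots> = (c + h) powr \<gamma> * (fact (m + 2) / c ^ (m + 2)) * h"
            using True c by (simp add: power_divide field_simps power2_eq_square)
          finally show ?thesis using True by (simp add: cutoff_def)
        next
          case False
          have "0 \<le> (c + h) powr \<gamma> * (fact (m + 2) / c ^ (m + 2)) * \<bar>h\<bar>"
            using c by (intro mult_nonneg_nonneg divide_nonneg_nonneg) auto
          moreover have "cutoff c \<gamma> m (c + h) = 0" using False by (simp add: cutoff_def)
          ultimately show ?thesis by (simp only: norm_zero div_0)
        qed
      qed
      have "((\<lambda>h. (c + h) powr \<gamma> * (fact (m + 2) / c ^ (m + 2)) * \<bar>h\<bar>) \<longlongrightarrow>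
          (c + 0) powr \<gamma> * (fact (m + 2) / c ^ (m + 2)) * \<bar>0\<bar>) (at 0)"
        using c by (intro tendsto_intros) auto
      then show "((\<lambda>h. (c + h) powr \<gamma> * (fact (m + 2) / c ^ (m + 2)) * \<bar>h\<bar>) \<longlongrightarrow> 0) (at 0)" by simp
    qed
    then show ?thesis by (simp add: DERIV_def 3 cutoff_def)
  qed
qed

lemma smooth_cutoff:
  assumes c: "c > 0" and "smooth \<phi>"
  shows "smooth (\<lambda>z. cutoff c \<gamma> m (\<phi> z))"
proof -
  have \<phi>: "C_k k \<phi>" for k using assms by (simp add: smooth_def)
  have "C_k k (\<lambda>z. cutoff c \<gamma> m (\<phi> z))" for k
  proof (induction k arbitrary: \<gamma> m)
    case 0
    have "continuous_on UNIV (cutoff c \<gamma> m)"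
      by (rule DERIV_continuous_on[OF DERIV_subset[OF cutoff_deriv[OF c]]]) auto
    then show ?case using \<phi>[of 0] by (auto intro: continuous_on_compose2)
  next
    case (Suc k)
    have *: "(\<lambda>z. \<gamma> * cutoff c (\<gamma> - 1) m (\<phi> z) - real m * cutoff c \<gamma> (m + 1) (\<phi> z) + c * cutoff c \<gamma> (m + 2) (\<phi> z)) =
      (\<lambda>z. (\<gamma> * cutoff c (\<gamma> - 1) m (\<phi> z) + (- real m) * cutoff c \<gamma> (m + 1) (\<phi> z)) + c * cutoff c \<gamma> (m + 2) (\<phi> z))"
      by auto
    have "C_k k (\<lambda>z. \<gamma> * cutoff c (\<gamma> - 1) m (\<phi> z) - real m * cutoff c \<gamma> (m + 1) (\<phi> z) + c * cutoff c \<gamma> (m + 2) (\<phi> z))"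
      unfolding * by (intro C_k_add C_k_mult C_k_const Suc.IH)
    then show ?case
      by (intro C_k_SucI[OF has_partials_real_comp[OF cutoff_deriv[OF c] C_k_SucD(1)[OF \<phi>[of "Suc k"]]]]
            C_k_mult C_k_SucD(2,3)[OF \<phi>[of "Suc k"]])
  qed
  then show ?thesis by (simp add: smooth_def)
qed

section \<open>Integration by parts and weak derivatives\<close>

lemma indicator_scaleR_eq:
  fixes f :: "plane \<Rightarrow> real"
  assumes "\<And>z. z \<notin> S \<Longrightarrow> f z = 0"
  shows "(\<lambda>z. indicator S z *\<^sub>R f z) = f"
proof
  fix z show "indicator S z *\<^sub>R f z = f z" using assms[of z] by (cases "z \<in> S") auto
qed

lemma integral_lebesgue_on_extend:
  fixes f :: "plane \<Rightarrow> real"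
  assumes "S \<in> sets lebesgue" and "\<And>z. z \<notin> S \<Longrightarrow> f z = 0"
  shows "(LINT z|lebesgue_on S. f z) = (LINT z|lebesgue. f z)"
proof -
  have "(\<lambda>z. indicator S z *\<^sub>R f z) = f" by (rule indicator_scaleR_eq[OF assms(2)])
  then show ?thesis using assms(1) by (simp add: integral_restrict_space)
qed

lemma integrable_lebesgue_on_extend:
  fixes f :: "plane \<Rightarrow> real"
  assumes "S \<in> sets lebesgue" and "\<And>z. z \<notin> S \<Longrightarrow> f z = 0"
  shows "integrable (lebesgue_on S) f \<longleftrightarrow> integrable lebesgue f"
proof -
  have "(\<lambda>z. indicator S z *\<^sub>R f z) = f" by (rule indicator_scaleR_eq[OF assms(2)])
  then show ?thesis using assms(1) by (simp add: integrable_restrict_space)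
qed

text \<open>
  Fubini reduces the claim to the fundamental theorem of calculus on each horizontal or vertical line.
\<close>
lemma integral_pdiff_compact_support:
  assumes D: "\<And>z. has_partials \<psi> (p z) (q z) z" and cont: "continuous_on UNIV p" "continuous_on UNIV q"
    and K: "compact K" "\<And>z. z \<notin> K \<Longrightarrow> \<psi> z = 0" "\<And>z. z \<notin> K \<Longrightarrow> p z = 0" "\<And>z. z \<notin> K \<Longrightarrow> q z = 0"
  shows "integrable lborel p" "integrable lborel q" "(LINT z|lborel. p z) = 0" "(LINT z|lborel. q z) = 0"
proof -
  have ind: "(\<lambda>z. indicator K z *\<^sub>R p z) = p" "(\<lambda>z. indicator K z *\<^sub>R q z) = q"
    by (rule indicator_scaleR_eq[OF K(3)] indicator_scaleR_eq[OF K(4)]; assumption)+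
  show int: "integrable lborel p" "integrable lborel q"
    using borel_integrable_compact[OF K(1) continuous_on_subset[OF cont(1)]]
      borel_integrable_compact[OF K(1) continuous_on_subset[OF cont(2)]] unfolding ind by simp_all
  obtain R where R: "\<And>z. z \<in> K \<Longrightarrow> norm z < R" and "R > 0"
    using compact_imp_bounded[OF K(1)] bounded_pos_less[of K] by blast
  have out: "(x, y) \<notin> K" if "\<bar>x\<bar> \<ge> R \<or> \<bar>y\<bar> \<ge> R" for x y
    using that R[of "(x, y)"] norm_fst_le[of x y] norm_snd_le[of y x] by auto
  have line1: "(LINT x|lborel. p (x, y)) = 0" for y
  proof -
    have "DERIV (\<lambda>x. \<psi> (x, y)) x :> p (x, y)" for x
    proof -
      have "((\<lambda>t. \<psi> (t, y)) has_derivative (\<lambda>h. fst (h, 0::real) * p (x, y) + snd (h, 0::real) * q (x, y))) (at x)"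
        by (rule has_derivative_compose[of "\<lambda>t. (t, y)" "\<lambda>h. (h, 0)" x UNIV \<psi>, OF _ D[unfolded has_partials_def]])
           (auto intro!: derivative_eq_intros)
      then show ?thesis
        unfolding has_field_derivative_def by (rule has_derivative_eq_rhs) (auto simp: mult.commute)
    qed
    moreover have c: "continuous_on UNIV (\<lambda>x. p (x, y))"
      by (rule continuous_on_compose2[OF cont(1)]) (auto intro!: continuous_intros)
    ultimately have "(LINT x|lborel. p (x, y) * indicator {- R..R} x) = \<psi> (R, y) - \<psi> (- R, y)"
      using \<open>R > 0\<close> c by (intro integral_FTC_Icc_real) (auto simp: continuous_on_eq_continuous_at)
    moreover have "p (x, y) * indicator {- R..R} x = p (x, y)" for x
    proof (cases "x \<in> {- R..R}")
      case False
      then have "(x, y) \<notin> K" by (intro out) auto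
      then show ?thesis using K(3) by simp
    qed simp
    moreover have "\<psi> (R, y) = 0" "\<psi> (- R, y) = 0" by (rule K(2)[OF out], use \<open>R > 0\<close> in simp)+
    ultimately show ?thesis by simp
  qed
  have line2: "(LINT y|lborel. q (x, y)) = 0" for x
  proof -
    have "DERIV (\<lambda>y. \<psi> (x, y)) y :> q (x, y)" for y
    proof -
      have "((\<lambda>t. \<psi> (x, t)) has_derivative (\<lambda>h. fst (0::real, h) * p (x, y) + snd (0::real, h) * q (x, y))) (at y)"
        by (rule has_derivative_compose[of "\<lambda>t. (x, t)" "\<lambda>h. (0, h)" y UNIV \<psi>, OF _ D[unfolded has_partials_def]])
           (auto intro!: derivative_eq_intros)
      then show ?thesis
        unfolding has_field_derivative_def by (rule has_derivative_eq_rhs) (auto simp: mult.commute)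
    qed
    moreover have c: "continuous_on UNIV (\<lambda>y. q (x, y))"
      by (rule continuous_on_compose2[OF cont(2)]) (auto intro!: continuous_intros)
    ultimately have "(LINT y|lborel. q (x, y) * indicator {- R..R} y) = \<psi> (x, R) - \<psi> (x, - R)"
      using \<open>R > 0\<close> c by (intro integral_FTC_Icc_real) (auto simp: continuous_on_eq_continuous_at)
    moreover have "q (x, y) * indicator {- R..R} y = q (x, y)" for y
    proof (cases "y \<in> {- R..R}")
      case False
      then have "(x, y) \<notin> K" by (intro out) auto
      then show ?thesis using K(4) by simp
    qed simp
    moreover have "\<psi> (x, R) = 0" "\<psi> (x, - R) = 0" by (rule K(2)[OF out], use \<open>R > 0\<close> in simp)+
    ultimately show ?thesis by simp
  qed
  have int': "integrable (lborel \<Otimes>\<^sub>M lborel) (\<lambda>(x, y). p (x, y))" "integrable (lborel \<Otimes>\<^sub>M lborel) (\<lambda>(x, y). q (x, y))"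
    using int by (simp_all add: lborel_prod)
  show "(LINT z|lborel. p z) = 0"
    using lborel_pair.integral_snd[OF int'(1)] line1 by (simp add: lborel_prod)
  show "(LINT z|lborel. q z) = 0"
    using lborel_pair.integral_fst[OF int'(2)] line2 by (simp add: lborel_prod)
qed

lemma continuous_locally_integrable:
  assumes "continuous_on UNIV f"
  shows "locally_integrable S f"
  unfolding locally_integrable_def
proof (intro allI impI)
  fix C :: "plane set" assume C: "compact C \<and> C \<subseteq> S"
  then have "integrable lborel (\<lambda>z. indicator C z *\<^sub>R f z)"
    using assms by (intro borel_integrable_compact) (auto intro: continuous_on_subset)
  then have "integrable lebesgue (\<lambda>z. indicator C z *\<^sub>R f z)" 
    by (subst integrable_completion) (auto dest: borel_measurable_integrable)
  then show "integrable (lebesgue_on C) f"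
    using C by (subst integrable_restrict_space) (auto simp: compact_imp_closed)
qed

lemma pdiff_simps: "pdiff (0, 0) \<phi> = \<phi>" "pdiff (1, 0) \<phi> = pdiff1 \<phi>" "pdiff (0, 1) \<phi> = pdiff2 \<phi>"
   "pdiff (Suc 0, 0) \<phi> = pdiff1 \<phi>" "pdiff (0, Suc 0) \<phi> = pdiff2 \<phi>"
  by (simp_all add: pdiff_def)

lemma smooth_has_weak_deriv:
  assumes f: "smooth f" and S: "open S"
  shows "has_weak_deriv S (1, 0) f (pdiff1 f)" and "has_weak_deriv S (0, 1) f (pdiff2 f)"
proof -
  have Sl: "S \<in> sets lebesgue" using S by auto
  have li: "locally_integrable S f" "locally_integrable S (pdiff1 f)" "locally_integrable S (pdiff2 f)"
    by (intro continuous_locally_integrable smooth_continuous smooth_pdiff1 smooth_pdiff2 f)+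
  have main: "(LINT z|lebesgue_on S. f z * pdiff1 \<phi> z) = - (LINT z|lebesgue_on S. pdiff1 f z * \<phi> z)"
    "(LINT z|lebesgue_on S. f z * pdiff2 \<phi> z) = - (LINT z|lebesgue_on S. pdiff2 f z * \<phi> z)"
    if \<phi>: "\<phi> \<in> test_functions S" for \<phi>
  proof -
    have s\<phi>: "smooth \<phi>" by (rule test_function_smooth[OF \<phi>])
    obtain C where C: "compact C" "C \<subseteq> S" and C0: "\<And>z. z \<notin> C \<Longrightarrow> \<phi> z = 0"
        "\<And>z. z \<notin> C \<Longrightarrow> pdiff1 \<phi> z = 0" "\<And>z. z \<notin> C \<Longrightarrow> pdiff2 \<phi> z = 0"
      using test_function_support[OF \<phi>] by blast
    note sm = f s\<phi> smooth_pdiff1[OF f] smooth_pdiff1[OF s\<phi>] smooth_pdiff2[OF f] smooth_pdiff2[OF s\<phi>]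
    note c = sm[THEN smooth_continuous[where S = UNIV]]
    have ibp: "(LINT z|lborel. pdiff1 f z * \<phi> z + f z * pdiff1 \<phi> z) = 0"
      "(LINT z|lborel. pdiff2 f z * \<phi> z + f z * pdiff2 \<phi> z) = 0"
      by (rule integral_pdiff_compact_support[OF has_partials_mult[OF smooth_partials[OF f] smooth_partials[OF s\<phi>]] _ _ C(1)];
          (intro continuous_intros c)?; simp add: C0)+
    have I: "integrable lborel (\<lambda>z. g z * h z)"
      if "continuous_on UNIV g" "continuous_on UNIV h" "\<And>z. z \<notin> C \<Longrightarrow> h z = 0" for g h :: "plane \<Rightarrow> real"
    proof -
      have "(\<lambda>z. indicator C z *\<^sub>R (g z * h z)) = (\<lambda>z. g z * h z)"
        by (rule indicator_scaleR_eq) (simp add: that(3))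
      moreover have "integrable lborel (\<lambda>z. indicator C z *\<^sub>R (g z * h z))"
        using that(1,2) by (intro borel_integrable_compact C(1) continuous_intros) (auto intro: continuous_on_subset)
      ultimately show ?thesis by (simp only:)
    qed
    have ext: "(LINT z|lebesgue_on S. g z * h z) = (LINT z|lborel. g z * h z)"
      if "continuous_on UNIV g" "continuous_on UNIV h" "\<And>z. z \<notin> C \<Longrightarrow> h z = 0" for g h :: "plane \<Rightarrow> real"
      using that C(2) I[OF that] by (subst integral_lebesgue_on_extend[OF Sl]) (auto simp: integral_completion)
    show "(LINT z|lebesgue_on S. f z * pdiff1 \<phi> z) = - (LINT z|lebesgue_on S. pdiff1 f z * \<phi> z)"
      "(LINT z|lebesgue_on S. f z * pdiff2 \<phi> z) = - (LINT z|lebesgue_on S. pdiff2 f z * \<phi> z)"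
      using ibp C0 c I by (simp_all add: ext)
  qed
  show "has_weak_deriv S (1, 0) f (pdiff1 f)" "has_weak_deriv S (0, 1) f (pdiff2 f)"
    unfolding has_weak_deriv_def using li main by (simp_all add: pdiff_simps)
qed

lemma test_function_bounded:
  assumes "\<phi> \<in> test_functions S"
  obtains B where "\<And>z. \<bar>\<phi> z\<bar> \<le> B" "\<And>z. \<bar>pdiff1 \<phi> z\<bar> \<le> B" "\<And>z. \<bar>pdiff2 \<phi> z\<bar> \<le> B"
proof -
  obtain C where C: "compact C" "C \<subseteq> S" and C0: "\<And>z. z \<notin> C \<Longrightarrow> \<phi> z = 0"
      "\<And>z. z \<notin> C \<Longrightarrow> pdiff1 \<phi> z = 0" "\<And>z. z \<notin> C \<Longrightarrow> pdiff2 \<phi> z = 0"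
    using test_function_support[OF assms] by blast
  have s: "smooth \<phi>" by (rule test_function_smooth[OF assms])
  have bd: "\<exists>B. \<forall>z. \<bar>h z\<bar> \<le> B" if "continuous_on UNIV h" "\<And>z. z \<notin> C \<Longrightarrow> h z = 0" for h :: "plane \<Rightarrow> real"
  proof -
    have "bounded (h ` C)"
      using compact_continuous_image[OF continuous_on_subset[OF that(1)] C(1)] compact_imp_bounded by blast
    then obtain B where B: "\<And>z. z \<in> C \<Longrightarrow> \<bar>h z\<bar> \<le> B" by (auto simp: bounded_iff)
    have "\<bar>h z\<bar> \<le> max B 0" for z using B[of z] that(2)[of z] by (cases "z \<in> C") auto
    then show ?thesis by blast
  qed
  obtain B0 where "\<And>z. \<bar>\<phi> z\<bar> \<le> B0" using bd[OF smooth_continuous[OF s] C0(1)] by blast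
  moreover obtain B1 where "\<And>z. \<bar>pdiff1 \<phi> z\<bar> \<le> B1"
    using bd[OF smooth_continuous[OF smooth_pdiff1[OF s]] C0(2)] by blast
  moreover obtain B2 where "\<And>z. \<bar>pdiff2 \<phi> z\<bar> \<le> B2"
    using bd[OF smooth_continuous[OF smooth_pdiff2[OF s]] C0(3)] by blast
  ultimately show thesis by (intro that[of "max B0 (max B1 B2)"]) (meson max.coboundedI1 max.coboundedI2)+
qed

text \<open>
  Only the values of a locally integrable function on the compact support of the test function matter.
\<close>
lemma locally_integrable_times:
  assumes u: "locally_integrable S u" and S: "open S" and C: "compact C" "C \<subseteq> S"
    and h: "continuous_on UNIV h" "\<And>z. z \<notin> C \<Longrightarrow> h z = 0"
  shows "integrable (lebesgue_on S) (\<lambda>z. u z * h z)"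
proof -
  have Sl: "S \<in> sets lebesgue" using S by auto
  have Cl: "C \<in> sets lebesgue" using C(1) by (auto simp: compact_imp_closed)
  have "bounded (h ` C)"
    using compact_continuous_image[OF continuous_on_subset[OF h(1)] C(1)] compact_imp_bounded by blast
  then obtain B where B: "\<And>z. z \<in> C \<Longrightarrow> \<bar>h z\<bar> \<le> B" by (auto simp: bounded_iff)
  have uC: "integrable (lebesgue_on C) u" using u C by (auto simp: locally_integrable_def)
  have hm: "h \<in> borel_measurable (lebesgue_on C)"
    using h(1) by (intro continuous_imp_measurable_on_sets_lebesgue) (auto intro: continuous_on_subset Cl)
  have "integrable (lebesgue_on C) (\<lambda>z. u z * h z)"
  proof (rule Bochner_Integration.integrable_bound)
    show "integrable (lebesgue_on C) (\<lambda>z. B * u z)" using uC by simp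
    show "(\<lambda>z. u z * h z) \<in> borel_measurable (lebesgue_on C)" using uC hm by auto
    show "AE z in lebesgue_on C. norm (u z * h z) \<le> norm (B * u z)"
    proof (rule AE_I2)
      fix z assume "z \<in> space (lebesgue_on C)"
      then have "\<bar>h z\<bar> \<le> \<bar>B\<bar>" using B[of z] by (simp add: space_restrict_space)
      then show "norm (u z * h z) \<le> norm (B * u z)"
        by (simp add: abs_mult mult.commute mult_right_mono)
    qed
  qed
  then have "integrable lebesgue (\<lambda>z. u z * h z)"
    using integrable_lebesgue_on_extend[OF Cl, of "\<lambda>z. u z * h z"] h(2) by auto
  then show ?thesis
    using integrable_lebesgue_on_extend[OF Sl, of "\<lambda>z. u z * h z"] h(2) C(2) by auto
qed

lemma locally_integrable_times_test:
  assumes "locally_integrable S u" "open S" "\<phi> \<in> test_functions S"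
  shows "integrable (lebesgue_on S) (\<lambda>z. u z * \<phi> z)"
    "integrable (lebesgue_on S) (\<lambda>z. u z * pdiff1 \<phi> z)"
    "integrable (lebesgue_on S) (\<lambda>z. u z * pdiff2 \<phi> z)"
proof -
  obtain C where C: "compact C" "C \<subseteq> S" and C0: "\<And>z. z \<notin> C \<Longrightarrow> \<phi> z = 0"
      "\<And>z. z \<notin> C \<Longrightarrow> pdiff1 \<phi> z = 0" "\<And>z. z \<notin> C \<Longrightarrow> pdiff2 \<phi> z = 0"
    using test_function_support[OF assms(3)] by blast
  have s: "smooth \<phi>" by (rule test_function_smooth[OF assms(3)])
  note c = s[THEN smooth_continuous] smooth_pdiff1[OF s, THEN smooth_continuous] smooth_pdiff2[OF s, THEN smooth_continuous]
  show "integrable (lebesgue_on S) (\<lambda>z. u z * \<phi> z)"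
    "integrable (lebesgue_on S) (\<lambda>z. u z * pdiff1 \<phi> z)"
    "integrable (lebesgue_on S) (\<lambda>z. u z * pdiff2 \<phi> z)"
    by (rule locally_integrable_times[OF assms(1,2) C c(1) C0(1)]
             locally_integrable_times[OF assms(1,2) C c(2) C0(2)]
             locally_integrable_times[OF assms(1,2) C c(3) C0(3)]; assumption)+
qed

lemma has_weak_deriv_mono:
  assumes "has_weak_deriv S \<alpha> u g" "T \<subseteq> S" "open S" "open T" "\<alpha> = (1, 0) \<or> \<alpha> = (0, 1)"
  shows "has_weak_deriv T \<alpha> u g"
proof -
  have Sl: "S \<in> sets lebesgue" "T \<in> sets lebesgue" using assms by auto
  have "(LINT z|lebesgue_on T. u z * pdiff \<alpha> \<phi> z) = (LINT z|lebesgue_on S. u z * pdiff \<alpha> \<phi> z)"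
    "(LINT z|lebesgue_on T. g z * \<phi> z) = (LINT z|lebesgue_on S. g z * \<phi> z)"
    if \<phi>: "\<phi> \<in> test_functions T" for \<phi>
  proof -
    obtain C where "compact C" and C: "C \<subseteq> T" and C0: "\<And>z. z \<notin> C \<Longrightarrow> \<phi> z = 0"
        "\<And>z. z \<notin> C \<Longrightarrow> pdiff1 \<phi> z = 0" "\<And>z. z \<notin> C \<Longrightarrow> pdiff2 \<phi> z = 0"
      using test_function_support[OF \<phi>] by blast
    have "(LINT z|lebesgue_on T. v z * h z) = (LINT z|lebesgue_on S. v z * h z)"
      if "\<And>z. z \<notin> C \<Longrightarrow> h z = 0" for v h :: "plane \<Rightarrow> real"
    proof -
      have "h z = 0" if "z \<notin> T" for z using that C \<open>\<And>z. z \<notin> C \<Longrightarrow> h z = 0\<close> by blast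
      moreover have "h z = 0" if "z \<notin> S" for z using that assms(2) calculation by blast
      ultimately show ?thesis
        by (simp add: integral_lebesgue_on_extend[OF Sl(1)] integral_lebesgue_on_extend[OF Sl(2)])
    qed
    from this[of \<phi>] this[of "pdiff1 \<phi>"] this[of "pdiff2 \<phi>"]
    show "(LINT z|lebesgue_on T. u z * pdiff \<alpha> \<phi> z) = (LINT z|lebesgue_on S. u z * pdiff \<alpha> \<phi> z)"
      "(LINT z|lebesgue_on T. g z * \<phi> z) = (LINT z|lebesgue_on S. g z * \<phi> z)"
      using C0 assms(5) by (auto simp: pdiff_simps)
  qed
  then show ?thesis
    using assms(1,2) test_function_mono[OF assms(2)] by (auto simp: has_weak_deriv_def locally_integrable_def)
qed

lemma has_weak_deriv_diff:
  assumes "has_weak_deriv S \<alpha> u g" "has_weak_deriv S \<alpha> v h" "open S" "\<alpha> = (1, 0) \<or> \<alpha> = (0, 1)"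
  shows "has_weak_deriv S \<alpha> (\<lambda>z. u z - v z) (\<lambda>z. g z - h z)"
proof -
  have li: "locally_integrable S u" "locally_integrable S g" "locally_integrable S v" "locally_integrable S h"
    using assms by (auto simp: has_weak_deriv_def)
  have "(LINT z|lebesgue_on S. (u z - v z) * pdiff \<alpha> \<phi> z) =
      (- 1) ^ (fst \<alpha> + snd \<alpha>) * (LINT z|lebesgue_on S. (g z - h z) * \<phi> z)"
    if \<phi>: "\<phi> \<in> test_functions S" for \<phi>
    using assms \<phi> locally_integrable_times_test[OF li(1) assms(3) \<phi>] locally_integrable_times_test[OF li(2) assms(3) \<phi>]
      locally_integrable_times_test[OF li(3) assms(3) \<phi>] locally_integrable_times_test[OF li(4) assms(3) \<phi>]
    by (auto simp: has_weak_deriv_def left_diff_distrib pdiff_simps)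
  then show ?thesis using li by (auto simp: has_weak_deriv_def locally_integrable_def)
qed

section \<open>Uniqueness and limits of weak derivatives\<close>

text \<open>
  Local integrability gives measurability on compact sets only; an open set is a countable union of
  closed boxes.
\<close>
lemma locally_integrable_measurable:
  assumes u: "locally_integrable S u" and S: "open S"
  shows "u \<in> borel_measurable (lebesgue_on S)"
proof -
  obtain D where D: "countable D" "D \<subseteq> Pow S" "\<And>X. X \<in> D \<Longrightarrow> \<exists>a b. X = cbox a b" "\<Union>D = S"
    using open_countable_Union_open_cbox[OF S] by blast
  show ?thesis
  proof (rule measurable_piecewise_restrict[OF D(1)])
    fix X assume X: "X \<in> D"
    obtain a b where ab: "X = cbox a b" using D(3)[OF X] by blast
    have XS: "X \<subseteq> S" using X D(2) by blast
    then show "X \<inter> space (lebesgue_on S) \<in> sets (lebesgue_on S)"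
      by (auto simp: space_restrict_space sets_restrict_space ab)
    have "integrable (lebesgue_on X) u"
      using u XS by (auto simp: locally_integrable_def ab)
    then have "u \<in> borel_measurable (lebesgue_on X)" by (rule borel_measurable_integrable)
    moreover have "restrict_space (lebesgue_on S) X = lebesgue_on X"
      using XS S by (simp add: restrict_restrict_space ab Int_absorb1)
    ultimately show "u \<in> borel_measurable (restrict_space (lebesgue_on S) X)" by simp
  qed (use D(4) in \<open>simp add: space_restrict_space\<close>)
qed

definition bump :: "real \<Rightarrow> plane \<Rightarrow> plane \<Rightarrow> plane \<Rightarrow> real" where
  "bump c l u z =
     (cutoff c 0 0 (fst z - fst l + c) * cutoff c 0 0 (fst u - fst z + c)) *
     (cutoff c 0 0 (snd z - snd l + c) * cutoff c 0 0 (snd u - snd z + c))"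

lemma box_plane: "z \<in> box l u \<longleftrightarrow> fst l < fst z \<and> fst z < fst u \<and> snd l < snd z \<and> snd z < (snd u::real)"
  for z :: plane
  by (cases z; cases l; cases u) (auto simp: mem_box Basis_prod_def)

lemma cutoff_shift:
  assumes "c > 0"
  shows "cutoff c 0 0 (r + c) = (if r > 0 then exp (- (c / r)) else 0)"
  using assms by (auto simp: cutoff_def)

lemma smooth_bump:
  assumes "c > 0"
  shows "smooth (bump c l u)"
proof -
  have "smooth (\<lambda>z. fst z - fst l + c)" "smooth (\<lambda>z. fst u - fst z + c)"
    "smooth (\<lambda>z. snd z - snd l + c)" "smooth (\<lambda>z. snd u - snd z + c)"
    by (intro smooth_add smooth_diff smooth_fst smooth_snd smooth_const)+
  then show ?thesis
    unfolding bump_def[abs_def] by (intro smooth_mult smooth_cutoff assms)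
qed

lemma bump_outside: "c > 0 \<Longrightarrow> z \<notin> box l u \<Longrightarrow> bump c l u z = 0"
  by (auto simp: bump_def cutoff_shift box_plane)

lemma bump_bounds:
  assumes "c > 0"
  shows "\<bar>bump c l u z\<bar> \<le> 1"
proof -
  have 1: "0 \<le> cutoff c 0 0 (r + c)" "cutoff c 0 0 (r + c) \<le> 1" for r
    using assms by (auto simp: cutoff_shift)
  show ?thesis unfolding bump_def abs_mult using 1 by (intro mult_le_one) auto
qed

lemma bump_limit: "(\<lambda>n. bump (1 / real (Suc n)) l u z) \<longlonglongrightarrow> indicator (box l u) z"
proof (cases "z \<in> box l u")
  case True
  have lim: "(\<lambda>n. cutoff (1 / real (Suc n)) 0 0 (r + 1 / real (Suc n))) \<longlonglongrightarrow> 1" if "r > 0" for r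
  proof -
    have "(\<lambda>n. exp (- (1 / real (Suc n) * (1 / r)))) \<longlonglongrightarrow> exp (- (0 * (1 / r)))"
      by (intro tendsto_intros lim_1_over_n[THEN LIMSEQ_Suc])
    then show ?thesis using that by (simp add: cutoff_shift)
  qed
  have "(\<lambda>n. bump (1 / real (Suc n)) l u z) \<longlonglongrightarrow> (1 * 1) * (1 * 1)"
    unfolding bump_def using True by (intro tendsto_mult lim) (auto simp: box_plane)
  then show ?thesis using True by simp
qed (simp add: bump_outside)

text \<open>
  Testing with smooth bumps that increase to the indicator of a box shows that the integral over
  every box vanishes.
\<close>
lemma test_orthogonal_box_integral:
  assumes h: "locally_integrable S h" and S: "open S"
    and orth: "\<And>\<phi>. \<phi> \<in> test_functions S \<Longrightarrow> (LINT z|lebesgue_on S. h z * \<phi> z) = 0"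
    and sub: "cbox l u \<subseteq> S"
  shows "(LINT z|lebesgue. indicator (box l u) z * h z) = 0"
proof -
  have Xl: "cbox l u \<in> sets lebesgue" by simp
  have "integrable (lebesgue_on (cbox l u)) h" using h sub by (auto simp: locally_integrable_def)
  then have hX: "integrable lebesgue (\<lambda>z. indicator (cbox l u) z * h z)"
    by (simp add: integrable_restrict_space)
  have L: "(\<lambda>n. LINT z|lebesgue. (indicator (cbox l u) z * h z) * bump (1 / real (Suc n)) l u z) \<longlonglongrightarrow>
      (LINT z|lebesgue. (indicator (cbox l u) z * h z) * indicator (box l u) z)"
  proof (rule integral_dominated_convergence)
    show "integrable lebesgue (\<lambda>z. \<bar>indicator (cbox l u) z * h z\<bar>)" using hX by simp
    have "continuous_on UNIV (bump (1 / real (Suc n)) l u)" for n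
      by (intro smooth_continuous smooth_bump) simp
    then have "bump (1 / real (Suc n)) l u \<in> borel_measurable lebesgue" for n
      by (intro borel_measurable_continuous_onI measurable_completion) (simp add: borel_measurable_continuous_onI)
    then show "(\<lambda>z. indicator (cbox l u) z * h z * bump (1 / real (Suc n)) l u z) \<in> borel_measurable lebesgue" for n
      by (rule borel_measurable_times[OF borel_measurable_integrable[OF hX]])
    show "(\<lambda>z. indicator (cbox l u) z * h z * indicator (box l u) z) \<in> borel_measurable lebesgue"
      by (rule borel_measurable_times[OF borel_measurable_integrable[OF hX] borel_measurable_indicator]) simp
    show "AE z in lebesgue. (\<lambda>n. indicator (cbox l u) z * h z * bump (1 / real (Suc n)) l u z) \<longlonglongrightarrow>
        indicator (cbox l u) z * h z * indicator (box l u) z"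
      by (intro AE_I2 tendsto_intros bump_limit)
    show "AE z in lebesgue. norm (indicator (cbox l u) z * h z * bump (1 / real (Suc n)) l u z)
        \<le> \<bar>indicator (cbox l u) z * h z\<bar>" for n
      by (intro AE_I2) (simp add: abs_mult mult_left_le bump_bounds)
  qed
  have L0: "(LINT z|lebesgue. (indicator (cbox l u) z * h z) * bump (1 / real (Suc n)) l u z) = 0" for n
  proof -
    let ?c = "1 / real (Suc n)"
    have c: "?c > 0" by simp
    have out: "bump ?c l u z = 0" if "z \<notin> cbox l u" for z
      using that box_subset_cbox[of l u] by (intro bump_outside[OF c]) blast
    have "bump ?c l u \<in> test_functions S"
      by (rule test_functionI[OF smooth_bump[OF c] compact_cbox sub out])
    then have "(LINT z|lebesgue_on S. h z * bump ?c l u z) = 0" by (rule orth)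
    moreover have "(LINT z|lebesgue_on S. h z * bump ?c l u z) = (LINT z|lebesgue. h z * bump ?c l u z)"
    proof (rule integral_lebesgue_on_extend)
      fix z assume "z \<notin> S"
      then have "z \<notin> cbox l u" using sub by blast
      then have "bump ?c l u z = 0" by (rule out)
      then show "h z * bump ?c l u z = 0" by (simp only: mult_zero_right)
    qed (use S in auto)
    moreover have "(indicator (cbox l u) z * h z) * bump ?c l u z = h z * bump ?c l u z" for z
      using out[of z] by (cases "z \<in> cbox l u") auto
    ultimately show ?thesis by (simp only:)
  qed
  have "(LINT z|lebesgue. (indicator (cbox l u) z * h z) * indicator (box l u) z) = 0"
    using L unfolding L0 by (rule LIMSEQ_unique[OF _ tendsto_const])
  moreover have "(indicator (cbox l u) z * h z) * indicator (box l u) z = indicator (box l u) z * h z" for z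
    using box_subset_cbox[of l u] by (auto simp: indicator_def)
  ultimately show ?thesis by simp
qed

text \<open>
  Boxes form an intersection-stable generator of the Borel sets, so by Dynkin's lemma the integral over
  every Borel set vanishes.
\<close>
lemma integral_boxes_zero_imp_AE_zero:
  fixes H :: "plane \<Rightarrow> real"
  assumes H: "integrable lborel H" and box0: "\<And>l u. (LINT z|lborel. indicator (box l u) z * H z) = 0"
  shows "AE z in lborel. H z = 0"
proof -
  have int: "integrable lborel (\<lambda>z. indicator A z * H z)" if "A \<in> sets borel" for A
    using integrable_mult_indicator[of A lborel H] that H by simp
  have UN0: "(LINT z|lborel. indicator (\<Union>i. A i) z * H z) = 0"
    if A: "\<And>i::nat. A i \<in> sets borel" "disjoint_family A" "\<And>i. (LINT z|lborel. indicator (A i) z * H z) = 0" for A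
  proof -
    have "(LINT z:(\<Union>i. A i)|lborel. H z) = (\<Sum>i. (LINT z:(A i)|lborel. H z))"
    proof (rule lebesgue_integral_countable_add)
      show "set_integrable lborel (\<Union>i. A i) H"
        using int[of "\<Union>i. A i"] A(1) by (auto simp: set_integrable_def)
    qed (use A in \<open>auto simp: disjoint_family_on_def\<close>)
    then show ?thesis using A(3) by (simp add: set_lebesgue_integral_def)
  qed
  let ?A = "\<lambda>n::nat. box (- (real n *\<^sub>R One)) (real n *\<^sub>R One) :: plane set"
  have "(\<lambda>n. LINT z|lborel. indicator (?A n) z * H z) \<longlonglongrightarrow> (LINT z|lborel. indicator UNIV z * H z)"
  proof (rule integral_dominated_convergence)
    show "integrable lborel (\<lambda>z. \<bar>H z\<bar>)" using H by simp
    show "AE z in lborel. (\<lambda>n. indicator (?A n) z * H z) \<longlonglongrightarrow> indicator UNIV z * H z"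
    proof (rule AE_I2)
      fix z :: plane
      have "z \<in> (\<Union>i. ?A i)" using UN_box_eq_UNIV by auto
      then obtain N where N: "z \<in> ?A N" by blast
      have "z \<in> ?A n" if "n \<ge> N" for n
      proof -
        have "real N \<le> real n" using that by simp
        then show ?thesis using N unfolding mem_box by (auto simp: inner_simps)
      qed
      then have "eventually (\<lambda>n. indicator (?A n) z * H z = indicator UNIV z * H z) sequentially"
        by (intro eventually_sequentiallyI[of N]) (simp only: indicator_simps UNIV_I)
      then show "(\<lambda>n. indicator (?A n) z * H z) \<longlonglongrightarrow> indicator UNIV z * H z"
        by (rule tendsto_eventually)
    qed
  qed (use H int in \<open>auto simp: indicator_def\<close>)
  then have tot: "(LINT z|lborel. H z) = 0"
    using box0 LIMSEQ_unique[OF _ tendsto_const] by simp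
  have all: "(LINT z|lborel. indicator A z * H z) = 0" if "A \<in> sets borel" for A
  proof -
    have mem: "A \<in> sigma_sets UNIV (range (\<lambda>(a, b). box a b :: plane set))"
      using that by (simp add: borel_eq_box)
    have st: "Int_stable (range (\<lambda>(a, b). box a b :: plane set))"
      by (auto simp: Int_stable_def box_Int_box)
    have sub: "range (\<lambda>(a, b). box a b :: plane set) \<subseteq> Pow UNIV" by simp
    show ?thesis
      using st sub mem
    proof (induction rule: sigma_sets_induct_disjoint)
      case (basic A) then show ?case using box0 by auto
    next
      case empty then show ?case by simp
    next
      case (compl A)
      then have A: "A \<in> sets borel" by (simp add: borel_eq_box)
      have "indicator (UNIV - A) z * H z = H z - indicator A z * H z" for z
        by (auto simp: indicator_def)
      then show ?case using compl tot int[OF A] H by simp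
    next
      case (union A)
      then show ?case by (intro UN0) (auto simp: borel_eq_box)
    qed
  qed
  have "AE z in lborel. H z = (\<lambda>_. 0) z"
    by (rule density_unique_real) (use H all in \<open>auto simp: set_lebesgue_integral_def\<close>)
  then show ?thesis by simp
qed

text \<open>
  The fundamental lemma of the calculus of variations. On a closed box inside \<open>S\<close> the function is
  replaced by a Borel representative, to which the preceding lemma applies; countably many such boxes
  cover \<open>S\<close>.
\<close>
lemma test_orthogonal_imp_AE_zero:
  assumes h: "locally_integrable S h" and S: "open S"
    and orth: "\<And>\<phi>. \<phi> \<in> test_functions S \<Longrightarrow> (LINT z|lebesgue_on S. h z * \<phi> z) = 0"
  shows "AE z in lebesgue. z \<in> S \<longrightarrow> h z = 0"
proof -
  obtain D where D: "countable D" "D \<subseteq> Pow S" "\<And>X. X \<in> D \<Longrightarrow> \<exists>a b. X = cbox a b" "\<Union>D = S"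
    using open_countable_Union_open_cbox[OF S] by blast
  have "AE z in lebesgue. z \<in> X \<longrightarrow> h z = 0" if X: "X \<in> D" for X
  proof -
    obtain a b where ab: "X = cbox a b" using D(3)[OF X] by blast
    have XS: "cbox a b \<subseteq> S" using X D(2) ab by blast
    have "integrable (lebesgue_on (cbox a b)) h" using h XS by (auto simp: locally_integrable_def)
    then have hX: "integrable lebesgue (\<lambda>z. indicator (cbox a b) z * h z)"
      by (simp add: integrable_restrict_space)
    obtain H where Hm: "H \<in> borel_measurable lborel" and HE: "AE z in lborel. indicator (cbox a b) z * h z = H z"
      using completion_ex_borel_measurable_real[OF borel_measurable_integrable[OF hX]] by blast
    have HE': "AE z in lebesgue. indicator (cbox a b) z * h z = H z"
      using HE by (rule AE_completion)
    have Hm': "H \<in> borel_measurable lebesgue" using Hm by (rule measurable_completion)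
    have "integrable lebesgue H"
      using hX integrable_cong_AE[OF borel_measurable_integrable[OF hX] Hm' HE'] by blast
    then have Hi: "integrable lborel H" using Hm by (simp add: integrable_completion)
    have box0: "(LINT z|lborel. indicator (box l u) z * H z) = 0" for l u
    proof -
      obtain l' u' where I: "box l u \<inter> box a b = box l' u'" by (rule that[OF box_Int_box])
      have "cbox l' u' \<subseteq> S \<or> box l' u' = {}"
      proof (cases "box l' u' = {}")
        case False
        have "box l' u' \<subseteq> cbox a b" using I box_subset_cbox[of a b] by blast
        then have "closure (box l' u') \<subseteq> cbox a b" by (rule closure_minimal) (rule closed_cbox)
        then show ?thesis using XS closure_box[OF False] by blast
      qed simp
      then have z: "(LINT z|lebesgue. indicator (box l' u') z * h z) = 0"
      proof
        assume "cbox l' u' \<subseteq> S"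
        show ?thesis
          by (rule test_orthogonal_box_integral[OF h S]) (erule orth, fact)
      qed simp
      have bd: "AE z in lebesgue. z \<notin> cbox a b - box a b"
        by (rule AE_not_in) (simp add: negligible_iff_null_sets[symmetric] negligible_frontier_interval)
      have "(\<lambda>z. indicator (box l u) z * H z) \<in> borel_measurable lborel"
        using Hm by measurable
      then have "(LINT z|lborel. indicator (box l u) z * H z) = (LINT z|lebesgue. indicator (box l u) z * H z)"
        by (simp add: integral_completion)
      also have "\<dots> = (LINT z|lebesgue. indicator (box l' u') z * h z)"
      proof (rule integral_cong_AE)
        show "(\<lambda>z. indicator (box l u) z * H z) \<in> borel_measurable lebesgue"
          by (rule borel_measurable_times[OF borel_measurable_indicator Hm']) simp
        have eq: "indicator (box l' u') z * h z = indicator (box l' u') z * (indicator (cbox a b) z * h z)" for z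
        proof (cases "z \<in> box l' u'")
          case True
          then have "z \<in> cbox a b" using I box_subset_cbox[of a b] by blast
          then show ?thesis by simp
        qed simp
        show "(\<lambda>z. indicator (box l' u') z * h z) \<in> borel_measurable lebesgue"
          unfolding eq by (rule borel_measurable_times[OF borel_measurable_indicator borel_measurable_integrable[OF hX]]) simp
        show "AE z in lebesgue. indicator (box l u) z * H z = indicator (box l' u') z * h z"
          using HE' bd
        proof eventually_elim
          case (elim z)
          have i: "z \<in> box l' u' \<longleftrightarrow> z \<in> box l u \<and> z \<in> box a b" using I by blast
          have ii: "z \<in> box a b \<longleftrightarrow> z \<in> cbox a b" using elim(2) box_subset_cbox[of a b] by blast
          show ?case
            using elim(1) i ii by (cases "z \<in> cbox a b"; cases "z \<in> box l u") simp_all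
        qed
      qed
      finally show ?thesis using z by simp
    qed
    have "AE z in lebesgue. H z = 0"
      by (rule AE_completion[OF integral_boxes_zero_imp_AE_zero[OF Hi box0]])
    with HE' show ?thesis by eventually_elim (auto simp: ab indicator_def)
  qed
  then have "AE z in lebesgue. \<forall>X\<in>D. z \<in> X \<longrightarrow> h z = 0" 
    using AE_ball_countable[OF D(1), of "\<lambda>z X. z \<in> X \<longrightarrow> h z = 0" lebesgue] by blast
  then show ?thesis by eventually_elim (use D(4) in blast)
qed

lemma has_weak_deriv_unique:
  assumes "has_weak_deriv S \<alpha> u g" "has_weak_deriv S \<alpha> u g'" and S: "open S"
  shows "AE z in lebesgue. z \<in> S \<longrightarrow> g z = g' z"
proof -
  have li: "locally_integrable S g" "locally_integrable S g'" using assms by (auto simp: has_weak_deriv_def)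
  have "AE z in lebesgue. z \<in> S \<longrightarrow> g z - g' z = 0"
  proof (rule test_orthogonal_imp_AE_zero[OF _ S])
    show "locally_integrable S (\<lambda>z. g z - g' z)" using li by (auto simp: locally_integrable_def)
    fix \<phi> assume \<phi>: "\<phi> \<in> test_functions S"
    have "(LINT z|lebesgue_on S. g z * \<phi> z) = (LINT z|lebesgue_on S. g' z * \<phi> z)"
    proof -
      have "(LINT z|lebesgue_on S. u z * pdiff \<alpha> \<phi> z) = (- 1) ^ (fst \<alpha> + snd \<alpha>) * (LINT z|lebesgue_on S. g z * \<phi> z)"
        "(LINT z|lebesgue_on S. u z * pdiff \<alpha> \<phi> z) = (- 1) ^ (fst \<alpha> + snd \<alpha>) * (LINT z|lebesgue_on S. g' z * \<phi> z)"
        using assms(1,2) \<phi> unfolding has_weak_deriv_def by blast+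
      then show ?thesis by simp
    qed
    then show "(LINT z|lebesgue_on S. (g z - g' z) * \<phi> z) = 0"
      using locally_integrable_times_test(1)[OF li(1) S \<phi>] locally_integrable_times_test(1)[OF li(2) S \<phi>]
      by (simp add: left_diff_distrib)
  qed
  then show ?thesis by eventually_elim auto
qed

text \<open>
  This links the chosen representative \<^const>\<open>weak_deriv\<close> to any explicitly known weak derivative.
\<close>
lemma weak_deriv_AE:
  assumes "has_weak_deriv S \<alpha> u g" "open S" "\<alpha> \<noteq> (0, 0)"
  shows "has_weak_deriv S \<alpha> u (weak_deriv S \<alpha> u)"
    and "AE z in lebesgue. z \<in> S \<longrightarrow> weak_deriv S \<alpha> u z = g z"
proof -
  show *: "has_weak_deriv S \<alpha> u (weak_deriv S \<alpha> u)"
    using someI[of "has_weak_deriv S \<alpha> u" g] assms(1,3) by (simp add: weak_deriv_def)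
  show "AE z in lebesgue. z \<in> S \<longrightarrow> weak_deriv S \<alpha> u z = g z"
    by (rule has_weak_deriv_unique[OF * assms(1,2)])
qed

lemma integrable_imp_locally_integrable:
  assumes "integrable (lebesgue_on S) u" "S \<in> sets lebesgue"
  shows "locally_integrable S u"
  unfolding locally_integrable_def
proof (intro allI impI)
  fix C :: "plane set" assume C: "compact C \<and> C \<subseteq> S"
  have Cl: "C \<in> sets lebesgue" using C by (simp add: compact_imp_closed borel_closed)
  have "integrable lebesgue (\<lambda>z. indicator S z *\<^sub>R u z)"
    using assms by (simp add: integrable_restrict_space)
  from integrable_mult_indicator[OF Cl this]
  have "integrable lebesgue (\<lambda>z. indicator C z *\<^sub>R indicator S z *\<^sub>R u z)" .
  moreover have "indicator C z *\<^sub>R indicator S z *\<^sub>R u z = indicator C z *\<^sub>R u z" for z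
    using C by (cases "z \<in> C") auto
  ultimately have "integrable lebesgue (\<lambda>z. indicator C z *\<^sub>R u z)" by (simp only:)
  then show "integrable (lebesgue_on C) u"
    using Cl by (simp add: integrable_restrict_space)
qed

text \<open>
  The defining identity passes to the limit by dominated convergence, since test functions and their
  derivatives are bounded.
\<close>
lemma has_weak_deriv_limit:
  assumes wd: "\<And>n::nat. has_weak_deriv S \<alpha> (u n) (g n)" and S: "open S" and \<alpha>: "\<alpha> = (1, 0) \<or> \<alpha> = (0, 1)"
    and b: "integrable (lebesgue_on S) b"
    and lim: "\<And>z. z \<in> S \<Longrightarrow> (\<lambda>n. u n z) \<longlonglongrightarrow> u' z" "\<And>z. z \<in> S \<Longrightarrow> (\<lambda>n. g n z) \<longlonglongrightarrow> g' z"
    and bd: "\<And>n z. z \<in> S \<Longrightarrow> \<bar>u n z\<bar> \<le> b z" "\<And>n z. z \<in> S \<Longrightarrow> \<bar>g n z\<bar> \<le> b z"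
  shows "has_weak_deriv S \<alpha> u' g'"
proof -
  have sp: "space (lebesgue_on S) = S" by (simp add: space_restrict_space)
  have meas: "u n \<in> borel_measurable (lebesgue_on S)" "g n \<in> borel_measurable (lebesgue_on S)" for n
    using wd[of n] S by (auto simp: has_weak_deriv_def intro!: locally_integrable_measurable)
  have meas': "u' \<in> borel_measurable (lebesgue_on S)" "g' \<in> borel_measurable (lebesgue_on S)"
    by (rule borel_measurable_LIMSEQ_real[of _ u, OF _ meas(1)] borel_measurable_LIMSEQ_real[of _ g, OF _ meas(2)];
        simp add: sp lim)+
  have bd': "\<bar>u' z\<bar> \<le> b z" "\<bar>g' z\<bar> \<le> b z" if "z \<in> S" for z
    by (rule LIMSEQ_le_const2[OF tendsto_rabs[OF lim(1)[OF that]]] LIMSEQ_le_const2[OF tendsto_rabs[OF lim(2)[OF that]]];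
        simp add: bd that)+
  have int: "integrable (lebesgue_on S) u'" "integrable (lebesgue_on S) g'"
    by (rule Bochner_Integration.integrable_bound[OF b meas'(1)] Bochner_Integration.integrable_bound[OF b meas'(2)];
        intro AE_I2; simp add: sp; meson bd' abs_ge_self order_trans)+
  have lim_int: "(\<lambda>n. LINT z|lebesgue_on S. v n z * h z) \<longlonglongrightarrow> (LINT z|lebesgue_on S. v' z * h z)"
    if v: "\<And>z. z \<in> S \<Longrightarrow> (\<lambda>n. v n z) \<longlonglongrightarrow> v' z" "\<And>n z. z \<in> S \<Longrightarrow> \<bar>v n z\<bar> \<le> b z"
      "\<And>n. v n \<in> borel_measurable (lebesgue_on S)" "v' \<in> borel_measurable (lebesgue_on S)"
      and h: "continuous_on UNIV h" "\<And>z. \<bar>h z\<bar> \<le> B" for v v' h B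
  proof (rule integral_dominated_convergence)
    have hm: "h \<in> borel_measurable (lebesgue_on S)"
      using h(1) S by (intro continuous_imp_measurable_on_sets_lebesgue) (auto intro: continuous_on_subset)
    show "(\<lambda>z. v' z * h z) \<in> borel_measurable (lebesgue_on S)" "(\<lambda>z. v n z * h z) \<in> borel_measurable (lebesgue_on S)" for n
      using hm v by auto
    show "integrable (lebesgue_on S) (\<lambda>z. b z * B)" using b by simp
    show "AE z in lebesgue_on S. (\<lambda>n. v n z * h z) \<longlonglongrightarrow> v' z * h z"
      by (intro AE_I2 tendsto_intros v(1)) (simp add: sp)
    show "AE z in lebesgue_on S. norm (v n z * h z) \<le> b z * B" for n
    proof (rule AE_I2)
      fix z assume "z \<in> space (lebesgue_on S)"
      then have "\<bar>v n z\<bar> \<le> b z" by (simp add: sp v(2))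
      then show "norm (v n z * h z) \<le> b z * B"
        unfolding real_norm_def abs_mult by (intro mult_mono h(2)) auto
    qed
  qed
  have "(LINT z|lebesgue_on S. u' z * pdiff \<alpha> \<phi> z) = (- 1) ^ (fst \<alpha> + snd \<alpha>) * (LINT z|lebesgue_on S. g' z * \<phi> z)"
    if \<phi>: "\<phi> \<in> test_functions S" for \<phi>
  proof -
    have s: "smooth \<phi>" by (rule test_function_smooth[OF \<phi>])
    obtain B where B: "\<And>z. \<bar>\<phi> z\<bar> \<le> B" "\<And>z. \<bar>pdiff1 \<phi> z\<bar> \<le> B" "\<And>z. \<bar>pdiff2 \<phi> z\<bar> \<le> B"
      using test_function_bounded[OF \<phi>] by blast
    have p: "continuous_on UNIV (pdiff \<alpha> \<phi>)" "\<And>z. \<bar>pdiff \<alpha> \<phi> z\<bar> \<le> B"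
      using \<alpha> B by (auto simp: pdiff_simps intro!: smooth_continuous smooth_pdiff1 smooth_pdiff2 s)
    have 1: "(\<lambda>n. LINT z|lebesgue_on S. u n z * pdiff \<alpha> \<phi> z) \<longlonglongrightarrow> (LINT z|lebesgue_on S. u' z * pdiff \<alpha> \<phi> z)"
      by (rule lim_int[OF lim(1) bd(1) meas(1) meas'(1) p])
    have "(\<lambda>n. LINT z|lebesgue_on S. g n z * \<phi> z) \<longlonglongrightarrow> (LINT z|lebesgue_on S. g' z * \<phi> z)"
      by (rule lim_int[OF lim(2) bd(2) meas(2) meas'(2) smooth_continuous[OF s] B(1)])
    then have 2: "(\<lambda>n. (- 1) ^ (fst \<alpha> + snd \<alpha>) * (LINT z|lebesgue_on S. g n z * \<phi> z)) \<longlonglongrightarrow>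
        (- 1) ^ (fst \<alpha> + snd \<alpha>) * (LINT z|lebesgue_on S. g' z * \<phi> z)"
      by (intro tendsto_intros)
    have "(LINT z|lebesgue_on S. u n z * pdiff \<alpha> \<phi> z) = (- 1) ^ (fst \<alpha> + snd \<alpha>) * (LINT z|lebesgue_on S. g n z * \<phi> z)" for n
      using wd[of n] \<phi> by (simp add: has_weak_deriv_def)
    then show ?thesis using LIMSEQ_unique[OF 1] 2 by simp
  qed
  then show ?thesis
    using int S by (auto simp: has_weak_deriv_def intro!: integrable_imp_locally_integrable)
qed

section \<open>Sobolev norms of first order\<close>

lemma enn_sqrt_ennreal: "r \<ge> 0 \<Longrightarrow> enn_sqrt (ennreal r) = ennreal (sqrt r)"
  by (simp add: enn_sqrt_def)

lemma enn_sqrt_less_top_iff: "enn_sqrt x < top \<longleftrightarrow> x < top"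
  by (auto simp: enn_sqrt_def less_top)

lemma enn_sqrt_tendsto_0:
  assumes "X \<longlonglongrightarrow> 0"
  shows "(\<lambda>n. enn_sqrt (X n)) \<longlonglongrightarrow> 0"
proof -
  have "(\<lambda>n. enn2real (X n)) \<longlonglongrightarrow> enn2real 0"
    using assms by (intro tendsto_enn2real) auto
  then have "(\<lambda>n. ennreal (sqrt (enn2real (X n)))) \<longlonglongrightarrow> ennreal (sqrt (enn2real 0))"
    by (intro tendsto_ennrealI tendsto_real_sqrt)
  moreover have "eventually (\<lambda>n. X n < top) sequentially"
    using assms by (rule order_tendstoD) simp
  then have "eventually (\<lambda>n. ennreal (sqrt (enn2real (X n))) = enn_sqrt (X n)) sequentially"
    by eventually_elim (simp add: enn_sqrt_def less_top[symmetric])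
  ultimately show ?thesis by (simp add: tendsto_cong)
qed

lemma AE_lebesgue_on:
  assumes "open S"
  shows "(AE z in lebesgue_on S. P z) \<longleftrightarrow> (AE z in lebesgue. z \<in> S \<longrightarrow> P z)"
  using assms by (subst AE_restrict_space_iff) auto

lemma multi_indices_0: "{\<alpha>::nat \<times> nat. fst \<alpha> + snd \<alpha> \<le> 0} = {(0, 0)}"
  by auto

lemma multi_indices_1: "{\<alpha>::nat \<times> nat. fst \<alpha> + snd \<alpha> \<le> 1} = {(0, 0), (1, 0), (0, 1)}"
proof (intro set_eqI iffI)
  fix \<alpha> :: "nat \<times> nat" assume "\<alpha> \<in> {\<alpha>. fst \<alpha> + snd \<alpha> \<le> 1}"
  moreover obtain i j where "\<alpha> = (i, j)" by (cases \<alpha>)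
  ultimately show "\<alpha> \<in> {(0, 0), (1, 0), (0, 1)}" by auto
qed auto

lemma sobolev_norm_0:
  "sobolev_norm 0 S W u = enn_sqrt (\<integral>\<^sup>+ z. ennreal ((u z)\<^sup>2 * W (0, 0) z) \<partial>lebesgue_on S)"
  unfolding sobolev_norm_def multi_indices_0 by (simp add: weak_deriv_def)

lemma sobolev_norm_1:
  assumes S: "open S" and g: "has_weak_deriv S (1, 0) u g1" "has_weak_deriv S (0, 1) u g2"
  shows "sobolev_norm 1 S W u = enn_sqrt
    ((\<integral>\<^sup>+ z. ennreal ((u z)\<^sup>2 * W (0, 0) z) \<partial>lebesgue_on S) +
     (\<integral>\<^sup>+ z. ennreal ((g1 z)\<^sup>2 * W (1, 0) z) \<partial>lebesgue_on S) +
     (\<integral>\<^sup>+ z. ennreal ((g2 z)\<^sup>2 * W (0, 1) z) \<partial>lebesgue_on S))"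
proof -
  have "AE z in lebesgue_on S. weak_deriv S (1, 0) u z = g1 z" "AE z in lebesgue_on S. weak_deriv S (0, 1) u z = g2 z"
    using weak_deriv_AE(2)[OF g(1) S] weak_deriv_AE(2)[OF g(2) S] by (simp_all add: AE_lebesgue_on[OF S])
  then have "(\<integral>\<^sup>+ z. ennreal ((weak_deriv S (1, 0) u z)\<^sup>2 * W (1, 0) z) \<partial>lebesgue_on S) = (\<integral>\<^sup>+ z. ennreal ((g1 z)\<^sup>2 * W (1, 0) z) \<partial>lebesgue_on S)"
    "(\<integral>\<^sup>+ z. ennreal ((weak_deriv S (0, 1) u z)\<^sup>2 * W (0, 1) z) \<partial>lebesgue_on S) = (\<integral>\<^sup>+ z. ennreal ((g2 z)\<^sup>2 * W (0, 1) z) \<partial>lebesgue_on S)"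
    by (auto intro!: nn_integral_cong_AE)
  then show ?thesis
    unfolding sobolev_norm_def multi_indices_1 by (simp add: weak_deriv_def add.assoc)
qed

lemma weakly_diff_1:
  assumes g: "has_weak_deriv S (1, 0) u g1" "has_weak_deriv S (0, 1) u g2"
  shows "weakly_diff 1 S u"
proof -
  have "has_weak_deriv S (0, 0) u u" using g by (simp add: has_weak_deriv_def pdiff_simps)
  then have "\<exists>g. has_weak_deriv S \<alpha> u g" if "\<alpha> \<in> {(0, 0), (1, 0), (0, 1)}" for \<alpha>
    using that g by blast
  then show ?thesis unfolding weakly_diff_def using multi_indices_1 by blast
qed

lemma weakly_diff_1_derivs:
  assumes "weakly_diff 1 S u" and S: "open S"
  shows "has_weak_deriv S (1, 0) u (weak_deriv S (1, 0) u)" "has_weak_deriv S (0, 1) u (weak_deriv S (0, 1) u)"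
proof -
  obtain g1 g2 where "has_weak_deriv S (1, 0) u g1" "has_weak_deriv S (0, 1) u g2"
    using assms(1) unfolding weakly_diff_def by (metis add_0 add.right_neutral fst_conv snd_conv le_refl)
  then show "has_weak_deriv S (1, 0) u (weak_deriv S (1, 0) u)" "has_weak_deriv S (0, 1) u (weak_deriv S (0, 1) u)"
    using S by (auto intro: weak_deriv_AE(1))
qed

lemma has_weak_deriv_measurable:
  "has_weak_deriv S \<alpha> u g \<Longrightarrow> open S \<Longrightarrow> g \<in> borel_measurable (lebesgue_on S)"
  by (intro locally_integrable_measurable) (simp_all add: has_weak_deriv_def)

lemma H1_weak_deriv_square_integrable:
  assumes u: "u \<in> Hk_space 1 S" and S: "open S"
  shows "square_integrable (lebesgue_on S) (weak_deriv S (1, 0) u)" "square_integrable (lebesgue_on S) (weak_deriv S (0, 1) u)"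
proof -
  have wd: "weakly_diff 1 S u" and fin: "Hk_norm 1 S u < top" using u by (auto simp: Hk_space_def)
  note g = weakly_diff_1_derivs[OF wd S]
  note m = has_weak_deriv_measurable[OF g(1) S] has_weak_deriv_measurable[OF g(2) S]
  have "(\<integral>\<^sup>+ z. ennreal ((weak_deriv S (1, 0) u z)\<^sup>2) \<partial>lebesgue_on S) < top"
    "(\<integral>\<^sup>+ z. ennreal ((weak_deriv S (0, 1) u z)\<^sup>2) \<partial>lebesgue_on S) < top"
    using fin unfolding sobolev_norm_1[OF S g] enn_sqrt_less_top_iff by simp_all
  then show "square_integrable (lebesgue_on S) (weak_deriv S (1, 0) u)" "square_integrable (lebesgue_on S) (weak_deriv S (0, 1) u)"
    using m by (auto simp: square_integrable_def integrable_iff_bounded)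
qed

lemma energy_eq:
  assumes S: "open S" and u: "has_weak_deriv S (1, 0) u g1" "has_weak_deriv S (0, 1) u g2"
    and v: "has_weak_deriv S (1, 0) v h1" "has_weak_deriv S (0, 1) v h2"
  shows "energy S u v = (LINT z|lebesgue_on S. g1 z * h1 z + g2 z * h2 z)"
proof -
  note m = has_weak_deriv_measurable[OF u(1) S] has_weak_deriv_measurable[OF u(2) S]
    has_weak_deriv_measurable[OF v(1) S] has_weak_deriv_measurable[OF v(2) S]
  note w = weak_deriv_AE[OF u(1) S] weak_deriv_AE[OF u(2) S] weak_deriv_AE[OF v(1) S] weak_deriv_AE[OF v(2) S]
  note m' = w(1)[THEN has_weak_deriv_measurable] w(3)[THEN has_weak_deriv_measurable]
    w(5)[THEN has_weak_deriv_measurable] w(7)[THEN has_weak_deriv_measurable]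
  have "energy S u v = (LINT z|lebesgue_on S. weak_deriv S (1, 0) u z * weak_deriv S (1, 0) v z
      + weak_deriv S (0, 1) u z * weak_deriv S (0, 1) v z)"
    by (simp add: energy_def weak_grad_def)
  also have "\<dots> = (LINT z|lebesgue_on S. g1 z * h1 z + g2 z * h2 z)"
  proof (rule integral_cong_AE)
    show "(\<lambda>z. weak_deriv S (1, 0) u z * weak_deriv S (1, 0) v z + weak_deriv S (0, 1) u z * weak_deriv S (0, 1) v z)
        \<in> borel_measurable (lebesgue_on S)"
      using m' S by (intro borel_measurable_add borel_measurable_times) auto
    show "(\<lambda>z. g1 z * h1 z + g2 z * h2 z) \<in> borel_measurable (lebesgue_on S)"
      using m by (intro borel_measurable_add borel_measurable_times) auto
    show "AE z in lebesgue_on S. weak_deriv S (1, 0) u z * weak_deriv S (1, 0) v z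
      + weak_deriv S (0, 1) u z * weak_deriv S (0, 1) v z = g1 z * h1 z + g2 z * h2 z"
    proof -
      have "AE z in lebesgue. z \<in> S \<longrightarrow> weak_deriv S (1, 0) u z = g1 z"
        "AE z in lebesgue. z \<in> S \<longrightarrow> weak_deriv S (0, 1) u z = g2 z"
        "AE z in lebesgue. z \<in> S \<longrightarrow> weak_deriv S (1, 0) v z = h1 z"
        "AE z in lebesgue. z \<in> S \<longrightarrow> weak_deriv S (0, 1) v z = h2 z"
        using w by simp_all
      then show ?thesis unfolding AE_lebesgue_on[OF S] by eventually_elim simp
    qed
  qed
  finally show ?thesis .
qed

text \<open>
  A criterion for membership in the spaces that are defined as closures of smooth functions: pointwise
  convergence of the functions and their first derivatives, together with an integrable bound for the
  weighted squares of the differences.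
\<close>
lemma sobolev_norm_1_tendsto_0:
  assumes S: "open S" and u: "has_weak_deriv S (1, 0) u g1" "has_weak_deriv S (0, 1) u g2"
    and \<phi>: "\<And>n. smooth (\<phi> n)"
    and lim: "\<And>z. z \<in> S \<Longrightarrow> (\<lambda>n. \<phi> n z) \<longlonglongrightarrow> u z" "\<And>z. z \<in> S \<Longrightarrow> (\<lambda>n. pdiff1 (\<phi> n) z) \<longlonglongrightarrow> g1 z"
      "\<And>z. z \<in> S \<Longrightarrow> (\<lambda>n. pdiff2 (\<phi> n) z) \<longlonglongrightarrow> g2 z"
    and W: "\<And>\<alpha>. W \<alpha> \<in> borel_measurable (lebesgue_on S)"
    and H: "integrable (lebesgue_on S) H"
    and bd: "\<And>n z. z \<in> S \<Longrightarrow> (u z - \<phi> n z)\<^sup>2 * W (0, 0) z \<le> H z"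
      "\<And>n z. z \<in> S \<Longrightarrow> (g1 z - pdiff1 (\<phi> n) z)\<^sup>2 * W (1, 0) z \<le> H z"
      "\<And>n z. z \<in> S \<Longrightarrow> (g2 z - pdiff2 (\<phi> n) z)\<^sup>2 * W (0, 1) z \<le> H z"
  shows "(\<lambda>n. sobolev_norm 1 S W (\<lambda>z. u z - \<phi> n z)) \<longlonglongrightarrow> 0"
proof -
  have sp: "space (lebesgue_on S) = S" by (simp add: space_restrict_space)
  have conv: "(\<lambda>n. \<integral>\<^sup>+ z. ennreal ((a z - b n z)\<^sup>2 * w z) \<partial>lebesgue_on S) \<longlonglongrightarrow> 0"
    if m: "a \<in> borel_measurable (lebesgue_on S)" "\<And>n. b n \<in> borel_measurable (lebesgue_on S)" "w \<in> borel_measurable (lebesgue_on S)"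
      and l: "\<And>z. z \<in> S \<Longrightarrow> (\<lambda>n. b n z) \<longlonglongrightarrow> a z" and d: "\<And>n z. z \<in> S \<Longrightarrow> (a z - b n z)\<^sup>2 * w z \<le> H z"
    for a w :: "plane \<Rightarrow> real" and b
  proof -
    have "(\<lambda>n. \<integral>\<^sup>+ z. ennreal ((a z - b n z)\<^sup>2 * w z) \<partial>lebesgue_on S) \<longlonglongrightarrow> (\<integral>\<^sup>+ z. 0 \<partial>lebesgue_on S)"
    proof (rule nn_integral_dominated_convergence)
      show "(\<integral>\<^sup>+ z. ennreal \<bar>H z\<bar> \<partial>lebesgue_on S) < \<infinity>"
        using H by (simp add: integrable_iff_bounded)
      show "AE z in lebesgue_on S. ennreal ((a z - b n z)\<^sup>2 * w z) \<le> ennreal \<bar>H z\<bar>" for n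
      proof (rule AE_I2)
        fix z assume "z \<in> space (lebesgue_on S)"
        then have "(a z - b n z)\<^sup>2 * w z \<le> \<bar>H z\<bar>" using d[of z n] by (simp add: sp)
        then show "ennreal ((a z - b n z)\<^sup>2 * w z) \<le> ennreal \<bar>H z\<bar>" by (rule ennreal_leI)
      qed
      show "AE z in lebesgue_on S. (\<lambda>n. ennreal ((a z - b n z)\<^sup>2 * w z)) \<longlonglongrightarrow> 0"
      proof (rule AE_I2)
        fix z assume z: "z \<in> space (lebesgue_on S)"
        have "(\<lambda>n. (a z - b n z)\<^sup>2 * w z) \<longlonglongrightarrow> (a z - a z)\<^sup>2 * w z"
          using z by (intro tendsto_intros l) (simp add: sp)
        then show "(\<lambda>n. ennreal ((a z - b n z)\<^sup>2 * w z)) \<longlonglongrightarrow> 0"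
          by (metis tendsto_ennrealI diff_self power_zero_numeral mult_zero_left ennreal_0)
      qed
      show "(\<lambda>z. ennreal ((a z - b n z)\<^sup>2 * w z)) \<in> borel_measurable (lebesgue_on S)" for n
        using m by measurable
      show "(\<lambda>z. ennreal \<bar>H z\<bar>) \<in> borel_measurable (lebesgue_on S)"
        using borel_measurable_integrable[OF H] by measurable
    qed simp
    then show ?thesis by simp
  qed
  have um: "u \<in> borel_measurable (lebesgue_on S)"
    using u S by (intro locally_integrable_measurable) (simp_all add: has_weak_deriv_def)
  have cm: "h \<in> borel_measurable (lebesgue_on S)" if "smooth h" for h
    using smooth_continuous[OF that] S by (intro continuous_imp_measurable_on_sets_lebesgue) auto
  have d1: "has_weak_deriv S (1, 0) (\<lambda>z. u z - \<phi> n z) (\<lambda>z. g1 z - pdiff1 (\<phi> n) z)"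
    and d2: "has_weak_deriv S (0, 1) (\<lambda>z. u z - \<phi> n z) (\<lambda>z. g2 z - pdiff2 (\<phi> n) z)" for n
    by (rule has_weak_deriv_diff[OF u(1) smooth_has_weak_deriv(1)[OF \<phi> S] S]
        has_weak_deriv_diff[OF u(2) smooth_has_weak_deriv(2)[OF \<phi> S] S]; simp)+
  have "(\<lambda>n. (\<integral>\<^sup>+ z. ennreal ((u z - \<phi> n z)\<^sup>2 * W (0, 0) z) \<partial>lebesgue_on S) +
      (\<integral>\<^sup>+ z. ennreal ((g1 z - pdiff1 (\<phi> n) z)\<^sup>2 * W (1, 0) z) \<partial>lebesgue_on S) +
      (\<integral>\<^sup>+ z. ennreal ((g2 z - pdiff2 (\<phi> n) z)\<^sup>2 * W (0, 1) z) \<partial>lebesgue_on S)) \<longlonglongrightarrow> 0 + 0 + 0"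
    by (intro tendsto_add conv[OF um cm[OF \<phi>] W lim(1) bd(1)]
        conv[OF has_weak_deriv_measurable[OF u(1) S] cm[OF smooth_pdiff1[OF \<phi>]] W lim(2) bd(2)]
        conv[OF has_weak_deriv_measurable[OF u(2) S] cm[OF smooth_pdiff2[OF \<phi>]] W lim(3) bd(3)])
  then show ?thesis
    unfolding sobolev_norm_1[OF S d1 d2] by (intro enn_sqrt_tendsto_0) simp
qed

section \<open>A weighted inverse inequality for polynomials in one variable\<close>

lemma one_minus_square_pos: "\<bar>x\<bar> < 1 \<Longrightarrow> 0 < 1 - x\<^sup>2" for x :: real
  by (simp add: abs_square_less_1)

text \<open>
  The antiderivatives are continuous up to the boundary, and the integrands are nonnegative.
\<close>
lemma powr_gap_integrable:
  fixes \<gamma> :: real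
  assumes \<gamma>: "-1 < \<gamma>"
  shows "(\<lambda>x. (1 - x) powr \<gamma>) absolutely_integrable_on {-1..1}"
    and "(\<lambda>x. (1 + x) powr \<gamma>) absolutely_integrable_on {-1..1}"
proof -
  have 1: "((\<lambda>x. (1 - x) powr \<gamma>) has_integral
      (- ((1 - 1) powr (\<gamma> + 1) / (\<gamma> + 1)) - (- ((1 - (-1)) powr (\<gamma> + 1) / (\<gamma> + 1))))) {-1..1}"
  proof (rule fundamental_theorem_of_calculus_interior)
    show "continuous_on {-1..1} (\<lambda>x. - ((1 - x) powr (\<gamma> + 1) / (\<gamma> + 1)))"
      using \<gamma> by (intro continuous_intros continuous_on_powr') auto
    fix x :: real assume "x \<in> {-1<..<1}"
    then have "((\<lambda>x. (1 - x) powr (\<gamma> + 1)) has_real_derivative (\<gamma> + 1) * (1 - x) powr \<gamma> * (- 1)) (at x)"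
      by (auto intro!: derivative_eq_intros)
    from DERIV_minus[OF DERIV_cdivide[OF this, of "\<gamma> + 1"]]
    show "((\<lambda>x. - ((1 - x) powr (\<gamma> + 1) / (\<gamma> + 1))) has_vector_derivative (1 - x) powr \<gamma>) (at x)"
      using \<gamma> unfolding has_real_derivative_iff_has_vector_derivative[symmetric] by simp
  qed simp
  have 2: "((\<lambda>x. (1 + x) powr \<gamma>) has_integral
      (((1 + 1) powr (\<gamma> + 1) / (\<gamma> + 1)) - (((1 + (-1)) powr (\<gamma> + 1) / (\<gamma> + 1))))) {-1..1}"
  proof (rule fundamental_theorem_of_calculus_interior)
    show "continuous_on {-1..1} (\<lambda>x. ((1 + x) powr (\<gamma> + 1) / (\<gamma> + 1)))"
      using \<gamma> by (intro continuous_intros continuous_on_powr') auto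
    fix x :: real assume "x \<in> {-1<..<1}"
    then have "((\<lambda>x. (1 + x) powr (\<gamma> + 1)) has_real_derivative (\<gamma> + 1) * (1 + x) powr \<gamma> * 1) (at x)"
      by (auto intro!: derivative_eq_intros)
    from DERIV_cdivide[OF this, of "\<gamma> + 1"]
    show "((\<lambda>x. ((1 + x) powr (\<gamma> + 1) / (\<gamma> + 1))) has_vector_derivative (1 + x) powr \<gamma>) (at x)"
      using \<gamma> unfolding has_real_derivative_iff_has_vector_derivative[symmetric] by simp
  qed simp
  show "(\<lambda>x. (1 - x) powr \<gamma>) absolutely_integrable_on {-1..1}"
    "(\<lambda>x. (1 + x) powr \<gamma>) absolutely_integrable_on {-1..1}"
    using 1 2 by (auto intro!: nonnegative_absolutely_integrable_1 simp: integrable_on_def)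
qed

definition jacobi_density :: "real \<Rightarrow> real \<Rightarrow> real" where
  "jacobi_density \<gamma> x = indicator {-1<..<1} x * (1 - x\<^sup>2) powr \<gamma>"

lemma jacobi_density_nonneg [simp]: "0 \<le> jacobi_density \<gamma> x"
  by (simp add: jacobi_density_def)

lemma jacobi_density_measurable [measurable]: "jacobi_density \<gamma> \<in> borel_measurable borel"
  unfolding jacobi_density_def[abs_def] by measurable

lemma jacobi_density_integrable:
  assumes \<gamma>: "-1 < \<gamma>"
  shows "integrable lborel (jacobi_density \<gamma>)"
proof -
  have i: "integrable lborel (\<lambda>x. indicator {-1..1} x *\<^sub>R f x)"
    if "f absolutely_integrable_on {-1..1}" "f \<in> borel_measurable borel" for f :: "real \<Rightarrow> real"
    using that by (simp add: set_integrable_def integrable_completion)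
  show ?thesis
  proof (rule Bochner_Integration.integrable_bound)
    show "integrable lborel (\<lambda>x. (indicator {-1..1} x *\<^sub>R (1 - x) powr \<gamma> + indicator {-1..1} x *\<^sub>R (1 + x) powr \<gamma>)
        + indicator {-1..1} x *\<^sub>R 1)"
      by (intro Bochner_Integration.integrable_add i powr_gap_integrable[OF \<gamma>]) (auto intro: absolutely_integrable_on_const)
    show "AE x in lborel. norm (jacobi_density \<gamma> x) \<le>
      norm ((indicator {-1..1} x *\<^sub>R (1 - x) powr \<gamma> + indicator {-1..1} x *\<^sub>R (1 + x) powr \<gamma>) + indicator {-1..1} x *\<^sub>R 1)"
    proof (rule AE_I2)
      fix x :: real
      have "(1 - x\<^sup>2) powr \<gamma> \<le> (1 - x) powr \<gamma> + (1 + x) powr \<gamma> + 1" if x: "x \<in> {-1<..<1}"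
      proof (cases "\<gamma> \<ge> 0")
        case True
        have "0 < 1 - x\<^sup>2" using x by (intro one_minus_square_pos) auto
        then have "(1 - x\<^sup>2) powr \<gamma> \<le> 1 powr \<gamma>" using True by (intro powr_mono2) auto
        then show ?thesis by (simp add: add_increasing)
      next
        case False
        have f: "1 - x\<^sup>2 = (1 - x) * (1 + x)" by (simp add: power2_eq_square algebra_simps)
        show ?thesis
        proof (cases "x \<ge> 0")
          case True
          have "(1 - x) * 1 \<le> 1 - x\<^sup>2" unfolding f using x True by (intro mult_left_mono) auto
          then have "(1 - x\<^sup>2) powr \<gamma> \<le> (1 - x) powr \<gamma>" using x False by (intro powr_mono2') auto
          then show ?thesis by (smt (verit) powr_ge_zero)
        next
          case x0: False
          have "1 * (1 + x) \<le> 1 - x\<^sup>2" unfolding f using x x0 by (intro mult_right_mono) auto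
          then have "(1 - x\<^sup>2) powr \<gamma> \<le> (1 + x) powr \<gamma>" using x False by (intro powr_mono2') auto
          then show ?thesis by (smt (verit) powr_ge_zero)
        qed
      qed
      then show "norm (jacobi_density \<gamma> x) \<le>
        norm ((indicator {-1..1} x *\<^sub>R (1 - x) powr \<gamma> + indicator {-1..1} x *\<^sub>R (1 + x) powr \<gamma>) + indicator {-1..1} x *\<^sub>R 1)"
        by (auto simp: jacobi_density_def indicator_def)
    qed
  qed simp
qed

lemma poly_jacobi_integrable:
  fixes q :: "real poly"
  assumes "-1 < \<gamma>"
  shows "integrable lborel (\<lambda>x. poly q x * jacobi_density \<gamma> x)"
proof -
  have "bounded (poly q ` {-1..1})"
    by (intro compact_imp_bounded compact_continuous_image continuous_intros) simp
  then obtain B where "\<forall>y\<in>poly q ` {-1..1}. norm y \<le> B" unfolding bounded_iff by blast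
  then have B: "\<And>x. x \<in> {-1..1} \<Longrightarrow> \<bar>poly q x\<bar> \<le> B" by auto
  have [measurable]: "poly q \<in> borel_measurable borel"
    by (intro borel_measurable_continuous_onI continuous_intros)
  show ?thesis
  proof (rule Bochner_Integration.integrable_bound)
    show "integrable lborel (\<lambda>x. B * jacobi_density \<gamma> x)"
      using jacobi_density_integrable[OF assms] by simp
    show "AE x in lborel. norm (poly q x * jacobi_density \<gamma> x) \<le> norm (B * jacobi_density \<gamma> x)"
    proof (rule AE_I2)
      fix x show "norm (poly q x * jacobi_density \<gamma> x) \<le> norm (B * jacobi_density \<gamma> x)"
      proof (cases "x \<in> {-1<..<1}")
        case True
        then have "\<bar>poly q x\<bar> \<le> \<bar>B\<bar>" using B[of x] by force
        then show ?thesis by (simp add: abs_mult mult_right_mono)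
      qed (simp add: jacobi_density_def)
    qed
  qed simp
qed

definition jacobi_ip :: "real \<Rightarrow> real poly \<Rightarrow> real poly \<Rightarrow> real" where
  "jacobi_ip \<gamma> p q = (LINT x|lborel. poly (p * q) x * jacobi_density \<gamma> x)"

text \<open>
  For \<open>g\<close> a polynomial, \<open>(g * (1 - x\<^sup>2) powr \<beta>)' = jacobi_flux \<beta> g * (1 - x\<^sup>2) powr (\<beta> - 1)\<close>.
\<close>
definition jacobi_flux :: "real \<Rightarrow> real poly \<Rightarrow> real poly" where
  "jacobi_flux \<beta> p = pderiv p - monom 1 2 * pderiv p - smult (2 * \<beta>) (pCons 0 p)"

lemma poly_jacobi_flux: "poly (jacobi_flux \<beta> p) x = (1 - x\<^sup>2) * poly (pderiv p) x - 2 * \<beta> * x * poly p x"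
  by (simp add: jacobi_flux_def poly_monom algebra_simps)

text \<open>
  The Jacobi differential operator \<open>- (1 - x\<^sup>2) g'' + (2 * \<beta> + 2) * x * g' + 2 * \<beta> * g\<close>, that is the
  classical one shifted by \<open>2 * \<beta>\<close>.
\<close>
definition jacobi_operator :: "real \<Rightarrow> real poly \<Rightarrow> real poly" where
  "jacobi_operator \<beta> p = - pderiv (jacobi_flux \<beta> p)"

lemma jacobi_ip_commute: "jacobi_ip \<gamma> p q = jacobi_ip \<gamma> q p"
  by (simp add: jacobi_ip_def mult.commute)

lemma jacobi_ip_linear:
  assumes "-1 < \<gamma>"
  shows "jacobi_ip \<gamma> (p + q) r = jacobi_ip \<gamma> p r + jacobi_ip \<gamma> q r"
    and "jacobi_ip \<gamma> (smult k p) r = k * jacobi_ip \<gamma> p r"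
    and "jacobi_ip \<gamma> r (p + q) = jacobi_ip \<gamma> r p + jacobi_ip \<gamma> r q"
    and "jacobi_ip \<gamma> r (smult k p) = k * jacobi_ip \<gamma> r p"
proof -
  show *: "jacobi_ip \<gamma> (p + q) r = jacobi_ip \<gamma> p r + jacobi_ip \<gamma> q r" for p q r
    using poly_jacobi_integrable[OF assms, of "p * r"] poly_jacobi_integrable[OF assms, of "q * r"]
    by (simp add: jacobi_ip_def ring_distribs)
  show **: "jacobi_ip \<gamma> (smult k p) r = k * jacobi_ip \<gamma> p r" for p r
    by (simp add: jacobi_ip_def mult.assoc)
  show "jacobi_ip \<gamma> r (p + q) = jacobi_ip \<gamma> r p + jacobi_ip \<gamma> r q"
    "jacobi_ip \<gamma> r (smult k p) = k * jacobi_ip \<gamma> r p"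
    using *[of p q r] **[of p r] by (simp_all add: jacobi_ip_commute[of \<gamma> r])
qed

lemma jacobi_ip_nonneg: "0 \<le> jacobi_ip \<gamma> p p"
  unfolding jacobi_ip_def by (intro integral_nonneg_AE AE_I2) simp

text \<open>
  Integration by parts: \<open>jacobi_flux \<beta> p * q * (1 - x\<^sup>2) powr \<beta>\<close> vanishes at both end points because
  \<open>\<beta> > 0\<close>, and its derivative is the difference of the two integrands.
\<close>
lemma jacobi_flux_adjoint:
  assumes \<beta>: "0 < \<beta>"
  shows "jacobi_ip (\<beta> - 1) (jacobi_flux \<beta> p) (jacobi_flux \<beta> q) = jacobi_ip \<beta> (jacobi_operator \<beta> p) q"
proof -
  define G where "G x = poly (jacobi_flux \<beta> p * q) x * (1 - x\<^sup>2) powr \<beta>" for x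
  let ?g = "\<lambda>x. poly (jacobi_flux \<beta> p * jacobi_flux \<beta> q) x * (1 - x\<^sup>2) powr (\<beta> - 1)
      - poly (jacobi_operator \<beta> p * q) x * (1 - x\<^sup>2) powr \<beta>"
  have i1: "integrable lborel (\<lambda>x. poly (jacobi_flux \<beta> p * jacobi_flux \<beta> q) x * jacobi_density (\<beta> - 1) x)"
    and i2: "integrable lborel (\<lambda>x. poly (jacobi_operator \<beta> p * q) x * jacobi_density \<beta> x)"
    using \<beta> by (intro poly_jacobi_integrable; simp)+
  have "(?g has_integral (G 1 - G (-1))) {-1..1}"
  proof (rule fundamental_theorem_of_calculus_interior)
    show "continuous_on {-1..1} G"
      unfolding G_def[abs_def] using \<beta>
      by (intro continuous_intros continuous_on_powr') (auto simp: abs_square_le_1)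
    fix x :: real assume "x \<in> {-1<..<1}"
    then have pos: "0 < 1 - x\<^sup>2" by (intro one_minus_square_pos) auto
    have w: "(1 - x\<^sup>2) powr \<beta> = (1 - x\<^sup>2) * (1 - x\<^sup>2) powr (\<beta> - 1)"
      using pos by (simp add: powr_diff)
    have "((\<lambda>x. (1 - x\<^sup>2) powr \<beta>) has_real_derivative (\<beta> * (1 - x\<^sup>2) powr (\<beta> - 1) * (- 2 * x))) (at x)"
      using pos by (auto intro!: derivative_eq_intros)
    from DERIV_mult[OF poly_DERIV[of "jacobi_flux \<beta> p * q" x] this]
    have "(G has_real_derivative (poly (pderiv (jacobi_flux \<beta> p * q)) x * (1 - x\<^sup>2) powr \<beta> +
        \<beta> * (1 - x\<^sup>2) powr (\<beta> - 1) * (- 2 * x) * poly (jacobi_flux \<beta> p * q) x)) (at x)"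
      by (simp add: G_def[abs_def])
    moreover have "poly (pderiv (jacobi_flux \<beta> p * q)) x * (1 - x\<^sup>2) powr \<beta> +
        \<beta> * (1 - x\<^sup>2) powr (\<beta> - 1) * (- 2 * x) * poly (jacobi_flux \<beta> p * q) x = ?g x"
    proof -
      have "poly (jacobi_flux \<beta> q) x = (1 - x\<^sup>2) * poly (pderiv q) x - 2 * \<beta> * x * poly q x"
        by (rule poly_jacobi_flux)
      moreover have "poly (pderiv (jacobi_flux \<beta> p * q)) x =
          poly (jacobi_flux \<beta> p) x * poly (pderiv q) x + poly (pderiv (jacobi_flux \<beta> p)) x * poly q x"
        by (simp add: pderiv_mult)
      ultimately show ?thesis unfolding w by (simp add: jacobi_operator_def) (simp add: algebra_simps)
    qed
    ultimately show "(G has_vector_derivative ?g x) (at x)"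
      by (simp only: has_real_derivative_iff_has_vector_derivative)
  qed simp
  then have "(?g has_integral 0) {-1..1}" using \<beta> by (simp add: G_def)
  then have "(?g has_integral 0) {-1<..<1}"
    using has_integral_Icc_iff_Ioo by blast
  moreover have "((\<lambda>x. ?g x) has_integral (LINT x:{-1<..<1}|lebesgue. ?g x)) {-1<..<1}"
    and eq: "(LINT x:{-1<..<1}|lebesgue. ?g x) = (LINT x|lborel. poly (jacobi_flux \<beta> p * jacobi_flux \<beta> q) x * jacobi_density (\<beta> - 1) x
      - poly (jacobi_operator \<beta> p * q) x * jacobi_density \<beta> x)"
  proof -
    have I: "integrable lborel (\<lambda>x. poly (jacobi_flux \<beta> p * jacobi_flux \<beta> q) x * jacobi_density (\<beta> - 1) x
      - poly (jacobi_operator \<beta> p * q) x * jacobi_density \<beta> x)"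
      using i1 i2 by (rule Bochner_Integration.integrable_diff)
    have e: "indicator {-1<..<1} x *\<^sub>R ?g x = poly (jacobi_flux \<beta> p * jacobi_flux \<beta> q) x * jacobi_density (\<beta> - 1) x
      - poly (jacobi_operator \<beta> p * q) x * jacobi_density \<beta> x" for x
      by (simp add: jacobi_density_def indicator_def)
    show "(LINT x:{-1<..<1}|lebesgue. ?g x) = (LINT x|lborel. poly (jacobi_flux \<beta> p * jacobi_flux \<beta> q) x * jacobi_density (\<beta> - 1) x
      - poly (jacobi_operator \<beta> p * q) x * jacobi_density \<beta> x)"
      unfolding set_lebesgue_integral_def e by (rule integral_completion[OF borel_measurable_integrable[OF I]])
    have "set_integrable lebesgue {-1<..<1} ?g"
      unfolding set_integrable_def e
      using I integrable_completion[OF borel_measurable_integrable[OF I]] by blast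
    then show "((\<lambda>x. ?g x) has_integral (LINT x:{-1<..<1}|lebesgue. ?g x)) {-1<..<1}"
      by (rule has_integral_set_lebesgue)
  qed
  ultimately have "(LINT x:{-1<..<1}|lebesgue. ?g x) = 0" using has_integral_unique by blast
  with eq i1 i2 show ?thesis by (simp add: jacobi_ip_def)
qed

lemma jacobi_operator_symmetric:
  "0 < \<beta> \<Longrightarrow> jacobi_ip \<beta> (jacobi_operator \<beta> p) q = jacobi_ip \<beta> p (jacobi_operator \<beta> q)"
  by (metis jacobi_flux_adjoint jacobi_ip_commute)

text \<open>
  The operator maps \<open>x ^ n\<close> to \<open>(n + 1) * (n + 2 * \<beta>) * x ^ n\<close> plus a multiple of \<open>x ^ (n - 2)\<close>; the
  diagonal factors are its eigenvalues.
\<close>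
lemma coeff_jacobi_operator:
  "coeff (jacobi_operator \<beta> p) i = real (i + 1) * (real i + 2 * \<beta>) * coeff p i - real (i + 1) * real (i + 2) * coeff p (i + 2)"
proof -
  have "coeff (jacobi_flux \<beta> p) (Suc i) = real (i + 2) * coeff p (i + 2) - real i * coeff p i - 2 * \<beta> * coeff p i"
    by (cases i) (simp_all add: jacobi_flux_def coeff_monom_mult coeff_pderiv)
  then have "coeff (jacobi_operator \<beta> p) i =
      - (real (Suc i) * (real (i + 2) * coeff p (i + 2) - real i * coeff p i - 2 * \<beta> * coeff p i))"
    by (simp add: jacobi_operator_def coeff_pderiv)
  then show ?thesis by (simp add: algebra_simps)
qed

definition deg_below :: "nat \<Rightarrow> real poly \<Rightarrow> bool" where
  "deg_below n p \<longleftrightarrow> (\<forall>i\<ge>n. coeff p i = 0)"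

lemma deg_below_sum: "deg_below n p \<Longrightarrow> p = (\<Sum>i<n. smult (coeff p i) (monom 1 i))"
  by (rule poly_eqI) (auto simp: deg_below_def coeff_sum if_distrib cong: if_cong)

lemma jacobi_operator_deg: "deg_below n p \<Longrightarrow> deg_below n (jacobi_operator \<beta> p)"
  by (auto simp: deg_below_def coeff_jacobi_operator)

lemma jacobi_ip_sum:
  assumes "-1 < \<gamma>"
  shows "jacobi_ip \<gamma> r (\<Sum>i\<in>I. f i) = (\<Sum>i\<in>I. jacobi_ip \<gamma> r (f i))"
proof (induction I rule: infinite_finite_induct)
  case (insert x I)
  then show ?case by (simp add: jacobi_ip_linear[OF assms])
qed (simp_all add: jacobi_ip_def)

text \<open>
  The monic polynomial of degree \<open>n\<close> is \<open>x ^ n\<close> minus its orthogonal projection onto the lower monomials.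
\<close>
lemma orthogonal_polynomial_exists:
  assumes "-1 < \<gamma>"
  obtains J where "deg_below (Suc n) J" "coeff J n = 1" "\<And>h. deg_below n h \<Longrightarrow> jacobi_ip \<gamma> J h = 0"
proof -
  define M where "M = density lborel (\<lambda>x. ennreal (jacobi_density \<gamma> x))"
  have LM: "(LINT x|M. f x) = (LINT x|lborel. f x * jacobi_density \<gamma> x)" if "f \<in> borel_measurable borel" for f :: "real \<Rightarrow> real"
    using that unfolding M_def by (subst integral_density) (auto simp: mult.commute)
  have sq: "square_integrable M (\<lambda>x. x ^ i)" for i
  proof -
    have "integrable lborel (\<lambda>x. jacobi_density \<gamma> x *\<^sub>R (x ^ i)\<^sup>2)"
      using poly_jacobi_integrable[OF assms, of "monom 1 (2 * i)"]
      by (simp add: poly_monom power_mult[symmetric] mult.commute)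
    then show ?thesis unfolding square_integrable_def M_def
      by (subst integrable_density) auto
  qed
  obtain r where r: "\<And>j. j < n \<Longrightarrow> (LINT x|M. (x ^ n - (\<Sum>i<n. r i * x ^ i)) * x ^ j) = 0"
    using orthogonal_projection_exists[of "{..<n}" M "\<lambda>i x. x ^ i" "\<lambda>x. x ^ n"] sq by auto
  define J where "J = monom 1 n - (\<Sum>i<n. monom (r i) i)"
  have J: "poly J x = x ^ n - (\<Sum>i<n. r i * x ^ i)" for x
    by (simp add: J_def poly_monom poly_sum)
  have cJ: "coeff J i = (if i = n then 1 else 0) - (if i < n then r i else 0)" for i
    by (simp add: J_def coeff_sum)
  have o: "jacobi_ip \<gamma> J (monom 1 j) = 0" if "j < n" for j
    using r[OF that] by (subst (asm) LM) (auto simp: jacobi_ip_def J poly_monom)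
  show thesis
  proof
    show "deg_below (Suc n) J" "coeff J n = 1" by (auto simp: deg_below_def cJ)
    fix h assume "deg_below n h"
    then have "jacobi_ip \<gamma> J h = jacobi_ip \<gamma> J (\<Sum>i<n. smult (coeff h i) (monom 1 i))"
      using deg_below_sum by metis
    also have "\<dots> = 0" by (simp add: jacobi_ip_sum[OF assms] jacobi_ip_linear[OF assms] o)
    finally show "jacobi_ip \<gamma> J h = 0" .
  qed
qed

text \<open>
  Induction on the degree with \<open>p = c * J + h\<close>, where \<open>J\<close> is the monic orthogonal polynomial of degree
  \<open>n\<close>. By symmetry and triangularity, the images of \<open>J\<close> and \<open>h\<close> have no mixed products with \<open>h\<close>
  and \<open>J\<close>, so the quadratic form splits, and on \<open>J\<close> it is the top eigenvalue times the square norm.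
\<close>
lemma jacobi_operator_bound:
  assumes \<beta>: "0 < \<beta>" "1/2 \<le> \<beta>"
  shows "deg_below n p \<Longrightarrow> jacobi_ip \<beta> (jacobi_operator \<beta> p) p \<le> real n * (real n - 1 + 2 * \<beta>) * jacobi_ip \<beta> p p"
proof (induction n arbitrary: p)
  case 0
  then have "p = 0" by (intro poly_eqI) (simp add: deg_below_def)
  then show ?case by (simp add: jacobi_ip_def)
next
  case (Suc n)
  have b: "-1 < \<beta>" using \<beta> by simp
  note lin = jacobi_ip_linear[OF b]
  obtain J where J: "deg_below (Suc n) J" "coeff J n = 1" and orth: "\<And>h. deg_below n h \<Longrightarrow> jacobi_ip \<beta> J h = 0"
    using orthogonal_polynomial_exists[OF b] by blast
  define c where "c = coeff p n"
  define h where "h = p - smult c J"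
  define L where "L = real (Suc n) * (real n + 2 * \<beta>)"
  \<comment> \<open>the remainder has lower degree than \<open>J\<close> and is therefore orthogonal to it\<close>
  define r where "r = jacobi_operator \<beta> J - smult L J"
  have p: "p = smult c J + h" by (simp add: h_def)
  have dh: "deg_below n h"
    unfolding deg_below_def
  proof (intro allI impI)
    fix i assume "n \<le> i"
    then show "coeff h i = 0" using Suc.prems J
      by (cases "i = n") (auto simp: h_def c_def deg_below_def)
  qed
  have dr: "deg_below n r"
    unfolding deg_below_def
  proof (intro allI impI)
    fix i assume "n \<le> i"
    then show "coeff r i = 0" using J
      by (cases "i = n") (auto simp: r_def L_def deg_below_def coeff_jacobi_operator algebra_simps)
  qed
  have add: "jacobi_operator \<beta> (smult c J + h) = smult c (jacobi_operator \<beta> J) + jacobi_operator \<beta> h"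
    by (rule poly_eqI) (simp add: coeff_jacobi_operator algebra_simps)
  have MJ: "jacobi_operator \<beta> J = smult L J + r" by (simp add: r_def)
  have z: "jacobi_ip \<beta> J h = 0" "jacobi_ip \<beta> h J = 0" "jacobi_ip \<beta> J r = 0" "jacobi_ip \<beta> r J = 0"
    "jacobi_ip \<beta> (jacobi_operator \<beta> h) J = 0" "jacobi_ip \<beta> (jacobi_operator \<beta> J) h = 0"
    using orth[OF dh] orth[OF dr] orth[OF jacobi_operator_deg[OF dh]] jacobi_operator_symmetric[OF \<beta>(1), of J h]
      jacobi_ip_commute[of \<beta> h J] jacobi_ip_commute[of \<beta> r J] jacobi_ip_commute[of \<beta> "jacobi_operator \<beta> h" J] by auto
  have zJ: "jacobi_ip \<beta> (jacobi_operator \<beta> J) J = L * jacobi_ip \<beta> J J"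
    unfolding MJ by (simp add: lin z)
  have A: "jacobi_ip \<beta> (jacobi_operator \<beta> p) p = L * (c\<^sup>2 * jacobi_ip \<beta> J J) + jacobi_ip \<beta> (jacobi_operator \<beta> h) h"
    unfolding p add by (simp add: lin z zJ power2_eq_square)
  have B: "jacobi_ip \<beta> p p = c\<^sup>2 * jacobi_ip \<beta> J J + jacobi_ip \<beta> h h"
    unfolding p by (simp add: lin z power2_eq_square)
  have "real n * (real n - 1 + 2 * \<beta>) \<le> L"
    unfolding L_def using \<beta> by (intro mult_mono) auto
  then have "jacobi_ip \<beta> (jacobi_operator \<beta> h) h \<le> L * jacobi_ip \<beta> h h"
    using Suc.IH[OF dh] jacobi_ip_nonneg[of \<beta> h] by (meson mult_right_mono order_trans)
  then have "jacobi_ip \<beta> (jacobi_operator \<beta> p) p \<le> L * jacobi_ip \<beta> p p"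
    unfolding A B by (simp add: algebra_simps)
  then show ?case by (simp add: L_def add.commute)
qed

lemma weighted_inverse_inequality:
  assumes \<beta>: "1/2 \<le> \<beta>" and p: "degree p \<le> n"
  shows "(\<integral>\<^sup>+ x. ennreal ((poly (jacobi_flux \<beta> p) x)\<^sup>2 * jacobi_density (\<beta> - 1) x) \<partial>lborel)
    \<le> ennreal (real (n + 1) * (real n + 2 * \<beta>)) * (\<integral>\<^sup>+ x. ennreal ((poly p x)\<^sup>2 * jacobi_density \<beta> x) \<partial>lborel)"
proof -
  have b: "0 < \<beta>" "-1 < \<beta>" "-1 < \<beta> - 1" using \<beta> by auto
  have nn: "(\<integral>\<^sup>+ x. ennreal ((poly q x)\<^sup>2 * jacobi_density \<gamma> x) \<partial>lborel) = ennreal (jacobi_ip \<gamma> q q)" if "-1 < \<gamma>" for q \<gamma>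
    using poly_jacobi_integrable[OF that, of "q * q"]
    by (subst nn_integral_eq_integral) (auto simp: jacobi_ip_def power2_eq_square)
  have "deg_below (n + 1) p" using p by (auto simp: deg_below_def intro: coeff_eq_0)
  then have "jacobi_ip \<beta> (jacobi_operator \<beta> p) p \<le> real (n + 1) * (real n + 2 * \<beta>) * jacobi_ip \<beta> p p"
    using jacobi_operator_bound[OF b(1) \<beta>, of "n + 1" p] by (simp add: algebra_simps)
  then have "jacobi_ip (\<beta> - 1) (jacobi_flux \<beta> p) (jacobi_flux \<beta> p) \<le> real (n + 1) * (real n + 2 * \<beta>) * jacobi_ip \<beta> p p"
    by (simp add: jacobi_flux_adjoint[OF b(1)])
  then show ?thesis
    using b \<beta> unfolding nn[OF b(2)] nn[OF b(3)] by (subst ennreal_mult[symmetric]) (auto intro: ennreal_leI jacobi_ip_nonneg)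
qed

section \<open>Tensor-product polynomials\<close>

text \<open>
  The restriction of a tensor-product polynomial with coefficients \<open>c\<close> to the horizontal line at
  height \<open>y\<close>.
\<close>
definition x_section :: "nat \<Rightarrow> (nat \<Rightarrow> nat \<Rightarrow> real) \<Rightarrow> real \<Rightarrow> real poly" where
  "x_section p c y = (\<Sum>i\<le>p. monom (\<Sum>j\<le>p. c i j * y ^ j) i)"

lemma coeff_x_section: "coeff (x_section p c y) i = (if i \<le> p then \<Sum>j\<le>p. c i j * y ^ j else 0)"
  by (simp add: x_section_def coeff_sum)

lemma degree_x_section: "degree (x_section p c y) \<le> p"
  by (rule degree_le) (simp add: coeff_x_section)

lemma poly_x_section: "poly (x_section p c y) x = (\<Sum>i\<le>p. \<Sum>j\<le>p. c i j * x ^ i * y ^ j)"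
  by (simp add: x_section_def poly_sum poly_monom sum_distrib_left sum_distrib_right mult_ac)

lemma poly_eq_sum_coeff: "degree q \<le> n \<Longrightarrow> poly q x = (\<Sum>i\<le>n. coeff q i * x ^ i)" for q :: "real poly"
proof -
  assume "degree q \<le> n"
  then have "q = (\<Sum>i\<le>n. monom (coeff q i) i)"
    by (simp add: poly_as_sum_of_monoms')
  then have "poly q x = poly (\<Sum>i\<le>n. monom (coeff q i) i) x" by simp
  then show ?thesis by (simp only: poly_sum poly_monom)
qed

text \<open>
  Symmetry in the two variables; it transfers every statement about the first partial derivative to the
  second one.
\<close>
lemma Qpoly_swap: "q \<in> Qpoly p \<Longrightarrow> (\<lambda>z. q (snd z, fst z)) \<in> Qpoly p"
proof -
  assume "q \<in> Qpoly p"
  then obtain c where q: "q = (\<lambda>(x, y). \<Sum>i\<le>p. \<Sum>j\<le>p. c i j * x ^ i * y ^ j)"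
    unfolding Qpoly_def by blast
  have "(\<Sum>i\<le>p. \<Sum>j\<le>p. c i j * y ^ i * x ^ j) = (\<Sum>i\<le>p. \<Sum>j\<le>p. c j i * x ^ i * y ^ j)" for x y
    by (subst sum.swap) (simp add: mult_ac)
  then have "(\<lambda>z. q (snd z, fst z)) = (\<lambda>(x, y). \<Sum>i\<le>p. \<Sum>j\<le>p. c j i * x ^ i * y ^ j)"
    by (auto simp: q)
  then show ?thesis unfolding Qpoly_def by (intro CollectI exI[of _ "\<lambda>i j. c j i"])
qed

lemma pdiff_swap: "pdiff2 q (x, y) = pdiff1 (\<lambda>z. q (snd z, fst z)) (y, x)"
  by (simp add: pdiff1_def pdiff2_def)

lemma Qpoly_sections:
  assumes "q \<in> Qpoly p"
  shows "\<exists>P. \<forall>y. degree (P y) \<le> p \<and> (\<forall>x. q (x, y) = poly (P y) x \<and> pdiff1 q (x, y) = poly (pderiv (P y)) x)"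
proof -
  obtain c where q: "q = (\<lambda>(x, y). \<Sum>i\<le>p. \<Sum>j\<le>p. c i j * x ^ i * y ^ j)"
    using assms unfolding Qpoly_def by blast
  have 1: "q (x, y) = poly (x_section p c y) x" for x y
    by (simp add: q poly_x_section)
  then have "pdiff1 q (x, y) = poly (pderiv (x_section p c y)) x" for x y
    by (simp add: pdiff1_def DERIV_imp_deriv poly_DERIV)
  with 1 show ?thesis using degree_x_section by blast
qed

lemma Qpoly_pdiff1:
  assumes "q \<in> Qpoly p"
  shows "pdiff1 q \<in> Qpoly p"
proof -
  obtain c where q: "q = (\<lambda>(x, y). \<Sum>i\<le>p. \<Sum>j\<le>p. c i j * x ^ i * y ^ j)"
    using assms unfolding Qpoly_def by blast
  \<comment> \<open>coefficients of the derivative, padded by zero in the top degree\<close>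
  define c' where "c' i j = (if i < p then real (Suc i) * c (Suc i) j else 0)" for i j
  have "pdiff1 q (x, y) = (\<Sum>i\<le>p. \<Sum>j\<le>p. c' i j * x ^ i * y ^ j)" for x y
  proof -
    have "pdiff1 q (x, y) = poly (pderiv (x_section p c y)) x"
      by (simp add: pdiff1_def q poly_x_section[symmetric] DERIV_imp_deriv poly_DERIV)
    also have "\<dots> = (\<Sum>i\<le>p. coeff (pderiv (x_section p c y)) i * x ^ i)"
      by (rule poly_eq_sum_coeff) (use degree_x_section[of p c y] in \<open>simp add: degree_pderiv\<close>)
    also have "\<dots> = (\<Sum>i\<le>p. \<Sum>j\<le>p. c' i j * x ^ i * y ^ j)"
      by (intro sum.cong refl)
         (auto simp: coeff_pderiv coeff_x_section c'_def sum_distrib_left sum_distrib_right mult_ac)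
    finally show ?thesis .
  qed
  then show ?thesis unfolding Qpoly_def by (intro CollectI exI[of _ c']) auto
qed

lemma Qpoly_pdiff2:
  assumes "q \<in> Qpoly p"
  shows "pdiff2 q \<in> Qpoly p"
proof -
  have "pdiff2 q = (\<lambda>z. pdiff1 (\<lambda>z. q (snd z, fst z)) (snd z, fst z))"
    by (auto simp: pdiff_swap)
  then show ?thesis using Qpoly_swap[OF Qpoly_pdiff1[OF Qpoly_swap[OF assms]]] by simp
qed

lemma Qpoly_add_cmult:
  assumes "q \<in> Qpoly p" "r \<in> Qpoly p"
  shows "(\<lambda>z. q z + k * r z) \<in> Qpoly p"
proof -
  obtain c d where q: "q = (\<lambda>(x, y). \<Sum>i\<le>p. \<Sum>j\<le>p. c i j * x ^ i * y ^ j)"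
    and r: "r = (\<lambda>(x, y). \<Sum>i\<le>p. \<Sum>j\<le>p. d i j * x ^ i * y ^ j)"
    using assms unfolding Qpoly_def by blast
  have "(\<lambda>z. q z + k * r z) = (\<lambda>(x, y). \<Sum>i\<le>p. \<Sum>j\<le>p. (c i j + k * d i j) * x ^ i * y ^ j)"
    by (auto simp: q r sum_distrib_left sum.distrib[symmetric] ring_distribs mult_ac)
  then show ?thesis unfolding Qpoly_def by (intro CollectI exI[of _ "\<lambda>i j. c i j + k * d i j"])
qed

lemma Qpoly_zero: "(\<lambda>_. 0) \<in> Qpoly p"
  unfolding Qpoly_def by (intro CollectI exI[of _ "\<lambda>_ _. 0"]) auto

lemma Qpoly_monomial:
  assumes "i \<le> p" "j \<le> p"
  shows "(\<lambda>z. fst z ^ i * snd z ^ j) \<in> Qpoly p"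
proof -
  let ?c = "\<lambda>i' j'. if i' = i \<and> j' = j then 1 else (0::real)"
  have "(\<Sum>i'\<le>p. \<Sum>j'\<le>p. ?c i' j' * x ^ i' * y ^ j') = x ^ i * y ^ j" for x y :: real
  proof -
    have "(\<Sum>j'\<le>p. ?c i' j' * x ^ i' * y ^ j') = (if i' = i then x ^ i * y ^ j else 0)" for i'
      using assms(2) by (cases "i' = i") (auto simp: if_distrib[of "\<lambda>t. t * _"] cong: if_cong)
    then show ?thesis using assms(1) by simp
  qed
  then show ?thesis unfolding Qpoly_def by (intro CollectI exI[of _ ?c]) auto
qed

lemma Qpoly_smooth:
  assumes "q \<in> Qpoly p"
  shows "smooth q"
proof -
  obtain c where q: "q = (\<lambda>(x, y). \<Sum>i\<le>p. \<Sum>j\<le>p. c i j * x ^ i * y ^ j)"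
    using assms unfolding Qpoly_def by blast
  have "smooth (\<lambda>z. \<Sum>i\<le>p. \<Sum>j\<le>p. c i j * fst z ^ i * snd z ^ j)"
    by (intro smooth_sum smooth_mult smooth_const smooth_power smooth_fst smooth_snd)
  then show ?thesis by (simp add: q case_prod_beta')
qed

text \<open>
  A polynomial has finitely many roots, first on every horizontal line through the square and
  then on every vertical line.
\<close>
lemma Qpoly_zero_on_refQ:
  assumes q: "q \<in> Qpoly p" and z: "\<And>z. z \<in> refQ \<Longrightarrow> q z = 0"
  shows "q = (\<lambda>_. 0)"
proof -
  have poly0: "P = 0" if "\<And>x. x \<in> {-1<..<1} \<Longrightarrow> poly P x = 0" for P :: "real poly"
  proof (rule ccontr)
    assume "P \<noteq> 0"
    then have "finite {x. poly P x = 0}" by (rule poly_roots_finite)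
    then have "finite {-1<..<(1::real)}" by (rule finite_subset[rotated]) (use that in auto)
    then show False by (simp add: infinite_Ioo)
  qed
  have line: "r (x, y) = 0" if r: "r \<in> Qpoly p" "\<And>x. x \<in> {-1<..<1} \<Longrightarrow> r (x, y) = 0" for r x y
  proof -
    obtain P where P: "\<And>y x. r (x, y) = poly (P y) x" using Qpoly_sections[OF r(1)] by blast
    have "P y = 0" using r(2) by (intro poly0) (simp add: P)
    then show ?thesis by (simp add: P)
  qed
  have 1: "q (x, y) = 0" if "y \<in> {-1<..<1}" for x y
    by (rule line[OF q]) (use that z in \<open>simp add: refQ_def\<close>)
  have 2: "q (x, y) = 0" for x y
    using line[OF Qpoly_swap[OF q], of x y] 1 by simp
  then show ?thesis by auto
qed

section \<open>The weighted bubble of a polynomial and its smooth approximations\<close>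

definition gap :: "real \<Rightarrow> real" where "gap x = 1 - x\<^sup>2"

lemma gap_bounds: "z \<in> refQ \<Longrightarrow> 0 < gap (fst z) \<and> gap (fst z) \<le> 1 \<and> 0 < gap (snd z) \<and> gap (snd z) \<le> 1"
  using one_minus_square_pos[of "fst z"] one_minus_square_pos[of "snd z"] by (auto simp: refQ_def gap_def)

lemma open_refQ: "open refQ"
  by (simp add: refQ_def open_Times)

lemma refQ_lebesgue [simp]: "refQ \<in> sets lebesgue" "refQ \<in> sets borel"
  using open_refQ by auto

text \<open>
  The test function of the efficiency proof, extended by zero; the extension is written with an explicit
  case distinction since \<open>powr\<close> carries no useful value for a negative base.
\<close>
definition bubble :: "real \<Rightarrow> (plane \<Rightarrow> real) \<Rightarrow> plane \<Rightarrow> real" where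
  "bubble \<beta> q z = (if z \<in> refQ then q z * (gap (fst z) powr \<beta> * gap (snd z) powr \<beta>) else 0)"

text \<open>
  The first partial derivative of the bubble inside the square; \<open>bubble_dy\<close> is the second one.
\<close>
definition bubble_dx :: "real \<Rightarrow> (plane \<Rightarrow> real) \<Rightarrow> plane \<Rightarrow> real" where
  "bubble_dx \<beta> q z = (if z \<in> refQ then (gap (fst z) * pdiff1 q z - 2 * \<beta> * fst z * q z)
     * (gap (fst z) powr (\<beta> - 1) * gap (snd z) powr \<beta>) else 0)"

definition bubble_dy :: "real \<Rightarrow> (plane \<Rightarrow> real) \<Rightarrow> plane \<Rightarrow> real" where
  "bubble_dy \<beta> q z = (if z \<in> refQ then (gap (snd z) * pdiff2 q z - 2 * \<beta> * snd z * q z)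
     * (gap (fst z) powr \<beta> * gap (snd z) powr (\<beta> - 1)) else 0)"

text \<open>
  The bubble with each power \<open>t powr \<beta>\<close> replaced by a smooth function that vanishes for \<open>t \<le> c\<close>, with
  \<open>c = 1 / (n + 1)\<close>.
\<close>
definition bubble_approx :: "real \<Rightarrow> (plane \<Rightarrow> real) \<Rightarrow> nat \<Rightarrow> plane \<Rightarrow> real" where
  "bubble_approx \<beta> q n z = q z * (cutoff (1 / real (Suc n)) \<beta> 0 (gap (fst z)) * cutoff (1 / real (Suc n)) \<beta> 0 (gap (snd z)))"

text \<open>
  The derivative of \<open>cutoff c \<beta> 0\<close>.
\<close>
definition cutoff_slope :: "real \<Rightarrow> real \<Rightarrow> real \<Rightarrow> real" where
  "cutoff_slope c \<beta> t = \<beta> * cutoff c (\<beta> - 1) 0 t + c * cutoff c \<beta> 2 t"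

lemma smooth_gap: "smooth (\<lambda>z. gap (fst z))" "smooth (\<lambda>z. gap (snd z))"
  unfolding gap_def by (intro smooth_diff smooth_const smooth_power smooth_fst smooth_snd)+

lemma smooth_bubble_approx: "smooth q \<Longrightarrow> smooth (bubble_approx \<beta> q n)"
  unfolding bubble_approx_def[abs_def] by (intro smooth_mult smooth_cutoff smooth_gap) auto

lemma pdiff_bubble_approx:
  fixes n
  assumes q: "smooth q"
  defines "c \<equiv> 1 / real (Suc n)"
  shows "pdiff1 (bubble_approx \<beta> q n) z = pdiff1 q z * (cutoff c \<beta> 0 (gap (fst z)) * cutoff c \<beta> 0 (gap (snd z)))
      + q z * (- 2 * fst z * cutoff_slope c \<beta> (gap (fst z)) * cutoff c \<beta> 0 (gap (snd z)))"
    and "pdiff2 (bubble_approx \<beta> q n) z = pdiff2 q z * (cutoff c \<beta> 0 (gap (fst z)) * cutoff c \<beta> 0 (gap (snd z)))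
      + q z * (- 2 * snd z * cutoff c \<beta> 0 (gap (fst z)) * cutoff_slope c \<beta> (gap (snd z)))"
proof -
  have c: "c > 0" by (simp add: c_def)
  have D: "DERIV (cutoff c \<beta> 0) t :> cutoff_slope c \<beta> t" for t
    using cutoff_deriv[OF c, of \<beta> 0 t] by (simp add: cutoff_slope_def numeral_2_eq_2)
  have G: "DERIV gap t :> - 2 * t" for t
    unfolding gap_def[abs_def] by (auto intro!: derivative_eq_intros)
  have 1: "has_partials (\<lambda>z. cutoff c \<beta> 0 (gap (fst z))) (cutoff_slope c \<beta> (gap (fst z)) * (- 2 * fst z * 1)) (cutoff_slope c \<beta> (gap (fst z)) * (- 2 * fst z * 0)) z"
    by (rule has_partials_real_comp[OF D has_partials_real_comp[OF G has_partials_fst]])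
  have 2: "has_partials (\<lambda>z. cutoff c \<beta> 0 (gap (snd z))) (cutoff_slope c \<beta> (gap (snd z)) * (- 2 * snd z * 0)) (cutoff_slope c \<beta> (gap (snd z)) * (- 2 * snd z * 1)) z"
    by (rule has_partials_real_comp[OF D has_partials_real_comp[OF G has_partials_snd]])
  have e: "bubble_approx \<beta> q n = (\<lambda>z. q z * (cutoff c \<beta> 0 (gap (fst z)) * cutoff c \<beta> 0 (gap (snd z))))"
    by (simp add: bubble_approx_def[abs_def] c_def)
  note P = has_partials_pdiff[OF has_partials_mult[OF smooth_partials[OF q] has_partials_mult[OF 1 2]]]
  show "pdiff1 (bubble_approx \<beta> q n) z = pdiff1 q z * (cutoff c \<beta> 0 (gap (fst z)) * cutoff c \<beta> 0 (gap (snd z)))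
      + q z * (- 2 * fst z * cutoff_slope c \<beta> (gap (fst z)) * cutoff c \<beta> 0 (gap (snd z)))"
    unfolding e P(1) by simp
  show "pdiff2 (bubble_approx \<beta> q n) z = pdiff2 q z * (cutoff c \<beta> 0 (gap (fst z)) * cutoff c \<beta> 0 (gap (snd z)))
      + q z * (- 2 * snd z * cutoff c \<beta> 0 (gap (fst z)) * cutoff_slope c \<beta> (gap (snd z)))"
    unfolding e P(2) by simp
qed

lemma cutoff_bounds:
  assumes "c > 0" "t > 0"
  shows "0 \<le> cutoff c \<gamma> 0 t" "cutoff c \<gamma> 0 t \<le> t powr \<gamma>"
  using assms by (auto simp: cutoff_def intro!: mult_left_le)

text \<open>
  With \<open>r = c / (t - c)\<close> the second summand is \<open>t powr (\<beta> - 1)\<close> times \<open>(r + r\<^sup>2) * exp (- r) \<le> 3\<close>.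
\<close>
lemma cutoff_slope_bound:
  assumes c: "c > 0" and t: "t > 0" and \<beta>: "0 \<le> \<beta>" "\<beta> \<le> 1"
  shows "\<bar>cutoff_slope c \<beta> t\<bar> \<le> 4 * t powr (\<beta> - 1)"
proof (cases "t > c")
  case True
  define r where "r = c / (t - c)"
  have r: "r > 0" using c True by (simp add: r_def)
  have "1 + r + r\<^sup>2 / 2 \<le> exp r" using exp_lower_Taylor_quadratic[of r] r by simp
  then have "r + r\<^sup>2 \<le> 3 * exp r" using r by (smt (verit) zero_le_power2 field_sum_of_halves)
  then have e: "(r + r\<^sup>2) * exp (- r) \<le> 3" by (simp add: exp_minus field_simps)
  have tc: "t * c / (t - c) ^ 2 = r + r\<^sup>2"
  proof -
    have "r + r\<^sup>2 = (c * (t - c) + c * c) / (t - c)\<^sup>2"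
      using True by (simp add: r_def power2_eq_square add_divide_distrib)
    also have "c * (t - c) + c * c = t * c" by (simp add: algebra_simps)
    finally show ?thesis by simp
  qed
  have "c * cutoff c \<beta> 2 t = t powr (\<beta> - 1) * ((t * c / (t - c) ^ 2) * exp (- r))"
    using True t by (simp add: cutoff_def r_def powr_diff field_simps)
  also have "\<dots> \<le> t powr (\<beta> - 1) * 3" unfolding tc using e by (intro mult_left_mono) auto
  finally have 2: "c * cutoff c \<beta> 2 t \<le> 3 * t powr (\<beta> - 1)" by simp
  have 1: "\<beta> * cutoff c (\<beta> - 1) 0 t \<le> 1 * t powr (\<beta> - 1)"
    using \<beta> cutoff_bounds[OF c t] by (intro mult_mono) auto
  have "0 \<le> \<beta> * cutoff c (\<beta> - 1) 0 t" "0 \<le> c * cutoff c \<beta> 2 t"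
    using \<beta> c cutoff_bounds[OF c t] by (auto simp: cutoff_def)
  with 1 2 show ?thesis unfolding cutoff_slope_def by simp
qed (simp add: cutoff_slope_def cutoff_def)

lemma cutoff_limits:
  assumes t: "t > 0"
  shows "(\<lambda>n. cutoff (1 / real (Suc n)) \<beta> 0 t) \<longlonglongrightarrow> t powr \<beta>"
    and "(\<lambda>n. cutoff_slope (1 / real (Suc n)) \<beta> t) \<longlonglongrightarrow> \<beta> * t powr (\<beta> - 1)"
proof -
  have c: "(\<lambda>n. 1 / real (Suc n)) \<longlonglongrightarrow> 0" by (rule lim_1_over_n[THEN LIMSEQ_Suc])
  have ev: "eventually (\<lambda>n. 1 / real (Suc n) < t) sequentially" using c t by (rule order_tendstoD)
  have L: "(\<lambda>n. cutoff (1 / real (Suc n)) \<gamma> m t) \<longlonglongrightarrow> t powr \<gamma> / t ^ m" for \<gamma> m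
  proof -
    have "(\<lambda>n. t powr \<gamma> * exp (- (1 / real (Suc n) / (t - 1 / real (Suc n)))) / (t - 1 / real (Suc n)) ^ m)
        \<longlonglongrightarrow> t powr \<gamma> * exp (- (0 / (t - 0))) / (t - 0) ^ m"
      using t by (intro tendsto_intros c) auto
    moreover have "eventually (\<lambda>n. t powr \<gamma> * exp (- (1 / real (Suc n) / (t - 1 / real (Suc n)))) / (t - 1 / real (Suc n)) ^ m
        = cutoff (1 / real (Suc n)) \<gamma> m t) sequentially"
      using ev by eventually_elim (simp add: cutoff_def)
    ultimately show ?thesis by (simp add: tendsto_cong)
  qed
  show "(\<lambda>n. cutoff (1 / real (Suc n)) \<beta> 0 t) \<longlonglongrightarrow> t powr \<beta>" using L[of \<beta> 0] by simp
  have "(\<lambda>n. \<beta> * cutoff (1 / real (Suc n)) (\<beta> - 1) 0 t + 1 / real (Suc n) * cutoff (1 / real (Suc n)) \<beta> 2 t)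
      \<longlonglongrightarrow> \<beta> * (t powr (\<beta> - 1) / t ^ 0) + 0 * (t powr \<beta> / t ^ 2)"
    by (intro tendsto_intros L c)
  then show "(\<lambda>n. cutoff_slope (1 / real (Suc n)) \<beta> t) \<longlonglongrightarrow> \<beta> * t powr (\<beta> - 1)"
    by (simp add: cutoff_slope_def)
qed

lemma bubble_approx_limits:
  assumes q: "smooth q" and z: "z \<in> refQ"
  shows "(\<lambda>n. bubble_approx \<beta> q n z) \<longlonglongrightarrow> bubble \<beta> q z"
    and "(\<lambda>n. pdiff1 (bubble_approx \<beta> q n) z) \<longlonglongrightarrow> bubble_dx \<beta> q z"
    and "(\<lambda>n. pdiff2 (bubble_approx \<beta> q n) z) \<longlonglongrightarrow> bubble_dy \<beta> q z"
proof -
  have g: "gap (fst z) > 0" "gap (snd z) > 0" using gap_bounds[OF z] by auto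
  note L = cutoff_limits(1)[OF g(1), of \<beta>] cutoff_limits(1)[OF g(2), of \<beta>]
    cutoff_limits(2)[OF g(1), of \<beta>] cutoff_limits(2)[OF g(2), of \<beta>]
  have P: "t powr \<beta> = t * t powr (\<beta> - 1)" if "t > 0" for t :: real
    using that by (simp add: powr_diff)
  have "(\<lambda>n. bubble_approx \<beta> q n z) \<longlonglongrightarrow> q z * (gap (fst z) powr \<beta> * gap (snd z) powr \<beta>)"
    unfolding bubble_approx_def by (intro tendsto_intros L)
  then show "(\<lambda>n. bubble_approx \<beta> q n z) \<longlonglongrightarrow> bubble \<beta> q z" using z by (simp add: bubble_def)
  have "(\<lambda>n. pdiff1 (bubble_approx \<beta> q n) z) \<longlonglongrightarrow> pdiff1 q z * (gap (fst z) powr \<beta> * gap (snd z) powr \<beta>)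
      + q z * (- 2 * fst z * (\<beta> * gap (fst z) powr (\<beta> - 1)) * gap (snd z) powr \<beta>)"
    unfolding pdiff_bubble_approx[OF q] by (intro tendsto_intros L)
  also have "pdiff1 q z * (gap (fst z) powr \<beta> * gap (snd z) powr \<beta>)
      + q z * (- 2 * fst z * (\<beta> * gap (fst z) powr (\<beta> - 1)) * gap (snd z) powr \<beta>) = bubble_dx \<beta> q z"
    using z P[OF g(1)] by (simp add: bubble_dx_def algebra_simps)
  finally show "(\<lambda>n. pdiff1 (bubble_approx \<beta> q n) z) \<longlonglongrightarrow> bubble_dx \<beta> q z" .
  have "(\<lambda>n. pdiff2 (bubble_approx \<beta> q n) z) \<longlonglongrightarrow> pdiff2 q z * (gap (fst z) powr \<beta> * gap (snd z) powr \<beta>)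
      + q z * (- 2 * snd z * gap (fst z) powr \<beta> * (\<beta> * gap (snd z) powr (\<beta> - 1)))"
    unfolding pdiff_bubble_approx[OF q] by (intro tendsto_intros L)
  also have "pdiff2 q z * (gap (fst z) powr \<beta> * gap (snd z) powr \<beta>)
      + q z * (- 2 * snd z * gap (fst z) powr \<beta> * (\<beta> * gap (snd z) powr (\<beta> - 1))) = bubble_dy \<beta> q z"
    using z P[OF g(2)] by (simp add: bubble_dy_def algebra_simps)
  finally show "(\<lambda>n. pdiff2 (bubble_approx \<beta> q n) z) \<longlonglongrightarrow> bubble_dy \<beta> q z" .
qed

lemma smooth_bounded_refQ:
  assumes "smooth q"
  obtains B where "B \<ge> 0" "\<And>z. z \<in> refQ \<Longrightarrow> \<bar>q z\<bar> \<le> B"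
proof -
  have "compact ({-1..1} \<times> {-1..1} :: plane set)" by (intro compact_Times) auto
  then have "bounded (q ` ({-1..1} \<times> {-1..1}))"
    by (intro compact_imp_bounded compact_continuous_image smooth_continuous assms)
  then obtain B where B: "\<forall>y\<in>q ` ({-1..1} \<times> {-1..1}). norm y \<le> B" unfolding bounded_iff by blast
  have "\<bar>q z\<bar> \<le> max B 0" if "z \<in> refQ" for z
  proof -
    have "z \<in> {-1..1} \<times> {-1..1}" using that by (auto simp: refQ_def)
    then have "norm (q z) \<le> B" using B by blast
    then show ?thesis by simp
  qed
  then show thesis by (intro that[of "max B 0"]) auto
qed

text \<open>
  The approximations obey the same pointwise bounds as the bubble, uniformly in \<open>n\<close>; this is where the
  uniform bound on the slope of the cutoff is used.
\<close>
lemma bubble_approx_bounds: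
  assumes q: "smooth q" and \<beta>: "0 \<le> \<beta>" "\<beta> \<le> 1"
  obtains B where "B \<ge> 0"
    "\<And>n z. z \<in> refQ \<Longrightarrow> \<bar>bubble_approx \<beta> q n z\<bar> \<le> B * (gap (fst z) powr \<beta> * gap (snd z) powr \<beta>)"
    "\<And>n z. z \<in> refQ \<Longrightarrow> \<bar>pdiff1 (bubble_approx \<beta> q n) z\<bar> \<le> B * (gap (fst z) powr (\<beta> - 1) * gap (snd z) powr \<beta>)"
    "\<And>n z. z \<in> refQ \<Longrightarrow> \<bar>pdiff2 (bubble_approx \<beta> q n) z\<bar> \<le> B * (gap (fst z) powr \<beta> * gap (snd z) powr (\<beta> - 1))"
proof -
  obtain B0 where B0: "B0 \<ge> 0" "\<And>z. z \<in> refQ \<Longrightarrow> \<bar>q z\<bar> \<le> B0" using smooth_bounded_refQ[OF q] by blast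
  obtain B1 where B1: "B1 \<ge> 0" "\<And>z. z \<in> refQ \<Longrightarrow> \<bar>pdiff1 q z\<bar> \<le> B1" using smooth_bounded_refQ[OF smooth_pdiff1[OF q]] by blast
  obtain B2 where B2: "B2 \<ge> 0" "\<And>z. z \<in> refQ \<Longrightarrow> \<bar>pdiff2 q z\<bar> \<le> B2" using smooth_bounded_refQ[OF smooth_pdiff2[OF q]] by blast
  define B where "B = B1 + B2 + 8 * B0"
  show thesis
  proof
    show "B \<ge> 0" using B0 B1 B2 by (simp add: B_def)
    fix n z assume z: "z \<in> refQ"
    define c where "c = 1 / real (Suc n)"
    have c: "c > 0" by (simp add: c_def)
    have g: "gap (fst z) > 0" "gap (snd z) > 0" "gap (fst z) \<le> 1" "gap (snd z) \<le> 1" using gap_bounds[OF z] by auto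
    have xy: "\<bar>fst z\<bar> \<le> 1" "\<bar>snd z\<bar> \<le> 1" using z by (auto simp: refQ_def)
    define X Y X' Y' where "X = gap (fst z) powr \<beta>" and "Y = gap (snd z) powr \<beta>"
      and "X' = gap (fst z) powr (\<beta> - 1)" and "Y' = gap (snd z) powr (\<beta> - 1)"
    have XY: "0 \<le> X" "0 \<le> Y" "0 \<le> X'" "0 \<le> Y'" by (auto simp: X_def Y_def X'_def Y'_def)
    have le: "X \<le> X'" "Y \<le> Y'" unfolding X_def X'_def Y_def Y'_def using g by (auto intro!: powr_mono')
    define hx hy kx ky where "hx = cutoff c \<beta> 0 (gap (fst z))" and "hy = cutoff c \<beta> 0 (gap (snd z))"
      and "kx = cutoff_slope c \<beta> (gap (fst z))" and "ky = cutoff_slope c \<beta> (gap (snd z))"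
    have h: "\<bar>hx\<bar> \<le> X" "\<bar>hy\<bar> \<le> Y"
      using cutoff_bounds[OF c g(1)] cutoff_bounds[OF c g(2)] by (auto simp: hx_def hy_def X_def Y_def)
    have k: "\<bar>kx\<bar> \<le> 4 * X'" "\<bar>ky\<bar> \<le> 4 * Y'"
      using cutoff_slope_bound[OF c g(1) \<beta>] cutoff_slope_bound[OF c g(2) \<beta>] by (auto simp: kx_def ky_def X'_def Y'_def)
    have hh: "\<bar>hx * hy\<bar> \<le> X * Y" unfolding abs_mult using h XY by (intro mult_mono) auto
    have "\<bar>q z * (hx * hy)\<bar> \<le> B * (X * Y)"
      unfolding abs_mult[of "q z"] using hh B0(2)[OF z] XY B0(1) B1(1) B2(1)
      by (intro mult_mono) (auto simp: B_def)
    then show "\<bar>bubble_approx \<beta> q n z\<bar> \<le> B * (gap (fst z) powr \<beta> * gap (snd z) powr \<beta>)"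
      by (simp add: bubble_approx_def hx_def hy_def X_def Y_def c_def)
    have "\<bar>pdiff1 q z * (hx * hy) + q z * (- 2 * fst z * kx * hy)\<bar> \<le> B1 * (X' * Y) + B0 * (2 * 1 * (4 * X') * Y)"
    proof (rule order_trans[OF abs_triangle_ineq] add_mono)+
      have "\<bar>hx * hy\<bar> \<le> X' * Y" using hh le XY by (meson mult_right_mono order_trans)
      then show "\<bar>pdiff1 q z * (hx * hy)\<bar> \<le> B1 * (X' * Y)"
        unfolding abs_mult[of "pdiff1 q z"] using B1 z XY by (intro mult_mono) auto
      show "\<bar>q z * (- 2 * fst z * kx * hy)\<bar> \<le> B0 * (2 * 1 * (4 * X') * Y)"
        unfolding abs_mult using B0 z XY h k xy by (intro mult_mono) auto
    qed
    also have "\<dots> \<le> B * (X' * Y)"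
    proof -
      have "0 \<le> B2 * (X' * Y)" using B2 XY by auto
      then show ?thesis by (simp add: B_def algebra_simps)
    qed
    finally show "\<bar>pdiff1 (bubble_approx \<beta> q n) z\<bar> \<le> B * (gap (fst z) powr (\<beta> - 1) * gap (snd z) powr \<beta>)"
      unfolding pdiff_bubble_approx[OF q] by (simp only: hx_def hy_def kx_def c_def X'_def Y_def)
    have "\<bar>pdiff2 q z * (hx * hy) + q z * (- 2 * snd z * hx * ky)\<bar> \<le> B2 * (X * Y') + B0 * (2 * 1 * X * (4 * Y'))"
    proof (rule order_trans[OF abs_triangle_ineq] add_mono)+
      have "\<bar>hx * hy\<bar> \<le> X * Y'" using hh le XY by (meson mult_left_mono order_trans)
      then show "\<bar>pdiff2 q z * (hx * hy)\<bar> \<le> B2 * (X * Y')"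
        unfolding abs_mult[of "pdiff2 q z"] using B2 z XY by (intro mult_mono) auto
      show "\<bar>q z * (- 2 * snd z * hx * ky)\<bar> \<le> B0 * (2 * 1 * X * (4 * Y'))"
        unfolding abs_mult using B0 z XY h k xy by (intro mult_mono) auto
    qed
    also have "\<dots> \<le> B * (X * Y')"
    proof -
      have "0 \<le> B1 * (X * Y')" using B1 XY by auto
      then show ?thesis by (simp add: B_def algebra_simps)
    qed
    finally show "\<bar>pdiff2 (bubble_approx \<beta> q n) z\<bar> \<le> B * (gap (fst z) powr \<beta> * gap (snd z) powr (\<beta> - 1))"
      unfolding pdiff_bubble_approx[OF q] by (simp only: hx_def hy_def ky_def c_def X_def Y'_def)
  qed
qed

text \<open>
  The squared boundary factors of the bubble and of its derivative, multiplied with the dual weight, return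
  the original weights.
\<close>
lemma powr_square_weight:
  fixes x :: real
  shows "(x powr \<beta>)\<^sup>2 * x powr (- \<beta>) = x powr \<beta>"
    and "(x powr (\<beta> - 1))\<^sup>2 * x powr (- \<beta> + 1) = x powr (\<beta> - 1)"
proof -
  have "(x powr \<beta>)\<^sup>2 * x powr (- \<beta>) = x powr (\<beta> + \<beta> + - \<beta>)"
    "(x powr (\<beta> - 1))\<^sup>2 * x powr (- \<beta> + 1) = x powr ((\<beta> - 1) + (\<beta> - 1) + (- \<beta> + 1))"
    by (simp_all only: powr_add power2_eq_square)
  then show "(x powr \<beta>)\<^sup>2 * x powr (- \<beta>) = x powr \<beta>"
    "(x powr (\<beta> - 1))\<^sup>2 * x powr (- \<beta> + 1) = x powr (\<beta> - 1)" by simp_all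
qed

lemma nn_integral_refQ:
  "(\<integral>\<^sup>+ z. f z \<partial>lebesgue_on refQ) = (\<integral>\<^sup>+ z. f z * indicator refQ z \<partial>lborel)"
  by (simp add: nn_integral_restrict_space nn_integral_completion)

text \<open>
  Up to constant factors it dominates the bubble, its derivatives, which grow like
  \<open>(1 - x\<^sup>2) powr (\<beta> - 1)\<close> towards the boundary, and the squares of all of them.
\<close>
definition majorant :: "real \<Rightarrow> plane \<Rightarrow> real" where
  "majorant \<beta> z = indicator refQ z * (gap (fst z) powr (2 * \<beta> - 2) + gap (snd z) powr (2 * \<beta> - 2))"

lemma jacobi_density_gap: "jacobi_density \<gamma> x = indicator {-1<..<1} x * gap x powr \<gamma>"
  by (simp add: jacobi_density_def gap_def)

lemma indicator_refQ: "indicator refQ z = (indicator {-1<..<1} (fst z) * indicator {-1<..<1} (snd z) :: real)"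
  by (cases z) (simp add: refQ_def indicator_times)

lemma product_density_integrable:
  assumes "-1 < \<gamma>" "-1 < \<gamma>'"
  shows "integrable lborel (\<lambda>z::plane. jacobi_density \<gamma> (fst z) * jacobi_density \<gamma>' (snd z))"
proof -
  have m: "(\<lambda>z. jacobi_density \<gamma> (fst z) * jacobi_density \<gamma>' (snd z)) \<in> borel_measurable (lborel \<Otimes>\<^sub>M lborel)"
    by measurable
  have "(\<integral>\<^sup>+ z. ennreal (jacobi_density \<gamma> (fst z) * jacobi_density \<gamma>' (snd z)) \<partial>(lborel \<Otimes>\<^sub>M lborel)) =
      (\<integral>\<^sup>+ x. \<integral>\<^sup>+ y. ennreal (jacobi_density \<gamma> x) * ennreal (jacobi_density \<gamma>' y) \<partial>lborel \<partial>lborel)"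
    by (subst lborel.nn_integral_fst[symmetric]) (auto simp: ennreal_mult)
  also have "\<dots> = (\<integral>\<^sup>+ x. ennreal (jacobi_density \<gamma> x) * (\<integral>\<^sup>+ y. ennreal (jacobi_density \<gamma>' y) \<partial>lborel) \<partial>lborel)"
    by (intro nn_integral_cong nn_integral_cmult) measurable
  also have "\<dots> = (\<integral>\<^sup>+ x. ennreal (jacobi_density \<gamma> x) \<partial>lborel) * (\<integral>\<^sup>+ y. ennreal (jacobi_density \<gamma>' y) \<partial>lborel)"
    by (rule nn_integral_multc) measurable
  also have "\<dots> < \<infinity>"
    using jacobi_density_integrable[OF assms(1)] jacobi_density_integrable[OF assms(2)]
    by (auto simp: integrable_iff_bounded ennreal_mult_less_top)
  finally have "integrable (lborel \<Otimes>\<^sub>M lborel) (\<lambda>z. jacobi_density \<gamma> (fst z) * jacobi_density \<gamma>' (snd z))"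
    using m by (simp add: integrable_iff_bounded)
  then show ?thesis by (simp add: lborel_prod)
qed

text \<open>
  This is where \<open>\<beta> > 1/2\<close> enters: it says that the exponent \<open>2 * \<beta> - 2\<close> exceeds \<open>-1\<close>.
\<close>
lemma majorant_integrable:
  assumes "1/2 < \<beta>"
  shows "integrable lborel (majorant \<beta>)"
proof -
  have "gap x powr 0 = 1" if "x \<in> {-1<..<1}" for x
  proof -
    have "\<bar>x\<bar> < 1" using that by auto
    then show ?thesis using one_minus_square_pos[of x] by (simp add: gap_def)
  qed
  note one = this
  have 0: "jacobi_density 0 x = indicator {-1<..<1} x" for x
  proof (cases "x \<in> {-1<..<1}")
    case True
    then show ?thesis using one[OF True] unfolding jacobi_density_gap by (simp only: indicator_simps mult_1)
  qed (simp add: jacobi_density_gap)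
  have e: "majorant \<beta> z = jacobi_density (2 * \<beta> - 2) (fst z) * jacobi_density 0 (snd z)
      + jacobi_density 0 (fst z) * jacobi_density (2 * \<beta> - 2) (snd z)" for z
    unfolding majorant_def indicator_refQ 0 jacobi_density_gap[of "2 * \<beta> - 2"] by (simp only: distrib_left ac_simps)
  show ?thesis
    unfolding e[abs_def] using assms
    by (intro Bochner_Integration.integrable_add product_density_integrable) auto
qed

lemma majorant_nonneg: "0 \<le> majorant \<beta> z"
  by (simp add: majorant_def)

lemma square_diff_bound:
  fixes a b M :: real
  assumes "\<bar>a\<bar> \<le> M" "\<bar>b\<bar> \<le> M"
  shows "(a - b)\<^sup>2 \<le> 4 * M\<^sup>2"
proof -
  have "\<bar>a - b\<bar> \<le> \<bar>2 * M\<bar>" using assms by linarith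
  then have "(a - b)\<^sup>2 \<le> (2 * M)\<^sup>2" by (simp only: abs_le_square_iff)
  then show ?thesis by (simp add: power2_eq_square)
qed

text \<open>
  One bound \<open>M\<close> for all the quantities to which dominated convergence is applied: the approximations with
  their derivatives (weak derivatives of the limit), the squared differences (unweighted Sobolev norm), the
  weighted squared differences (dual-weight norm), and the squares of the limits (finiteness of the norm).
\<close>
definition bubble_approx_dominated_by :: "real \<Rightarrow> real \<Rightarrow> (plane \<Rightarrow> real) \<Rightarrow> nat \<Rightarrow> plane \<Rightarrow> bool" where
  "bubble_approx_dominated_by M \<beta> q n z \<longleftrightarrow>
    \<bar>bubble_approx \<beta> q n z\<bar> \<le> M \<and> \<bar>pdiff1 (bubble_approx \<beta> q n) z\<bar> \<le> M \<and> \<bar>pdiff2 (bubble_approx \<beta> q n) z\<bar> \<le> M \<and>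
    (bubble \<beta> q z - bubble_approx \<beta> q n z)\<^sup>2 \<le> M \<and>
    (bubble_dx \<beta> q z - pdiff1 (bubble_approx \<beta> q n) z)\<^sup>2 \<le> M \<and>
    (bubble_dy \<beta> q z - pdiff2 (bubble_approx \<beta> q n) z)\<^sup>2 \<le> M \<and>
    (bubble \<beta> q z - bubble_approx \<beta> q n z)\<^sup>2 * jacobi_weight (- \<beta>) (0, 0) z \<le> M \<and>
    (bubble_dx \<beta> q z - pdiff1 (bubble_approx \<beta> q n) z)\<^sup>2 * jacobi_weight (- \<beta>) (1, 0) z \<le> M \<and>
    (bubble_dy \<beta> q z - pdiff2 (bubble_approx \<beta> q n) z)\<^sup>2 * jacobi_weight (- \<beta>) (0, 1) z \<le> M \<and>
    (bubble \<beta> q z)\<^sup>2 \<le> M \<and> (bubble_dx \<beta> q z)\<^sup>2 \<le> M \<and> (bubble_dy \<beta> q z)\<^sup>2 \<le> M"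

text \<open>
  With \<open>X = 1 - x\<^sup>2\<close> and \<open>Y = 1 - y\<^sup>2\<close>, the derivative with respect to \<open>x\<close> and its approximations are bounded by
  \<open>A * X powr (\<beta> - 1) * Y powr \<beta>\<close>. The square of this is at most a multiple of \<open>X powr (2 * \<beta> - 2)\<close>, and
  its square times the dual weight is a multiple of \<open>X powr (\<beta> - 1) * Y powr \<beta>\<close>, which is smaller still.
\<close>
lemma bubble_approx_dominated:
  assumes q: "smooth q" and \<beta>: "1/2 < \<beta>" "\<beta> < 1"
  shows "\<exists>B\<ge>0. \<forall>z\<in>refQ. \<forall>n. bubble_approx_dominated_by (B * majorant \<beta> z) \<beta> q n z"
proof -
  obtain A where A: "A \<ge> 0"
    "\<And>n z. z \<in> refQ \<Longrightarrow> \<bar>bubble_approx \<beta> q n z\<bar> \<le> A * (gap (fst z) powr \<beta> * gap (snd z) powr \<beta>)"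
    "\<And>n z. z \<in> refQ \<Longrightarrow> \<bar>pdiff1 (bubble_approx \<beta> q n) z\<bar> \<le> A * (gap (fst z) powr (\<beta> - 1) * gap (snd z) powr \<beta>)"
    "\<And>n z. z \<in> refQ \<Longrightarrow> \<bar>pdiff2 (bubble_approx \<beta> q n) z\<bar> \<le> A * (gap (fst z) powr \<beta> * gap (snd z) powr (\<beta> - 1))"
  proof -
    have "0 \<le> \<beta>" "\<beta> \<le> 1" using \<beta> by auto
    from bubble_approx_bounds[OF q this] that show thesis by blast
  qed
  have lim: "\<bar>a\<bar> \<le> C" if "b \<longlonglongrightarrow> a" "\<And>n. \<bar>b n\<bar> \<le> C" for a C :: real and b
    by (rule LIMSEQ_le_const2[OF tendsto_rabs[OF that(1)]]) (use that(2) in auto)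
  note L = bubble_approx_limits[OF q]
  have A': "\<bar>bubble \<beta> q z\<bar> \<le> A * (gap (fst z) powr \<beta> * gap (snd z) powr \<beta>)"
    "\<bar>bubble_dx \<beta> q z\<bar> \<le> A * (gap (fst z) powr (\<beta> - 1) * gap (snd z) powr \<beta>)"
    "\<bar>bubble_dy \<beta> q z\<bar> \<le> A * (gap (fst z) powr \<beta> * gap (snd z) powr (\<beta> - 1))" if "z \<in> refQ" for z
    by (rule lim[OF L(1)[OF that] A(2)[OF that]] lim[OF L(2)[OF that] A(3)[OF that]] lim[OF L(3)[OF that] A(4)[OF that]])+
  have pw: "x powr \<beta> \<le> 1" "1 \<le> x powr (2 * \<beta> - 2)" "x powr (\<beta> - 1) \<le> x powr (2 * \<beta> - 2)"
    "(x powr \<beta>)\<^sup>2 \<le> 1" "(x powr (\<beta> - 1))\<^sup>2 = x powr (2 * \<beta> - 2)" "x powr 0 = 1"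
    "(x powr \<beta>)\<^sup>2 * x powr (- \<beta>) = x powr \<beta>" "(x powr (\<beta> - 1))\<^sup>2 * x powr (- \<beta> + 1) = x powr (\<beta> - 1)"
    if x: "0 < x" "x \<le> 1" for x
  proof -
    show 1: "x powr \<beta> \<le> 1" using powr_mono2[of \<beta> x 1] x \<beta> by simp
    show "1 \<le> x powr (2 * \<beta> - 2)" using powr_mono2'[of "2 * \<beta> - 2" x 1] x \<beta> by simp
    show "x powr (\<beta> - 1) \<le> x powr (2 * \<beta> - 2)" using x \<beta> by (intro powr_mono') auto
    show "(x powr \<beta>)\<^sup>2 \<le> 1" using 1 by (simp add: abs_square_le_1)
    have "(x powr (\<beta> - 1))\<^sup>2 = x powr ((\<beta> - 1) + (\<beta> - 1))" by (simp only: powr_add power2_eq_square)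
    then show "(x powr (\<beta> - 1))\<^sup>2 = x powr (2 * \<beta> - 2)" by (simp add: algebra_simps)
    show "x powr 0 = 1" using x by simp
    show "(x powr \<beta>)\<^sup>2 * x powr (- \<beta>) = x powr \<beta>"
      "(x powr (\<beta> - 1))\<^sup>2 * x powr (- \<beta> + 1) = x powr (\<beta> - 1)" by (rule powr_square_weight)+
  qed
  \<comment> \<open>large enough for the linear bounds and for the squares of differences\<close>
  define B where "B = A + 4 * A\<^sup>2"
  have B: "0 \<le> A" "0 \<le> B" "A \<le> B" "4 * A\<^sup>2 \<le> B" "A\<^sup>2 \<le> B" using A(1) by (auto simp: B_def)
  have key: "a * b \<le> B * majorant \<beta> z" if "z \<in> refQ" "a \<le> B" "0 \<le> b" "b \<le> majorant \<beta> z" for a b z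
    using that B by (intro mult_mono) auto
  show ?thesis
    unfolding bubble_approx_dominated_by_def
  proof (intro exI[of _ B] conjI[OF B(2)] ballI allI conjI)
    fix n z assume z: "z \<in> refQ"
    define X Y X' Y' X2 Y2 where "X = gap (fst z) powr \<beta>" and "Y = gap (snd z) powr \<beta>"
      and "X' = gap (fst z) powr (\<beta> - 1)" and "Y' = gap (snd z) powr (\<beta> - 1)"
      and "X2 = gap (fst z) powr (2 * \<beta> - 2)" and "Y2 = gap (snd z) powr (2 * \<beta> - 2)"
    have g: "0 < gap (fst z)" "gap (fst z) \<le> 1" "0 < gap (snd z)" "gap (snd z) \<le> 1" using gap_bounds[OF z] by auto
    note px = pw[OF g(1,2), folded X_def X'_def X2_def] and py = pw[OF g(3,4), folded Y_def Y'_def Y2_def]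
    have nn: "0 \<le> X" "0 \<le> Y" "0 \<le> X'" "0 \<le> Y'" "0 \<le> X2" "0 \<le> Y2" by (auto simp: X_def Y_def X'_def Y'_def X2_def Y2_def)
    have s: "majorant \<beta> z = X2 + Y2" using z by (simp add: majorant_def X2_def Y2_def)
    have b0: "X * Y \<le> majorant \<beta> z" "X' * Y \<le> majorant \<beta> z" "X * Y' \<le> majorant \<beta> z"
    proof -
      have "X * Y \<le> 1 * 1" "X' * Y \<le> X2 * 1" "X * Y' \<le> 1 * Y2"
        by (rule mult_mono[OF px(1) py(1)] mult_mono[OF px(3) py(1)] mult_mono[OF px(1) py(3)]; simp add: nn)+
      then show "X * Y \<le> majorant \<beta> z" "X' * Y \<le> majorant \<beta> z" "X * Y' \<le> majorant \<beta> z"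
        using px(2) py(2) unfolding s by linarith+
    qed
    have b1: "(X * Y)\<^sup>2 \<le> majorant \<beta> z" "(X' * Y)\<^sup>2 \<le> majorant \<beta> z" "(X * Y')\<^sup>2 \<le> majorant \<beta> z"
    proof -
      have "X\<^sup>2 * Y\<^sup>2 \<le> 1 * 1" "X'\<^sup>2 * Y\<^sup>2 \<le> X2 * 1" "X\<^sup>2 * Y'\<^sup>2 \<le> 1 * Y2"
        by (rule mult_mono[OF px(4) py(4)] mult_mono[OF eq_refl[OF px(5)] py(4)] mult_mono[OF px(4) eq_refl[OF py(5)]]; simp add: nn)+
      then show "(X * Y)\<^sup>2 \<le> majorant \<beta> z" "(X' * Y)\<^sup>2 \<le> majorant \<beta> z" "(X * Y')\<^sup>2 \<le> majorant \<beta> z"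
        using px(2) py(2) unfolding s power_mult_distrib by linarith+
    qed
    note a = A(2)[OF z, of n, folded X_def Y_def] A(3)[OF z, of n, folded X'_def Y_def] A(4)[OF z, of n, folded X_def Y'_def]
    note a' = A'(1)[OF z, folded X_def Y_def] A'(2)[OF z, folded X'_def Y_def] A'(3)[OF z, folded X_def Y'_def]
    show "\<bar>bubble_approx \<beta> q n z\<bar> \<le> B * majorant \<beta> z"
      by (rule order_trans[OF a(1) key[OF z B(3) _ b0(1)]]) (simp add: nn)
    show "\<bar>pdiff1 (bubble_approx \<beta> q n) z\<bar> \<le> B * majorant \<beta> z"
      by (rule order_trans[OF a(2) key[OF z B(3) _ b0(2)]]) (simp add: nn)
    show "\<bar>pdiff2 (bubble_approx \<beta> q n) z\<bar> \<le> B * majorant \<beta> z"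
      by (rule order_trans[OF a(3) key[OF z B(3) _ b0(3)]]) (simp add: nn)
    have d: "(bubble \<beta> q z - bubble_approx \<beta> q n z)\<^sup>2 \<le> 4 * A\<^sup>2 * (X * Y)\<^sup>2"
      "(bubble_dx \<beta> q z - pdiff1 (bubble_approx \<beta> q n) z)\<^sup>2 \<le> 4 * A\<^sup>2 * (X' * Y)\<^sup>2"
      "(bubble_dy \<beta> q z - pdiff2 (bubble_approx \<beta> q n) z)\<^sup>2 \<le> 4 * A\<^sup>2 * (X * Y')\<^sup>2"
      using square_diff_bound[OF a'(1) a(1)] square_diff_bound[OF a'(2) a(2)] square_diff_bound[OF a'(3) a(3)]
      by (simp_all add: power_mult_distrib mult.assoc)
    show "(bubble \<beta> q z - bubble_approx \<beta> q n z)\<^sup>2 \<le> B * majorant \<beta> z"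
      by (rule order_trans[OF d(1) key[OF z B(4) _ b1(1)]]) simp
    show "(bubble_dx \<beta> q z - pdiff1 (bubble_approx \<beta> q n) z)\<^sup>2 \<le> B * majorant \<beta> z"
      by (rule order_trans[OF d(2) key[OF z B(4) _ b1(2)]]) simp
    show "(bubble_dy \<beta> q z - pdiff2 (bubble_approx \<beta> q n) z)\<^sup>2 \<le> B * majorant \<beta> z"
      by (rule order_trans[OF d(3) key[OF z B(4) _ b1(3)]]) simp
    have W: "jacobi_weight (- \<beta>) (0, 0) z = gap (fst z) powr (- \<beta>) * gap (snd z) powr (- \<beta>)"
      "jacobi_weight (- \<beta>) (1, 0) z = gap (fst z) powr (- \<beta> + 1) * gap (snd z) powr (- \<beta>)"
      "jacobi_weight (- \<beta>) (0, 1) z = gap (fst z) powr (- \<beta>) * gap (snd z) powr (- \<beta> + 1)"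
      by (simp_all add: jacobi_weight_def gap_def case_prod_beta)
    have Wn: "0 \<le> jacobi_weight (- \<beta>) \<alpha> z" for \<alpha> by (simp add: jacobi_weight_def case_prod_beta)
    have e: "(X * Y)\<^sup>2 * jacobi_weight (- \<beta>) (0, 0) z = X * Y"
      "(X' * Y)\<^sup>2 * jacobi_weight (- \<beta>) (1, 0) z = X' * Y"
      "(X * Y')\<^sup>2 * jacobi_weight (- \<beta>) (0, 1) z = X * Y'"
    proof -
      have "(a * b)\<^sup>2 * (c * d) = (a\<^sup>2 * c) * (b\<^sup>2 * d)" for a b c d :: real
        by (simp add: power_mult_distrib)
      then show "(X * Y)\<^sup>2 * jacobi_weight (- \<beta>) (0, 0) z = X * Y"
        "(X' * Y)\<^sup>2 * jacobi_weight (- \<beta>) (1, 0) z = X' * Y"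
        "(X * Y')\<^sup>2 * jacobi_weight (- \<beta>) (0, 1) z = X * Y'"
        unfolding W by (simp_all only: px(7,8) py(7,8))
    qed
    have dW: "t * w \<le> B * majorant \<beta> z" if "t \<le> 4 * A\<^sup>2 * r" "0 \<le> w" "r * w \<le> majorant \<beta> z" "0 \<le> r" for t r w
    proof -
      have "t * w \<le> (4 * A\<^sup>2 * r) * w" using that by (intro mult_right_mono) auto
      also have "\<dots> = 4 * A\<^sup>2 * (r * w)" by simp
      also have "\<dots> \<le> B * majorant \<beta> z" by (rule key[OF z B(4) _ that(3)]) (use that in simp)
      finally show ?thesis .
    qed
    show "(bubble \<beta> q z - bubble_approx \<beta> q n z)\<^sup>2 * jacobi_weight (- \<beta>) (0, 0) z \<le> B * majorant \<beta> z"
      by (rule dW[OF d(1) Wn]) (simp_all only: e b0 zero_le_power2)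
    show "(bubble_dx \<beta> q z - pdiff1 (bubble_approx \<beta> q n) z)\<^sup>2 * jacobi_weight (- \<beta>) (1, 0) z \<le> B * majorant \<beta> z"
      by (rule dW[OF d(2) Wn]) (simp_all only: e b0 zero_le_power2)
    show "(bubble_dy \<beta> q z - pdiff2 (bubble_approx \<beta> q n) z)\<^sup>2 * jacobi_weight (- \<beta>) (0, 1) z \<le> B * majorant \<beta> z"
      by (rule dW[OF d(3) Wn]) (simp_all only: e b0 zero_le_power2)
    have sq: "t\<^sup>2 \<le> A\<^sup>2 * r\<^sup>2" if "\<bar>t\<bar> \<le> A * r" for t r
      using power_mono[OF that, of 2] by (simp add: power_mult_distrib)
    show "(bubble \<beta> q z)\<^sup>2 \<le> B * majorant \<beta> z"
      by (rule order_trans[OF sq[OF a'(1)] key[OF z B(5) _ b1(1)]]) simp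
    show "(bubble_dx \<beta> q z)\<^sup>2 \<le> B * majorant \<beta> z"
      by (rule order_trans[OF sq[OF a'(2)] key[OF z B(5) _ b1(2)]]) simp
    show "(bubble_dy \<beta> q z)\<^sup>2 \<le> B * majorant \<beta> z"
      by (rule order_trans[OF sq[OF a'(3)] key[OF z B(5) _ b1(3)]]) simp
  qed
qed

text \<open>
  The one-dimensional inverse inequality on every horizontal line, integrated over the lines.
\<close>
lemma bubble_dx_norm_bound:
  assumes q: "q \<in> Qpoly p" and \<beta>: "1/2 \<le> \<beta>"
  shows "(\<integral>\<^sup>+ z. ennreal ((bubble_dx \<beta> q z)\<^sup>2 * jacobi_weight (- \<beta>) (1, 0) z) \<partial>lebesgue_on refQ)
    \<le> ennreal (real (p + 1) * (real p + 2 * \<beta>)) *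
       (\<integral>\<^sup>+ z. ennreal ((q z)\<^sup>2 * jacobi_weight \<beta> (0, 0) z) \<partial>lebesgue_on refQ)"
proof -
  obtain P where deg: "\<And>y. degree (P y) \<le> p" and Pq: "\<And>x y. q (x, y) = poly (P y) x"
    and Pd: "\<And>x y. pdiff1 q (x, y) = poly (pderiv (P y)) x"
    using Qpoly_sections[OF q] by metis
  have sm: "smooth q" by (rule Qpoly_smooth[OF q])
  have [measurable]: "q \<in> borel_measurable (lborel \<Otimes>\<^sub>M lborel)" "pdiff1 q \<in> borel_measurable (lborel \<Otimes>\<^sub>M lborel)"
    using smooth_continuous[OF sm, of UNIV] smooth_continuous[OF smooth_pdiff1[OF sm], of UNIV]
    by (simp_all add: lborel_prod borel_measurable_continuous_onI)
  let ?f = "\<lambda>z. (gap (fst z) * pdiff1 q z - 2 * \<beta> * fst z * q z)\<^sup>2 * jacobi_density (\<beta> - 1) (fst z) * jacobi_density \<beta> (snd z)"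
  let ?g = "\<lambda>z. (q z)\<^sup>2 * jacobi_density \<beta> (fst z) * jacobi_density \<beta> (snd z)"
  have [measurable]: "gap \<in> borel_measurable borel" unfolding gap_def[abs_def] by measurable
  have [measurable]: "poly r \<in> borel_measurable borel" for r :: "real poly"
    by (intro borel_measurable_continuous_onI continuous_intros)
  have m: "?f \<in> borel_measurable (lborel \<Otimes>\<^sub>M lborel)" "?g \<in> borel_measurable (lborel \<Otimes>\<^sub>M lborel)" by measurable
  have 1: "ennreal ((bubble_dx \<beta> q z)\<^sup>2 * jacobi_weight (- \<beta>) (1, 0) z) * indicator refQ z = ennreal (?f z)" for z
  proof (cases "z \<in> refQ")
    case True
    have W: "jacobi_weight (- \<beta>) (1, 0) z = gap (fst z) powr (- \<beta> + 1) * gap (snd z) powr (- \<beta>)"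
      by (simp add: jacobi_weight_def gap_def case_prod_beta)
    have i: "fst z \<in> {-1<..<1}" "snd z \<in> {-1<..<1}" using True by (auto simp: refQ_def)
    have "(bubble_dx \<beta> q z)\<^sup>2 * jacobi_weight (- \<beta>) (1, 0) z =
      (gap (fst z) * pdiff1 q z - 2 * \<beta> * fst z * q z)\<^sup>2 * (((gap (fst z) powr (\<beta> - 1))\<^sup>2 * gap (fst z) powr (- \<beta> + 1)) *
        ((gap (snd z) powr \<beta>)\<^sup>2 * gap (snd z) powr (- \<beta>)))"
      using True unfolding W bubble_dx_def by (simp only: power_mult_distrib if_True ac_simps)
    also have "\<dots> = ?f z" unfolding powr_square_weight using i by (simp add: jacobi_density_gap)
    finally show ?thesis using True by simp
  next
    case False
    then have "fst z \<notin> {-1<..<1} \<or> snd z \<notin> {-1<..<1}" by (cases z) (auto simp: refQ_def)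
    then have "?f z = 0" by (auto simp: jacobi_density_def)
    then show ?thesis using False by simp
  qed
  have 2: "ennreal ((q z)\<^sup>2 * jacobi_weight \<beta> (0, 0) z) * indicator refQ z = ennreal (?g z)" for z
  proof (cases "z \<in> refQ")
    case True
    then have "fst z \<in> {-1<..<1}" "snd z \<in> {-1<..<1}" by (auto simp: refQ_def)
    then show ?thesis using True by (simp add: jacobi_density_def jacobi_weight_def case_prod_beta)
  next
    case False
    then have "fst z \<notin> {-1<..<1} \<or> snd z \<notin> {-1<..<1}" by (cases z) (auto simp: refQ_def)
    then have "?g z = 0" by (auto simp: jacobi_density_def)
    then show ?thesis using False by simp
  qed
  let ?L = "ennreal (real (p + 1) * (real p + 2 * \<beta>))"
  have line: "(\<integral>\<^sup>+ x. ennreal (?f (x, y)) \<partial>lborel) \<le> ?L * (\<integral>\<^sup>+ x. ennreal (?g (x, y)) \<partial>lborel)" for y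
  proof -
    have "(\<integral>\<^sup>+ x. ennreal (?f (x, y)) \<partial>lborel) =
        (\<integral>\<^sup>+ x. ennreal ((poly (jacobi_flux \<beta> (P y)) x)\<^sup>2 * jacobi_density (\<beta> - 1) x) * ennreal (jacobi_density \<beta> y) \<partial>lborel)"
      by (simp add: ennreal_mult[symmetric] poly_jacobi_flux Pq Pd gap_def)
    also have "\<dots> = (\<integral>\<^sup>+ x. ennreal ((poly (jacobi_flux \<beta> (P y)) x)\<^sup>2 * jacobi_density (\<beta> - 1) x) \<partial>lborel) * ennreal (jacobi_density \<beta> y)"
      by (rule nn_integral_multc) measurable
    also have "\<dots> \<le> (?L * (\<integral>\<^sup>+ x. ennreal ((poly (P y) x)\<^sup>2 * jacobi_density \<beta> x) \<partial>lborel)) * ennreal (jacobi_density \<beta> y)"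
      by (intro mult_right_mono weighted_inverse_inequality \<beta> deg) simp
    also have "\<dots> = ?L * ((\<integral>\<^sup>+ x. ennreal ((poly (P y) x)\<^sup>2 * jacobi_density \<beta> x) \<partial>lborel) * ennreal (jacobi_density \<beta> y))"
      by (simp add: mult.assoc)
    also have "(\<integral>\<^sup>+ x. ennreal ((poly (P y) x)\<^sup>2 * jacobi_density \<beta> x) \<partial>lborel) * ennreal (jacobi_density \<beta> y) =
        (\<integral>\<^sup>+ x. ennreal ((poly (P y) x)\<^sup>2 * jacobi_density \<beta> x) * ennreal (jacobi_density \<beta> y) \<partial>lborel)"
      by (rule nn_integral_multc[symmetric]) measurable
    also have "\<dots> = (\<integral>\<^sup>+ x. ennreal (?g (x, y)) \<partial>lborel)"
      by (simp add: ennreal_mult[symmetric] Pq)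
    finally show ?thesis .
  qed
  have "(\<integral>\<^sup>+ z. ennreal (?f z) \<partial>(lborel \<Otimes>\<^sub>M lborel)) = (\<integral>\<^sup>+ y. \<integral>\<^sup>+ x. ennreal (?f (x, y)) \<partial>lborel \<partial>lborel)"
    using m(1) by (subst lborel_pair.nn_integral_snd[symmetric]) auto
  also have "\<dots> \<le> (\<integral>\<^sup>+ y. ?L * (\<integral>\<^sup>+ x. ennreal (?g (x, y)) \<partial>lborel) \<partial>lborel)"
    by (intro nn_integral_mono line)
  also have "\<dots> = ?L * (\<integral>\<^sup>+ y. \<integral>\<^sup>+ x. ennreal (?g (x, y)) \<partial>lborel \<partial>lborel)"
    by (rule nn_integral_cmult) measurable
  also have "(\<integral>\<^sup>+ y. \<integral>\<^sup>+ x. ennreal (?g (x, y)) \<partial>lborel \<partial>lborel) = (\<integral>\<^sup>+ z. ennreal (?g z) \<partial>(lborel \<Otimes>\<^sub>M lborel))"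
    using m(2) by (subst lborel_pair.nn_integral_snd[symmetric]) auto
  finally show ?thesis unfolding nn_integral_refQ 1 2 by (simp add: lborel_prod)
qed

lemma nn_integral_refQ_swap:
  assumes "f \<in> borel_measurable borel"
  shows "(\<integral>\<^sup>+ z. f z \<partial>lebesgue_on refQ) = (\<integral>\<^sup>+ z. f (snd z, fst z) \<partial>lebesgue_on refQ)"
proof -
  have "(\<lambda>z. f z * indicator refQ z) \<in> borel_measurable borel" 
    using assms by (intro borel_measurable_times_ennreal borel_measurable_indicator) auto
  moreover have "indicator refQ (snd z, fst z) = (indicator refQ z :: ennreal)" for z
    by (cases z) (auto simp: refQ_def indicator_def)
  ultimately show ?thesis unfolding nn_integral_refQ by (subst nn_integral_plane_swap) auto
qed

lemma jacobi_weight_measurable [measurable]: "jacobi_weight \<beta> \<alpha> \<in> borel_measurable borel"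
proof -
  have "(\<lambda>z::plane. (1 - (fst z)\<^sup>2) powr (\<beta> + real (fst \<alpha>)) * (1 - (snd z)\<^sup>2) powr (\<beta> + real (snd \<alpha>)))
      \<in> borel_measurable (borel \<Otimes>\<^sub>M borel)" by measurable
  then show ?thesis by (simp add: jacobi_weight_def case_prod_beta' borel_prod)
qed

lemma bubble_dx_measurable:
  assumes q: "smooth q"
  shows "bubble_dx \<beta> q \<in> borel_measurable borel"
proof -
  have [measurable]: "q \<in> borel_measurable borel" "pdiff1 q \<in> borel_measurable borel"
    using smooth_continuous[OF q, of UNIV] smooth_continuous[OF smooth_pdiff1[OF q], of UNIV]
    by (simp_all add: borel_measurable_continuous_onI)
  have [measurable]: "(\<lambda>z::plane. gap (fst z)) \<in> borel_measurable borel" "(\<lambda>z::plane. gap (snd z)) \<in> borel_measurable borel"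
    "(fst :: plane \<Rightarrow> real) \<in> borel_measurable borel"
    by (intro borel_measurable_continuous_onI smooth_continuous smooth_gap smooth_fst)+
  have [measurable]: "refQ \<in> sets borel" by simp
  show ?thesis unfolding bubble_dx_def[abs_def] by measurable
qed

text \<open>
  The case of the other variable, by interchanging the coordinates.
\<close>
lemma bubble_dy_norm_bound:
  assumes q: "q \<in> Qpoly p" and \<beta>: "1/2 \<le> \<beta>"
  shows "(\<integral>\<^sup>+ z. ennreal ((bubble_dy \<beta> q z)\<^sup>2 * jacobi_weight (- \<beta>) (0, 1) z) \<partial>lebesgue_on refQ)
    \<le> ennreal (real (p + 1) * (real p + 2 * \<beta>)) *
       (\<integral>\<^sup>+ z. ennreal ((q z)\<^sup>2 * jacobi_weight \<beta> (0, 0) z) \<partial>lebesgue_on refQ)"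
proof -
  let ?q = "\<lambda>z. q (snd z, fst z)"
  have sw: "?q \<in> Qpoly p" by (rule Qpoly_swap[OF q])
  have sm: "smooth ?q" "smooth q" using Qpoly_smooth[OF sw] Qpoly_smooth[OF q] .
  have [measurable]: "bubble_dx \<beta> ?q \<in> borel_measurable borel" "q \<in> borel_measurable borel"
    using bubble_dx_measurable[OF sm(1)] smooth_continuous[OF sm(2), of UNIV]
    by (simp_all add: borel_measurable_continuous_onI)
  have "bubble_dy \<beta> q z = bubble_dx \<beta> ?q (snd z, fst z)" for z
  proof -
    have "z \<in> refQ \<longleftrightarrow> (snd z, fst z) \<in> refQ" by (cases z) (auto simp: refQ_def)
    moreover have "pdiff2 q z = pdiff1 ?q (snd z, fst z)" using pdiff_swap[of q "fst z" "snd z"] by simp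
    ultimately show ?thesis by (simp add: bubble_dx_def bubble_dy_def mult_ac)
  qed
  moreover have "jacobi_weight (- \<beta>) (0, 1) z = jacobi_weight (- \<beta>) (1, 0) (snd z, fst z)" for z
    by (simp add: jacobi_weight_def case_prod_beta mult.commute)
  ultimately have "(\<integral>\<^sup>+ z. ennreal ((bubble_dy \<beta> q z)\<^sup>2 * jacobi_weight (- \<beta>) (0, 1) z) \<partial>lebesgue_on refQ) =
      (\<integral>\<^sup>+ z. ennreal ((bubble_dx \<beta> ?q (snd z, fst z))\<^sup>2 * jacobi_weight (- \<beta>) (1, 0) (snd z, fst z)) \<partial>lebesgue_on refQ)"
    by simp
  also have "\<dots> = (\<integral>\<^sup>+ z. ennreal ((bubble_dx \<beta> ?q z)\<^sup>2 * jacobi_weight (- \<beta>) (1, 0) z) \<partial>lebesgue_on refQ)"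
    by (rule nn_integral_refQ_swap[symmetric]) measurable
  also have "\<dots> \<le> ennreal (real (p + 1) * (real p + 2 * \<beta>)) *
       (\<integral>\<^sup>+ z. ennreal ((?q z)\<^sup>2 * jacobi_weight \<beta> (0, 0) z) \<partial>lebesgue_on refQ)"
    by (rule bubble_dx_norm_bound[OF sw \<beta>])
  also have "(\<integral>\<^sup>+ z. ennreal ((?q z)\<^sup>2 * jacobi_weight \<beta> (0, 0) z) \<partial>lebesgue_on refQ) =
      (\<integral>\<^sup>+ z. ennreal ((q z)\<^sup>2 * jacobi_weight \<beta> (0, 0) z) \<partial>lebesgue_on refQ)"
  proof -
    have "(\<lambda>z. ennreal ((q z)\<^sup>2 * jacobi_weight \<beta> (0, 0) z)) \<in> borel_measurable borel" by measurable
    from nn_integral_refQ_swap[OF this] show ?thesis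
      by (simp add: jacobi_weight_def case_prod_beta mult.commute)
  qed
  finally show ?thesis .
qed

section \<open>The Jacobi projection\<close>

lemma jacobi_weight_nonneg [simp]: "0 \<le> jacobi_weight \<beta> \<alpha> z"
  by (simp add: jacobi_weight_def case_prod_beta)

lemma jacobi_weight_le_1:
  assumes "0 \<le> \<beta>" "z \<in> refQ"
  shows "jacobi_weight \<beta> (0, 0) z \<le> 1"
proof -
  have "gap (fst z) powr \<beta> \<le> 1 powr \<beta>" "gap (snd z) powr \<beta> \<le> 1 powr \<beta>"
    using gap_bounds[OF assms(2)] assms(1) powr_mono2[of \<beta> "gap (fst z)" 1] powr_mono2[of \<beta> "gap (snd z)" 1] by simp_all
  then have "gap (fst z) powr \<beta> * gap (snd z) powr \<beta> \<le> 1 * 1"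
    by (intro mult_mono) auto
  then show ?thesis by (simp add: jacobi_weight_def gap_def case_prod_beta)
qed

lemma jacobi_weight_measurable_refQ: "jacobi_weight \<beta> \<alpha> \<in> borel_measurable (lebesgue_on refQ)"
  by (intro measurable_restrict_space1 measurable_completion) simp

lemma smooth_measurable_refQ: "smooth q \<Longrightarrow> q \<in> borel_measurable (lebesgue_on refQ)"
  using smooth_continuous[of q UNIV]
  by (intro measurable_restrict_space1 measurable_completion) (simp add: borel_measurable_continuous_onI)

lemma space_refQ: "space (lebesgue_on refQ) = refQ"
  by (simp add: space_restrict_space)

lemma emeasure_refQ_finite: "emeasure (lebesgue_on refQ) refQ < \<infinity>"
proof -
  have "bounded refQ" unfolding refQ_def by (intro bounded_Times) auto
  then show ?thesis using emeasure_bounded_finite by (simp add: emeasure_restrict_space)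
qed

lemma integrable_refQ_bounded:
  fixes h :: "plane \<Rightarrow> real"
  assumes "h \<in> borel_measurable (lebesgue_on refQ)" "\<And>z. z \<in> refQ \<Longrightarrow> \<bar>h z\<bar> \<le> B"
  shows "integrable (lebesgue_on refQ) h"
proof (rule integrableI_bounded_set[of refQ _ _ B])
  show "AE z\<in>refQ in lebesgue_on refQ. norm (h z) \<le> B" using assms(2) by auto
qed (use assms emeasure_refQ_finite in \<open>auto simp: space_refQ sets_restrict_space\<close>)

lemma weighted_square_integrable:
  assumes "square_integrable (lebesgue_on refQ) h" "0 \<le> \<beta>"
  shows "integrable (lebesgue_on refQ) (\<lambda>z. (h z)\<^sup>2 * jacobi_weight \<beta> (0, 0) z)"
proof (rule Bochner_Integration.integrable_bound)
  show "integrable (lebesgue_on refQ) (\<lambda>z. (h z)\<^sup>2)" using assms by (simp add: square_integrable_def)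
  show "(\<lambda>z. (h z)\<^sup>2 * jacobi_weight \<beta> (0, 0) z) \<in> borel_measurable (lebesgue_on refQ)"
    using assms by (intro borel_measurable_times borel_measurable_power jacobi_weight_measurable_refQ) (simp add: square_integrable_def)
  show "AE z in lebesgue_on refQ. norm ((h z)\<^sup>2 * jacobi_weight \<beta> (0, 0) z) \<le> norm ((h z)\<^sup>2)"
    by (rule AE_I2) (auto simp: space_refQ abs_mult intro!: mult_left_le jacobi_weight_le_1 assms(2))
qed

lemma smooth_square_integrable_refQ:
  assumes "smooth q"
  shows "square_integrable (lebesgue_on refQ) q"
proof -
  obtain B where B: "\<And>z. z \<in> refQ \<Longrightarrow> \<bar>q z\<bar> \<le> B" using smooth_bounded_refQ[OF assms] by blast
  have m: "q \<in> borel_measurable (lebesgue_on refQ)" by (rule smooth_measurable_refQ[OF assms])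
  have "integrable (lebesgue_on refQ) (\<lambda>z. (q z)\<^sup>2)"
  proof (rule integrable_refQ_bounded)
    show "\<bar>(q z)\<^sup>2\<bar> \<le> B\<^sup>2" if "z \<in> refQ" for z
      using power_mono[OF B[OF that], of 2] by simp
  qed (use m in \<open>intro borel_measurable_power\<close>)
  with m show ?thesis by (simp add: square_integrable_def)
qed

text \<open>
  The definite description denotes a polynomial because the projection exists, by Gram--Schmidt, and is
  unique: the difference of two candidates is orthogonal to itself, hence vanishes almost everywhere on
  the square, hence everywhere by continuity and the identity theorem for polynomials.
\<close>
lemma jacobi_projection_mem:
  assumes g: "square_integrable (lebesgue_on refQ) g" and \<beta>: "0 \<le> \<beta>"
  shows "jacobi_projection \<beta> p g \<in> Qpoly p"
proof -
  let ?w = "jacobi_weight \<beta> (0, 0)"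
  define M where "M = density (lebesgue_on refQ) (\<lambda>z. ennreal (?w z))"
  have wm: "?w \<in> borel_measurable (lebesgue_on refQ)" by (rule jacobi_weight_measurable_refQ)
  have LM: "(LINT z|M. h z) = (LINT z|lebesgue_on refQ. h z * ?w z)" if "h \<in> borel_measurable (lebesgue_on refQ)" for h :: "plane \<Rightarrow> real"
    using that wm unfolding M_def by (subst integral_density) (auto simp: mult.commute)
  have sqM: "square_integrable M h" if "square_integrable (lebesgue_on refQ) h" for h
  proof -
    have hm: "h \<in> borel_measurable (lebesgue_on refQ)" using that by (simp add: square_integrable_def)
    have "integrable (lebesgue_on refQ) (\<lambda>z. ?w z *\<^sub>R (h z)\<^sup>2)"
      using weighted_square_integrable[OF that \<beta>] by (simp add: mult.commute)
    then have "integrable M (\<lambda>z. (h z)\<^sup>2)"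
      unfolding M_def using hm wm by (subst integrable_density) auto
    then show ?thesis using hm by (simp add: square_integrable_def M_def)
  qed
  let ?I = "{..p} \<times> {..p}"
  define b :: "nat \<times> nat \<Rightarrow> plane \<Rightarrow> real" where "b k z = fst z ^ fst k * snd z ^ snd k" for k z
  have bQ: "b k \<in> Qpoly p" if "k \<in> ?I" for k
    unfolding b_def[abs_def] using that by (intro Qpoly_monomial) auto
  have bsq: "square_integrable M (b k)" if "k \<in> ?I" for k
    by (intro sqM smooth_square_integrable_refQ Qpoly_smooth[OF bQ[OF that]])
  have "\<exists>r. \<forall>k\<in>?I. (LINT z|M. (g z - (\<Sum>i\<in>?I. r i * b i z)) * b k z) = 0"
    by (rule orthogonal_projection_exists[OF _ bsq sqM[OF g]]) simp
  then obtain r where "\<forall>k\<in>?I. (LINT z|M. (g z - (\<Sum>i\<in>?I. r i * b i z)) * b k z) = 0"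
    by (rule exE)
  note r = bspec[OF this]
  define q where "q z = (\<Sum>i\<in>?I. r i * b i z)" for z
  have qQ: "q \<in> Qpoly p"
  proof -
    have "q = (\<lambda>(x, y). \<Sum>i\<le>p. \<Sum>j\<le>p. r (i, j) * x ^ i * y ^ j)"
      by (auto simp: q_def b_def sum.cartesian_product case_prod_beta mult.assoc)
    then show ?thesis unfolding Qpoly_def by (intro CollectI exI[of _ "\<lambda>i j. r (i, j)"])
  qed
  have qsq: "square_integrable (lebesgue_on refQ) q"
    by (intro smooth_square_integrable_refQ Qpoly_smooth[OF qQ])
  have gm: "g \<in> borel_measurable (lebesgue_on refQ)" "q \<in> borel_measurable (lebesgue_on refQ)"
    using g qsq by (simp_all add: square_integrable_def)
  have dsq: "square_integrable M (\<lambda>z. g z - q z)"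
    using square_integrable_add[OF sqM[OF g] sqM[OF qsq], of "-1"] by simp
  have orth: "(LINT z|lebesgue_on refQ. (g z - q z) * h z * ?w z) = 0" if h: "h \<in> Qpoly p" for h
  proof -
    obtain c where c: "h = (\<lambda>(x, y). \<Sum>i\<le>p. \<Sum>j\<le>p. c i j * x ^ i * y ^ j)"
      using h unfolding Qpoly_def by blast
    have hs: "h z = (\<Sum>k\<in>?I. c (fst k) (snd k) * b k z)" for z
      by (cases z) (simp add: c b_def sum.cartesian_product case_prod_beta mult.assoc)
    have "(LINT z|M. (g z - q z) * h z) = (LINT z|M. (\<Sum>k\<in>?I. c (fst k) (snd k) * ((g z - q z) * b k z)))"
      unfolding hs by (simp add: sum_distrib_left mult.left_commute)
    also have "\<dots> = (\<Sum>k\<in>?I. LINT z|M. c (fst k) (snd k) * ((g z - q z) * b k z))"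
      by (intro Bochner_Integration.integral_sum integrable_mult_right square_integrable_mult dsq bsq)
    also have "\<dots> = (\<Sum>k\<in>?I. c (fst k) (snd k) * (LINT z|M. (g z - q z) * b k z))"
      by (intro sum.cong refl) (rule integral_mult_right_zero)
    also have "\<dots> = 0" by (intro sum.neutral ballI) (simp only: q_def r mult_zero_right)
    finally have "(LINT z|M. (g z - q z) * h z) = 0" .
    then show ?thesis
      using gm smooth_measurable_refQ[OF Qpoly_smooth[OF h]] by (subst (asm) LM) auto
  qed
  have unique: "q' = q" if q': "q' \<in> Qpoly p" and o': "\<forall>h\<in>Qpoly p. (LINT z|lebesgue_on refQ. (g z - q' z) * h z * ?w z) = 0" for q'
  proof -
    define d where "d z = q' z - q z" for z
    have dQ: "d \<in> Qpoly p" using Qpoly_add_cmult[OF q' qQ, of "-1"] by (simp add: d_def[abs_def])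
    have dsm: "smooth d" by (rule Qpoly_smooth[OF dQ])
    have dd: "square_integrable (lebesgue_on refQ) d" by (rule smooth_square_integrable_refQ[OF dsm])
    have q'sq: "square_integrable (lebesgue_on refQ) q'"
      by (intro smooth_square_integrable_refQ Qpoly_smooth[OF q'])
    have I: "integrable (lebesgue_on refQ) (\<lambda>z. (g z - a z) * d z * ?w z)" if a: "square_integrable (lebesgue_on refQ) a" for a
    proof -
      have s: "square_integrable (lebesgue_on refQ) (\<lambda>z. g z - a z)"
        using square_integrable_add[OF g a, of "-1"] by simp
      have m: "(\<lambda>z. (g z - a z) * d z) \<in> borel_measurable (lebesgue_on refQ)"
        using s dd by (auto simp: square_integrable_def)
      show ?thesis
      proof (rule Bochner_Integration.integrable_bound[OF square_integrable_mult[OF s dd]])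
        show "(\<lambda>z. (g z - a z) * d z * ?w z) \<in> borel_measurable (lebesgue_on refQ)"
          using m wm by (rule borel_measurable_times)
        show "AE z in lebesgue_on refQ. norm ((g z - a z) * d z * ?w z) \<le> norm ((g z - a z) * d z)"
          by (rule AE_I2) (auto simp: space_refQ abs_mult intro!: mult_left_le jacobi_weight_le_1 \<beta>)
      qed
    qed
    have "(g z - q z) * d z * ?w z - (g z - q' z) * d z * ?w z = (d z)\<^sup>2 * ?w z" for z
      by (simp add: d_def power2_eq_square algebra_simps)
    then have "(LINT z|lebesgue_on refQ. (d z)\<^sup>2 * ?w z) = 0"
      using Bochner_Integration.integral_diff[OF I[OF qsq] I[OF q'sq]] orth[OF dQ] o' dQ by simp
    then have "AE z in lebesgue_on refQ. (d z)\<^sup>2 * ?w z = 0"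
      using integral_nonneg_eq_0_iff_AE[OF weighted_square_integrable[OF dd \<beta>]] by simp
    moreover have "?w z \<noteq> 0" if "z \<in> refQ" for z
      using gap_bounds[OF that] by (simp add: jacobi_weight_def gap_def case_prod_beta)
    ultimately have ae: "AE z\<in>refQ in lebesgue. z \<in> {z. d z = 0}"
      unfolding AE_lebesgue_on[OF open_refQ] by auto
    have "closed {z. d z = 0}"
      using smooth_continuous[OF dsm, of UNIV] by (intro closed_Collect_eq) auto
    then have "d z = 0" if "z \<in> refQ" for z
      using mem_closed_if_AE_lebesgue_open[OF open_refQ _ ae that] by simp
    then have "d = (\<lambda>_. 0)" by (rule Qpoly_zero_on_refQ[OF dQ])
    then have "q' z - q z = 0" for z unfolding d_def[abs_def] by (rule fun_cong)
    then show ?thesis by (intro ext) simp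
  qed
  have "jacobi_projection \<beta> p g = q"
    unfolding jacobi_projection_def
  proof (rule the_equality)
    show "q \<in> Qpoly p \<and> (\<forall>r\<in>Qpoly p. (LINT z|lebesgue_on refQ. (g z - q z) * r z * ?w z) = 0)"
      using qQ orth by blast
    fix q' assume q': "q' \<in> Qpoly p \<and> (\<forall>r\<in>Qpoly p. (LINT z|lebesgue_on refQ. (g z - q' z) * r z * ?w z) = 0)"
    show "q' = q" by (rule unique[OF conjunct1[OF q'] conjunct2[OF q']])
  qed
  then show ?thesis using qQ by simp
qed

section \<open>Bubbles on a mesh cell\<close>

lemma outside_refQ:
  assumes "z \<notin> refQ"
  shows "gap (fst z) \<le> 0 \<or> gap (snd z) \<le> 0"
proof (rule ccontr)
  assume "\<not> ?thesis"
  then have "(fst z)\<^sup>2 < 1" "(snd z)\<^sup>2 < 1" by (auto simp: gap_def)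
  then have "\<bar>fst z\<bar> < 1" "\<bar>snd z\<bar> < 1" by (simp_all add: abs_square_less_1)
  then have "z \<in> refQ" by (cases z) (auto simp: refQ_def)
  with assms show False by simp
qed

lemma cutoff_zero: "c > 0 \<Longrightarrow> t \<le> c \<Longrightarrow> cutoff c \<gamma> m t = 0 \<and> cutoff_slope c \<gamma> t = 0"
  by (simp add: cutoff_def cutoff_slope_def)

lemma bubble_approx_zero:
  assumes "gap (fst z) < 1 / real (Suc n) \<or> gap (snd z) < 1 / real (Suc n)"
  shows "bubble_approx \<beta> q n z = 0"
  using assms cutoff_zero[of "1 / real (Suc n)"] by (auto simp: bubble_approx_def)

lemma bubble_approx_outside:
  assumes q: "smooth q" and z: "z \<notin> refQ"
  shows "bubble_approx \<beta> q n z = 0" "pdiff1 (bubble_approx \<beta> q n) z = 0" "pdiff2 (bubble_approx \<beta> q n) z = 0"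
proof -
  have c: "0 < 1 / real (Suc n)" by simp
  have "gap (fst z) \<le> 1 / real (Suc n) \<or> gap (snd z) \<le> 1 / real (Suc n)"
    using outside_refQ[OF z] c by linarith
  then consider "cutoff (1 / real (Suc n)) \<beta> 0 (gap (fst z)) = 0" "cutoff_slope (1 / real (Suc n)) \<beta> (gap (fst z)) = 0"
    | "cutoff (1 / real (Suc n)) \<beta> 0 (gap (snd z)) = 0" "cutoff_slope (1 / real (Suc n)) \<beta> (gap (snd z)) = 0"
    using cutoff_zero[OF c] by blast
  then show "bubble_approx \<beta> q n z = 0" "pdiff1 (bubble_approx \<beta> q n) z = 0" "pdiff2 (bubble_approx \<beta> q n) z = 0"
    unfolding pdiff_bubble_approx[OF q] bubble_approx_def by (cases; simp only: mult_zero_left mult_zero_right add_0_left)+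
qed

lemma majorant_outside: "z \<notin> refQ \<Longrightarrow> majorant \<beta> z = 0"
  by (simp add: majorant_def)

lemma bubble_outside: "z \<notin> refQ \<Longrightarrow> bubble \<beta> q z = 0" "z \<notin> refQ \<Longrightarrow> bubble_dx \<beta> q z = 0" "z \<notin> refQ \<Longrightarrow> bubble_dy \<beta> q z = 0"
  by (simp_all add: bubble_def bubble_dx_def bubble_dy_def)

lemma bubble_approx_limits':
  assumes q: "smooth q"
  shows "(\<lambda>n. bubble_approx \<beta> q n z) \<longlonglongrightarrow> bubble \<beta> q z"
    and "(\<lambda>n. pdiff1 (bubble_approx \<beta> q n) z) \<longlonglongrightarrow> bubble_dx \<beta> q z"
    and "(\<lambda>n. pdiff2 (bubble_approx \<beta> q n) z) \<longlonglongrightarrow> bubble_dy \<beta> q z"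
  using bubble_approx_limits[OF q, of z \<beta>] by (cases "z \<in> refQ"; simp add: bubble_approx_outside[OF q] bubble_outside)+

context affine_chart
begin

definition cell :: "plane set" where "cell = fwd ` refQ"

lemma open_cell: "open cell" unfolding cell_def by (rule open_fwd_image[OF open_refQ])

lemma cell_iff: "z \<in> cell \<longleftrightarrow> bwd z \<in> refQ" by (simp add: cell_def fwd_image)

lemma bwd_affine: "bwd z = (m11 * fst z + m12 * snd z + (- m11 * s - m12 * t), m21 * fst z + m22 * snd z + (- m21 * s - m22 * t))"
  by (simp add: bwd_def algebra_simps)

lemma smooth_bwd: "smooth \<phi> \<Longrightarrow> smooth (\<lambda>z. \<phi> (bwd z))"
  unfolding smooth_def bwd_affine using C_k_affine_comp by blast

lemma pdiff_bwd:
  assumes "smooth \<phi>"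
  shows "pdiff1 (\<lambda>z. \<phi> (bwd z)) z = m11 * pdiff1 \<phi> (bwd z) + m21 * pdiff2 \<phi> (bwd z)"
    and "pdiff2 (\<lambda>z. \<phi> (bwd z)) z = m12 * pdiff1 \<phi> (bwd z) + m22 * pdiff2 \<phi> (bwd z)"
proof -
  have 1: "has_partials (\<lambda>z. a * fst z + b * snd z + s) a b z" for a b s z
    unfolding has_partials_def by (auto intro!: derivative_eq_intros)
  have "has_partials (\<lambda>z. \<phi> (bwd z)) (m11 * pdiff1 \<phi> (bwd z) + m21 * pdiff2 \<phi> (bwd z))
      (m12 * pdiff1 \<phi> (bwd z) + m22 * pdiff2 \<phi> (bwd z)) z"
    unfolding bwd_affine by (rule has_partials_plane_comp[OF smooth_partials[OF assms] 1 1])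
  from has_partials_pdiff[OF this]
  show "pdiff1 (\<lambda>z. \<phi> (bwd z)) z = m11 * pdiff1 \<phi> (bwd z) + m21 * pdiff2 \<phi> (bwd z)"
    "pdiff2 (\<lambda>z. \<phi> (bwd z)) z = m12 * pdiff1 \<phi> (bwd z) + m22 * pdiff2 \<phi> (bwd z)" by auto
qed

definition cell_bubble :: "real \<Rightarrow> (plane \<Rightarrow> real) \<Rightarrow> plane \<Rightarrow> real" where
  "cell_bubble \<beta> q z = bubble \<beta> q (bwd z)"

text \<open>
  The partial derivatives of the transplanted bubble, by the chain rule.
\<close>
definition cell_bubble_dx :: "real \<Rightarrow> (plane \<Rightarrow> real) \<Rightarrow> plane \<Rightarrow> real" where
  "cell_bubble_dx \<beta> q z = m11 * bubble_dx \<beta> q (bwd z) + m21 * bubble_dy \<beta> q (bwd z)"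

definition cell_bubble_dy :: "real \<Rightarrow> (plane \<Rightarrow> real) \<Rightarrow> plane \<Rightarrow> real" where
  "cell_bubble_dy \<beta> q z = m12 * bubble_dx \<beta> q (bwd z) + m22 * bubble_dy \<beta> q (bwd z)"

definition cell_approx :: "real \<Rightarrow> (plane \<Rightarrow> real) \<Rightarrow> nat \<Rightarrow> plane \<Rightarrow> real" where
  "cell_approx \<beta> q n z = bubble_approx \<beta> q n (bwd z)"

lemma cell_bubble_outside: "z \<notin> cell \<Longrightarrow> cell_bubble \<beta> q z = 0" "z \<notin> cell \<Longrightarrow> cell_bubble_dx \<beta> q z = 0" "z \<notin> cell \<Longrightarrow> cell_bubble_dy \<beta> q z = 0"
  by (simp_all add: cell_iff cell_bubble_def cell_bubble_dx_def cell_bubble_dy_def bubble_outside)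

text \<open>
  The approximation vanishes unless both coordinates \<open>x\<close> and \<open>y\<close> of the preimage satisfy
  \<open>1 - x\<^sup>2 \<ge> c\<close> and \<open>1 - y\<^sup>2 \<ge> c\<close>, which describes a compact subset of the open square.
\<close>
lemma cell_approx_test:
  assumes q: "smooth q"
  shows "cell_approx \<beta> q n \<in> test_functions cell"
proof (rule test_functionI)
  define c where "c = 1 / real (Suc n)"
  have c: "c > 0" by (simp add: c_def)
  define C where "C = {w::plane. c \<le> gap (fst w) \<and> c \<le> gap (snd w)}"
  have CQ: "C \<subseteq> refQ"
  proof
    fix w assume "w \<in> C"
    then have "\<not> (gap (fst w) \<le> 0 \<or> gap (snd w) \<le> 0)" using c by (auto simp: C_def)
    then show "w \<in> refQ" using outside_refQ by blast
  qed
  have "closed C"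
    unfolding C_def using smooth_continuous[OF smooth_gap(1), of UNIV] smooth_continuous[OF smooth_gap(2), of UNIV]
    by (intro closed_Collect_conj closed_Collect_le continuous_intros) auto
  moreover have "bounded C"
    using CQ by (rule bounded_subset[rotated]) (simp add: refQ_def bounded_Times)
  ultimately have "compact C" by (simp add: compact_eq_bounded_closed)
  then show "compact (fwd ` C)" by (rule compact_continuous_image[OF continuous_fwd])
  show "fwd ` C \<subseteq> cell" unfolding cell_def using CQ by blast
  show "smooth (cell_approx \<beta> q n)"
    unfolding cell_approx_def[abs_def] by (intro smooth_bwd smooth_bubble_approx q)
  fix z assume "z \<notin> fwd ` C"
  then have "bwd z \<notin> C" by (simp add: fwd_image)
  then show "cell_approx \<beta> q n z = 0" unfolding cell_approx_def by (intro bubble_approx_zero) (auto simp: C_def c_def)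
qed

lemma pdiff_cell_approx:
  assumes q: "smooth q"
  shows "pdiff1 (cell_approx \<beta> q n) z = m11 * pdiff1 (bubble_approx \<beta> q n) (bwd z) + m21 * pdiff2 (bubble_approx \<beta> q n) (bwd z)"
    and "pdiff2 (cell_approx \<beta> q n) z = m12 * pdiff1 (bubble_approx \<beta> q n) (bwd z) + m22 * pdiff2 (bubble_approx \<beta> q n) (bwd z)"
  using pdiff_bwd[OF smooth_bubble_approx[OF q, of \<beta> n], of z] by (simp_all add: cell_approx_def[abs_def])

lemma cell_approx_limits:
  assumes q: "smooth q"
  shows "(\<lambda>n. cell_approx \<beta> q n z) \<longlonglongrightarrow> cell_bubble \<beta> q z"
    and "(\<lambda>n. pdiff1 (cell_approx \<beta> q n) z) \<longlonglongrightarrow> cell_bubble_dx \<beta> q z"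
    and "(\<lambda>n. pdiff2 (cell_approx \<beta> q n) z) \<longlonglongrightarrow> cell_bubble_dy \<beta> q z"
  unfolding pdiff_cell_approx[OF q] cell_approx_def cell_bubble_def cell_bubble_dx_def cell_bubble_dy_def
  by (intro tendsto_intros bubble_approx_limits'[OF q])+

lemma lincomb_bounds:
  fixes k l x y M :: real
  shows "\<bar>x\<bar> \<le> M \<Longrightarrow> \<bar>y\<bar> \<le> M \<Longrightarrow> \<bar>k * x + l * y\<bar> \<le> (\<bar>k\<bar> + \<bar>l\<bar>) * M"
    and "x\<^sup>2 \<le> M \<Longrightarrow> y\<^sup>2 \<le> M \<Longrightarrow> (k * x + l * y)\<^sup>2 \<le> 2 * (k\<^sup>2 + l\<^sup>2) * M"
proof -
  assume "\<bar>x\<bar> \<le> M" "\<bar>y\<bar> \<le> M"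
  then have "\<bar>k\<bar> * \<bar>x\<bar> \<le> \<bar>k\<bar> * M" "\<bar>l\<bar> * \<bar>y\<bar> \<le> \<bar>l\<bar> * M" by (auto intro: mult_left_mono)
  then show "\<bar>k * x + l * y\<bar> \<le> (\<bar>k\<bar> + \<bar>l\<bar>) * M"
    using abs_triangle_ineq[of "k * x" "l * y"] by (simp add: abs_mult distrib_right)
next
  assume "x\<^sup>2 \<le> M" "y\<^sup>2 \<le> M"
  then have "k\<^sup>2 * x\<^sup>2 \<le> k\<^sup>2 * M" "l\<^sup>2 * y\<^sup>2 \<le> l\<^sup>2 * M" by (auto intro: mult_left_mono)
  moreover have "(k * x + l * y)\<^sup>2 \<le> 2 * (k\<^sup>2 * x\<^sup>2) + 2 * (l\<^sup>2 * y\<^sup>2)"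
    using sum_squares_bound[of "k * x" "l * y"] by (simp add: power2_sum power_mult_distrib)
  ultimately show "(k * x + l * y)\<^sup>2 \<le> 2 * (k\<^sup>2 + l\<^sup>2) * M" by (simp add: algebra_simps)
qed

definition cell_approx_dominated_by :: "real \<Rightarrow> real \<Rightarrow> (plane \<Rightarrow> real) \<Rightarrow> nat \<Rightarrow> plane \<Rightarrow> bool" where
  "cell_approx_dominated_by M \<beta> q n z \<longleftrightarrow>
    \<bar>cell_approx \<beta> q n z\<bar> \<le> M \<and> \<bar>pdiff1 (cell_approx \<beta> q n) z\<bar> \<le> M \<and> \<bar>pdiff2 (cell_approx \<beta> q n) z\<bar> \<le> M \<and>
    (cell_bubble \<beta> q z - cell_approx \<beta> q n z)\<^sup>2 \<le> M \<and>
    (cell_bubble_dx \<beta> q z - pdiff1 (cell_approx \<beta> q n) z)\<^sup>2 \<le> M \<and>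
    (cell_bubble_dy \<beta> q z - pdiff2 (cell_approx \<beta> q n) z)\<^sup>2 \<le> M \<and>
    (cell_bubble \<beta> q z)\<^sup>2 \<le> M \<and> (cell_bubble_dx \<beta> q z)\<^sup>2 \<le> M \<and> (cell_bubble_dy \<beta> q z)\<^sup>2 \<le> M"

lemma cell_approx_dominated:
  assumes q: "smooth q" and \<beta>: "1/2 < \<beta>" "\<beta> < 1"
  shows "\<exists>B\<ge>0. \<forall>n z. cell_approx_dominated_by (B * majorant \<beta> (bwd z)) \<beta> q n z"
proof -
  obtain A where A: "A \<ge> 0" and dom: "\<forall>z\<in>refQ. \<forall>n. bubble_approx_dominated_by (A * majorant \<beta> z) \<beta> q n z"
    using bubble_approx_dominated[OF q \<beta>] by blast
  have A': "\<bar>bubble_approx \<beta> q n w\<bar> \<le> A * majorant \<beta> w"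
    "\<bar>pdiff1 (bubble_approx \<beta> q n) w\<bar> \<le> A * majorant \<beta> w"
    "\<bar>pdiff2 (bubble_approx \<beta> q n) w\<bar> \<le> A * majorant \<beta> w"
    "(bubble \<beta> q w - bubble_approx \<beta> q n w)\<^sup>2 \<le> A * majorant \<beta> w"
    "(bubble_dx \<beta> q w - pdiff1 (bubble_approx \<beta> q n) w)\<^sup>2 \<le> A * majorant \<beta> w"
    "(bubble_dy \<beta> q w - pdiff2 (bubble_approx \<beta> q n) w)\<^sup>2 \<le> A * majorant \<beta> w"
    "(bubble \<beta> q w)\<^sup>2 \<le> A * majorant \<beta> w" "(bubble_dx \<beta> q w)\<^sup>2 \<le> A * majorant \<beta> w" "(bubble_dy \<beta> q w)\<^sup>2 \<le> A * majorant \<beta> w" for n w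
    using dom[rule_format, of w n, unfolded bubble_approx_dominated_by_def]
    by (cases "w \<in> refQ"; simp add: bubble_approx_outside[OF q] bubble_outside majorant_outside)+
  \<comment> \<open>a crude common factor for the chain rule, its square, and the bubble itself\<close>
  define m where "m = \<bar>m11\<bar> + \<bar>m12\<bar> + \<bar>m21\<bar> + \<bar>m22\<bar> + 2 * (m11\<^sup>2 + m12\<^sup>2 + m21\<^sup>2 + m22\<^sup>2) + 1"
  have ge: "1 \<le> m" "\<bar>m11\<bar> + \<bar>m21\<bar> \<le> m" "\<bar>m12\<bar> + \<bar>m22\<bar> \<le> m"
    "2 * (m11\<^sup>2 + m21\<^sup>2) \<le> m" "2 * (m12\<^sup>2 + m22\<^sup>2) \<le> m"
    using zero_le_power2[of m11] zero_le_power2[of m12] zero_le_power2[of m21] zero_le_power2[of m22]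
    unfolding m_def by (smt (verit))+
  have up: "x \<le> m * A * majorant \<beta> w" if "x \<le> k * (A * majorant \<beta> w)" "k \<le> m" for x k w
  proof -
    have "0 \<le> A * majorant \<beta> w" using A majorant_nonneg by simp
    then have "k * (A * majorant \<beta> w) \<le> m * (A * majorant \<beta> w)" using that(2) by (rule mult_right_mono[rotated])
    then show ?thesis using that(1) by (simp add: mult.assoc)
  qed
  have mA: "0 \<le> m * A" using ge(1) A by simp
  show ?thesis
    unfolding cell_approx_dominated_by_def
  proof (intro exI[of _ "m * A"] conjI[OF mA] allI conjI)
    fix n z
    have one: "x \<le> A * majorant \<beta> (bwd z) \<Longrightarrow> x \<le> m * A * majorant \<beta> (bwd z)" for x
      using up[OF _ ge(1), of x "bwd z"] by simp
    show "\<bar>cell_approx \<beta> q n z\<bar> \<le> m * A * majorant \<beta> (bwd z)"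
      unfolding cell_approx_def by (rule one[OF A'(1)])
    show "(cell_bubble \<beta> q z - cell_approx \<beta> q n z)\<^sup>2 \<le> m * A * majorant \<beta> (bwd z)"
      unfolding cell_approx_def cell_bubble_def by (rule one[OF A'(4)])
    show "(cell_bubble \<beta> q z)\<^sup>2 \<le> m * A * majorant \<beta> (bwd z)"
      unfolding cell_bubble_def by (rule one[OF A'(7)])
    show "\<bar>pdiff1 (cell_approx \<beta> q n) z\<bar> \<le> m * A * majorant \<beta> (bwd z)"
      unfolding pdiff_cell_approx[OF q] by (rule up[OF lincomb_bounds(1)[OF A'(2) A'(3)] ge(2)])
    show "\<bar>pdiff2 (cell_approx \<beta> q n) z\<bar> \<le> m * A * majorant \<beta> (bwd z)"
      unfolding pdiff_cell_approx[OF q] by (rule up[OF lincomb_bounds(1)[OF A'(2) A'(3)] ge(3)])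
    have e: "cell_bubble_dx \<beta> q z - pdiff1 (cell_approx \<beta> q n) z = m11 * (bubble_dx \<beta> q (bwd z) - pdiff1 (bubble_approx \<beta> q n) (bwd z))
        + m21 * (bubble_dy \<beta> q (bwd z) - pdiff2 (bubble_approx \<beta> q n) (bwd z))"
      "cell_bubble_dy \<beta> q z - pdiff2 (cell_approx \<beta> q n) z = m12 * (bubble_dx \<beta> q (bwd z) - pdiff1 (bubble_approx \<beta> q n) (bwd z))
        + m22 * (bubble_dy \<beta> q (bwd z) - pdiff2 (bubble_approx \<beta> q n) (bwd z))"
      unfolding pdiff_cell_approx[OF q] cell_bubble_dx_def cell_bubble_dy_def by (simp_all add: algebra_simps)
    show "(cell_bubble_dx \<beta> q z - pdiff1 (cell_approx \<beta> q n) z)\<^sup>2 \<le> m * A * majorant \<beta> (bwd z)"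
      unfolding e by (rule up[OF lincomb_bounds(2)[OF A'(5) A'(6)] ge(4)])
    show "(cell_bubble_dy \<beta> q z - pdiff2 (cell_approx \<beta> q n) z)\<^sup>2 \<le> m * A * majorant \<beta> (bwd z)"
      unfolding e by (rule up[OF lincomb_bounds(2)[OF A'(5) A'(6)] ge(5)])
    show "(cell_bubble_dx \<beta> q z)\<^sup>2 \<le> m * A * majorant \<beta> (bwd z)"
      unfolding cell_bubble_dx_def by (rule up[OF lincomb_bounds(2)[OF A'(8) A'(9)] ge(4)])
    show "(cell_bubble_dy \<beta> q z)\<^sup>2 \<le> m * A * majorant \<beta> (bwd z)"
      unfolding cell_bubble_dy_def by (rule up[OF lincomb_bounds(2)[OF A'(8) A'(9)] ge(5)])
  qed
qed

lemma majorant_bwd_integrable: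
  assumes "1/2 < \<beta>"
  shows "integrable lebesgue (\<lambda>z. majorant \<beta> (bwd z))"
proof -
  have i: "integrable lborel (majorant \<beta>)" by (rule majorant_integrable[OF assms])
  then have m: "majorant \<beta> \<in> borel_measurable borel" using borel_measurable_integrable by force
  have "(\<lambda>z. majorant \<beta> (bwd z)) \<in> borel_measurable borel" using measurable_compose[OF borel_bwd m] .
  then have "(\<lambda>z. majorant \<beta> (bwd z)) \<in> borel_measurable lebesgue" by (intro measurable_completion) simp
  from integrable_fwd[OF this] show ?thesis
    using i m by (simp add: integrable_completion)
qed

lemma majorant_bwd_integrable_on:
  assumes "1/2 < \<beta>" "S \<in> sets lebesgue"
  shows "integrable (lebesgue_on S) (\<lambda>z. B * majorant \<beta> (bwd z))"
  using integrable_mult_indicator[OF assms(2) majorant_bwd_integrable[OF assms(1)]] assms(2)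
  by (simp add: integrable_restrict_space)

text \<open>
  The open set \<open>S\<close> is arbitrary because the bubble and its approximations are functions on the whole
  plane. The cases in use are the domain, the cell and the reference square.
\<close>
lemma cell_bubble_has_weak_deriv:
  assumes q: "smooth q" and \<beta>: "1/2 < \<beta>" "\<beta> < 1" and S: "open S"
  shows "has_weak_deriv S (1, 0) (cell_bubble \<beta> q) (cell_bubble_dx \<beta> q)"
    and "has_weak_deriv S (0, 1) (cell_bubble \<beta> q) (cell_bubble_dy \<beta> q)"
proof -
  obtain B where dom: "\<forall>n z. cell_approx_dominated_by (B * majorant \<beta> (bwd z)) \<beta> q n z"
    using cell_approx_dominated[OF q \<beta>] by blast
  have B: "\<bar>cell_approx \<beta> q n z\<bar> \<le> B * majorant \<beta> (bwd z)" "\<bar>pdiff1 (cell_approx \<beta> q n) z\<bar> \<le> B * majorant \<beta> (bwd z)"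
    "\<bar>pdiff2 (cell_approx \<beta> q n) z\<bar> \<le> B * majorant \<beta> (bwd z)" for n z
    using dom[rule_format, of z n] unfolding cell_approx_dominated_by_def by simp_all
  have Sl: "S \<in> sets lebesgue" using S by auto
  have sm: "smooth (cell_approx \<beta> q n)" for n by (rule test_function_smooth[OF cell_approx_test[OF q]])
  show "has_weak_deriv S (1, 0) (cell_bubble \<beta> q) (cell_bubble_dx \<beta> q)"
    by (rule has_weak_deriv_limit[OF smooth_has_weak_deriv(1)[OF sm S] S _ majorant_bwd_integrable_on[OF \<beta>(1) Sl]
          cell_approx_limits(1)[OF q] cell_approx_limits(2)[OF q] B(1) B(2)]) simp
  show "has_weak_deriv S (0, 1) (cell_bubble \<beta> q) (cell_bubble_dy \<beta> q)"
    by (rule has_weak_deriv_limit[OF smooth_has_weak_deriv(2)[OF sm S] S _ majorant_bwd_integrable_on[OF \<beta>(1) Sl]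
          cell_approx_limits(1)[OF q] cell_approx_limits(3)[OF q] B(1) B(3)]) simp
qed

lemma cell_bubble_square_integrable:
  assumes q: "smooth q" and \<beta>: "1/2 < \<beta>" "\<beta> < 1" and S: "open S"
  shows "square_integrable (lebesgue_on S) (cell_bubble \<beta> q)" "square_integrable (lebesgue_on S) (cell_bubble_dx \<beta> q)"
    "square_integrable (lebesgue_on S) (cell_bubble_dy \<beta> q)"
proof -
  obtain B where dom: "\<forall>n z. cell_approx_dominated_by (B * majorant \<beta> (bwd z)) \<beta> q n z"
    using cell_approx_dominated[OF q \<beta>] by blast
  have B: "(cell_bubble \<beta> q z)\<^sup>2 \<le> B * majorant \<beta> (bwd z)" "(cell_bubble_dx \<beta> q z)\<^sup>2 \<le> B * majorant \<beta> (bwd z)"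
    "(cell_bubble_dy \<beta> q z)\<^sup>2 \<le> B * majorant \<beta> (bwd z)" for z
    using dom[rule_format, of z 0] unfolding cell_approx_dominated_by_def by simp_all
  have Sl: "S \<in> sets lebesgue" using S by auto
  note d = cell_bubble_has_weak_deriv[OF q \<beta> S]
  have "cell_bubble \<beta> q \<in> borel_measurable (lebesgue_on S)"
    using d(1) S by (intro locally_integrable_measurable) (simp_all add: has_weak_deriv_def)
  moreover note has_weak_deriv_measurable[OF d(1) S] has_weak_deriv_measurable[OF d(2) S]
  moreover have "integrable (lebesgue_on S) (\<lambda>z. (h z)\<^sup>2)"
    if "h \<in> borel_measurable (lebesgue_on S)" "\<And>z. (h z)\<^sup>2 \<le> B * majorant \<beta> (bwd z)" for h
  proof (rule Bochner_Integration.integrable_bound[OF majorant_bwd_integrable_on[OF \<beta>(1) Sl, of B]])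
    show "AE z in lebesgue_on S. norm ((h z)\<^sup>2) \<le> norm (B * majorant \<beta> (bwd z))"
    proof (rule AE_I2)
      fix z show "norm ((h z)\<^sup>2) \<le> norm (B * majorant \<beta> (bwd z))" using that(2)[of z] by simp
    qed
  qed (use that(1) in \<open>rule borel_measurable_power\<close>)
  ultimately show "square_integrable (lebesgue_on S) (cell_bubble \<beta> q)" "square_integrable (lebesgue_on S) (cell_bubble_dx \<beta> q)"
    "square_integrable (lebesgue_on S) (cell_bubble_dy \<beta> q)"
    using B by (simp_all add: square_integrable_def)
qed

lemma cell_bubble_in_H01:
  assumes q: "smooth q" and \<beta>: "1/2 < \<beta>" "\<beta> < 1" and S: "open S" "cell \<subseteq> S"
  shows "cell_bubble \<beta> q \<in> H01_space S"
proof -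
  obtain B where dom: "\<forall>n z. cell_approx_dominated_by (B * majorant \<beta> (bwd z)) \<beta> q n z"
    using cell_approx_dominated[OF q \<beta>] by blast
  have B: "(cell_bubble \<beta> q z - cell_approx \<beta> q n z)\<^sup>2 \<le> B * majorant \<beta> (bwd z)"
    "(cell_bubble_dx \<beta> q z - pdiff1 (cell_approx \<beta> q n) z)\<^sup>2 \<le> B * majorant \<beta> (bwd z)"
    "(cell_bubble_dy \<beta> q z - pdiff2 (cell_approx \<beta> q n) z)\<^sup>2 \<le> B * majorant \<beta> (bwd z)" for n z
    using dom[rule_format, of z n] unfolding cell_approx_dominated_by_def by simp_all
  have Sl: "S \<in> sets lebesgue" using S by auto
  note d = cell_bubble_has_weak_deriv[OF q \<beta> S(1)]
  have test: "cell_approx \<beta> q n \<in> test_functions S" for n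
    using cell_approx_test[OF q] test_function_mono[OF S(2)] by blast
  have lim: "(\<lambda>n. Hk_norm 1 S (\<lambda>z. cell_bubble \<beta> q z - cell_approx \<beta> q n z)) \<longlonglongrightarrow> 0"
    by (rule sobolev_norm_1_tendsto_0[OF S(1) d test_function_smooth[OF test] cell_approx_limits[OF q] _ majorant_bwd_integrable_on[OF \<beta>(1) Sl, of B]])
       (use B in auto)
  have fin: "(\<integral>\<^sup>+ z. ennreal ((h z)\<^sup>2 * 1) \<partial>lebesgue_on S) < top" if "square_integrable (lebesgue_on S) h" for h
    using that by (simp add: square_integrable_def integrable_iff_bounded)
  have "Hk_norm 1 S (cell_bubble \<beta> q) < top"
    unfolding sobolev_norm_1[OF S(1) d] enn_sqrt_less_top_iff
    using fin[OF cell_bubble_square_integrable(1)[OF q \<beta> S(1)]] fin[OF cell_bubble_square_integrable(2)[OF q \<beta> S(1)]]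
      fin[OF cell_bubble_square_integrable(3)[OF q \<beta> S(1)]] by (simp del: mult_1_right)
  then have "cell_bubble \<beta> q \<in> Hk_space 1 S" using weakly_diff_1[OF d] by (simp add: Hk_space_def)
  then show ?thesis unfolding H01_space_def using test lim by blast
qed

end

text \<open>
  The reference square is the cell of the identity map, so the facts about bubbles on a cell specialise to it.
\<close>
interpretation id_chart: affine_chart 1 0 0 1 0 0
  by unfold_locales simp

lemma id_chart_simps: "id_chart.bwd z = z" "id_chart.cell_bubble \<beta> q = bubble \<beta> q" "id_chart.cell_bubble_dx \<beta> q = bubble_dx \<beta> q"
  "id_chart.cell_bubble_dy \<beta> q = bubble_dy \<beta> q"
proof -
  show 1: "id_chart.bwd z = z" for z
    by (simp add: id_chart.bwd_def id_chart.m11_def id_chart.m12_def id_chart.m21_def id_chart.m22_def)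
  show "id_chart.cell_bubble \<beta> q = bubble \<beta> q" "id_chart.cell_bubble_dx \<beta> q = bubble_dx \<beta> q" "id_chart.cell_bubble_dy \<beta> q = bubble_dy \<beta> q"
    by (auto simp: id_chart.cell_bubble_def id_chart.cell_bubble_dx_def id_chart.cell_bubble_dy_def 1
        id_chart.m11_def id_chart.m12_def id_chart.m21_def id_chart.m22_def)
qed

lemma bubble_has_weak_deriv:
  assumes "smooth q" "1/2 < \<beta>" "\<beta> < 1"
  shows "has_weak_deriv refQ (1, 0) (bubble \<beta> q) (bubble_dx \<beta> q)"
    and "has_weak_deriv refQ (0, 1) (bubble \<beta> q) (bubble_dy \<beta> q)"
  using id_chart.cell_bubble_has_weak_deriv[OF assms open_refQ] by (simp_all add: id_chart_simps)

lemma bubble_in_Hkb: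
  assumes q: "smooth q" and \<beta>: "1/2 < \<beta>" "\<beta> < 1"
  shows "bubble \<beta> q \<in> Hkb_space_ref 1 (- \<beta>)"
proof -
  obtain B where dom: "\<forall>z\<in>refQ. \<forall>n. bubble_approx_dominated_by (B * majorant \<beta> z) \<beta> q n z"
    using bubble_approx_dominated[OF q \<beta>] by blast
  have B: "(bubble \<beta> q z - bubble_approx \<beta> q n z)\<^sup>2 * jacobi_weight (- \<beta>) (0, 0) z \<le> B * majorant \<beta> z"
    "(bubble_dx \<beta> q z - pdiff1 (bubble_approx \<beta> q n) z)\<^sup>2 * jacobi_weight (- \<beta>) (1, 0) z \<le> B * majorant \<beta> z"
    "(bubble_dy \<beta> q z - pdiff2 (bubble_approx \<beta> q n) z)\<^sup>2 * jacobi_weight (- \<beta>) (0, 1) z \<le> B * majorant \<beta> z" if "z \<in> refQ" for n z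
    using dom[rule_format, OF that, of n] unfolding bubble_approx_dominated_by_def by simp_all
  note d = bubble_has_weak_deriv[OF q \<beta>]
  have int: "integrable (lebesgue_on refQ) (\<lambda>z. B * majorant \<beta> z)"
    using id_chart.majorant_bwd_integrable_on[OF \<beta>(1) refQ_lebesgue(1), of B] by (simp add: id_chart_simps)
  have "(\<lambda>n. Hkb_norm_ref 1 (- \<beta>) (\<lambda>z. bubble \<beta> q z - bubble_approx \<beta> q n z)) \<longlonglongrightarrow> 0"
    by (rule sobolev_norm_1_tendsto_0[OF open_refQ d smooth_bubble_approx[OF q] bubble_approx_limits[OF q]
          jacobi_weight_measurable_refQ int B])
  then show ?thesis
    unfolding Hkb_space_ref_def using weakly_diff_1[OF d] smooth_bubble_approx[OF q] by blast
qed

section \<open>The weighted norm of the bubble\<close>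

lemma bubble_cmult:
  assumes "smooth q"
  shows "bubble \<beta> (\<lambda>z. k * q z) z = k * bubble \<beta> q z"
    and "bubble_dx \<beta> (\<lambda>z. k * q z) z = k * bubble_dx \<beta> q z"
    and "bubble_dy \<beta> (\<lambda>z. k * q z) z = k * bubble_dy \<beta> q z"
proof -
  have z: "pdiff1 (\<lambda>_. k) z = 0" "pdiff2 (\<lambda>_. k) z = 0"
    by (rule has_partials_pdiff[OF has_partials_const])+
  have "pdiff1 (\<lambda>z. k * q z) z = k * pdiff1 q z" "pdiff2 (\<lambda>z. k * q z) z = k * pdiff2 q z"
    using smooth_pdiff_mult[OF smooth_const[of k] assms, of z] by (simp_all add: z)
  then show "bubble \<beta> (\<lambda>z. k * q z) z = k * bubble \<beta> q z" "bubble_dx \<beta> (\<lambda>z. k * q z) z = k * bubble_dx \<beta> q z"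
    "bubble_dy \<beta> (\<lambda>z. k * q z) z = k * bubble_dy \<beta> q z"
    by (simp_all add: bubble_def bubble_dx_def bubble_dy_def algebra_simps)
qed

lemma bubble_weighted_square:
  assumes "z \<in> refQ"
  shows "(bubble \<beta> q z)\<^sup>2 * jacobi_weight (- \<beta>) (0, 0) z = (q z)\<^sup>2 * jacobi_weight \<beta> (0, 0) z"
proof -
  have W: "jacobi_weight \<gamma> (0, 0) z = gap (fst z) powr \<gamma> * gap (snd z) powr \<gamma>" for \<gamma>
    by (simp add: jacobi_weight_def gap_def case_prod_beta)
  have "(bubble \<beta> q z)\<^sup>2 * jacobi_weight (- \<beta>) (0, 0) z =
      (q z)\<^sup>2 * (((gap (fst z) powr \<beta>)\<^sup>2 * gap (fst z) powr (- \<beta>)) * ((gap (snd z) powr \<beta>)\<^sup>2 * gap (snd z) powr (- \<beta>)))"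
    using assms unfolding W bubble_def by (simp only: power_mult_distrib if_True ac_simps)
  then show ?thesis unfolding powr_square_weight W .
qed

text \<open>
  The squared norm is a number \<open>r\<close> that scales quadratically with the polynomial; this allows a
  normalisation to norm one later on. The constant comes from \<open>1 + 2 * (p + 1) * (p + 2 * \<beta>) \<le> 1 + 12 * p\<^sup>2\<close>,
  which is at most \<open>16 * p\<^sup>2\<close> for \<open>p \<ge> 1\<close>.
\<close>
lemma bubble_norm:
  assumes q: "q \<in> Qpoly p" and p: "1 \<le> p" and \<beta>: "1/2 < \<beta>" "\<beta> < 1"
  defines "N \<equiv> (LINT z|lebesgue_on refQ. (q z)\<^sup>2 * jacobi_weight \<beta> (0, 0) z)"
  shows "\<exists>r. N \<le> r \<and> r \<le> 16 * (real p)\<^sup>2 * N \<and>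
    (\<forall>k. Hkb_norm_ref 1 (- \<beta>) (bubble \<beta> (\<lambda>z. k * q z)) = enn_sqrt (ennreal (k\<^sup>2 * r)))"
proof -
  have sm: "smooth q" by (rule Qpoly_smooth[OF q])
  have "integrable (lebesgue_on refQ) (\<lambda>z. (q z)\<^sup>2 * jacobi_weight \<beta> (0, 0) z)"
    using \<beta> by (intro weighted_square_integrable smooth_square_integrable_refQ sm) auto
  then have N: "(\<integral>\<^sup>+ z. ennreal ((q z)\<^sup>2 * jacobi_weight \<beta> (0, 0) z) \<partial>lebesgue_on refQ) = ennreal N"
    unfolding N_def by (intro nn_integral_eq_integral) auto
  have N0: "0 \<le> N" unfolding N_def by (intro integral_nonneg_AE AE_I2) simp
  define A0 A1 A2 where "A0 = (\<integral>\<^sup>+ z. ennreal ((bubble \<beta> q z)\<^sup>2 * jacobi_weight (- \<beta>) (0, 0) z) \<partial>lebesgue_on refQ)"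
    and "A1 = (\<integral>\<^sup>+ z. ennreal ((bubble_dx \<beta> q z)\<^sup>2 * jacobi_weight (- \<beta>) (1, 0) z) \<partial>lebesgue_on refQ)"
    and "A2 = (\<integral>\<^sup>+ z. ennreal ((bubble_dy \<beta> q z)\<^sup>2 * jacobi_weight (- \<beta>) (0, 1) z) \<partial>lebesgue_on refQ)"
  have A0: "A0 = ennreal N"
    unfolding A0_def N[symmetric] by (rule nn_integral_cong) (simp add: space_refQ bubble_weighted_square)
  define L where "L = real (p + 1) * (real p + 2 * \<beta>)"
  have "L \<le> (2 * real p) * (3 * real p)"
    unfolding L_def using p \<beta> by (intro mult_mono) auto
  then have L: "0 \<le> L" "L \<le> 6 * (real p)\<^sup>2" using \<beta> by (simp_all add: L_def power2_eq_square)
  have b: "1/2 \<le> \<beta>" using \<beta> by simp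
  have A12: "A1 \<le> ennreal (L * N)" "A2 \<le> ennreal (L * N)"
    using bubble_dx_norm_bound[OF q b] bubble_dy_norm_bound[OF q b] L N0
    unfolding A1_def A2_def N L_def by (simp_all add: ennreal_mult)
  have fin: "A0 + A1 + A2 < top"
    using A0 A12 by (simp add: less_top[symmetric] top_unique) (metis ennreal_less_top leD top.not_eq_extremum)
  define r where "r = enn2real (A0 + A1 + A2)"
  have r: "A0 + A1 + A2 = ennreal r" unfolding r_def using fin by (simp add: less_top)
  have r0: "0 \<le> r" by (simp add: r_def)
  have "ennreal N \<le> ennreal r" using r A0 by (metis add.assoc le_iff_add)
  then have 1: "N \<le> r" using r0 by (simp add: ennreal_le_iff)
  have "ennreal r \<le> ennreal N + ennreal (L * N) + ennreal (L * N)"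
    unfolding r[symmetric] A0 by (intro add_mono A12 order_refl)
  also have "\<dots> = ennreal (N + L * N + L * N)" using N0 L by (simp add: ennreal_plus[symmetric] del: ennreal_plus)
  finally have le: "ennreal r \<le> ennreal (N + L * N + L * N)" .
  have "0 \<le> N + L * N + L * N" using N0 L by simp
  then have "r \<le> N + L * N + L * N" using le ennreal_le_iff by blast
  also have "\<dots> = (1 + 2 * L) * N" by (simp add: algebra_simps)
  also have "\<dots> \<le> (16 * (real p)\<^sup>2) * N"
  proof (rule mult_right_mono[OF _ N0])
    have "1 \<le> (real p)\<^sup>2" using p by simp
    then show "1 + 2 * L \<le> 16 * (real p)\<^sup>2" using L by linarith
  qed
  finally have 2: "r \<le> 16 * (real p)\<^sup>2 * N" .
  have "Hkb_norm_ref 1 (- \<beta>) (bubble \<beta> (\<lambda>z. k * q z)) = enn_sqrt (ennreal (k\<^sup>2 * r))" for k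
  proof -
    have ksm: "smooth (\<lambda>z. k * q z)" by (intro smooth_mult smooth_const sm)
    note d = bubble_has_weak_deriv[OF sm \<beta>] and kd = bubble_has_weak_deriv[OF ksm \<beta>]
    have m: "bubble \<beta> q \<in> borel_measurable (lebesgue_on refQ)" "bubble_dx \<beta> q \<in> borel_measurable (lebesgue_on refQ)"
      "bubble_dy \<beta> q \<in> borel_measurable (lebesgue_on refQ)"
      using d open_refQ by (auto simp: has_weak_deriv_def intro!: locally_integrable_measurable)
    have sc: "(\<integral>\<^sup>+ z. ennreal ((k * h z)\<^sup>2 * jacobi_weight (- \<beta>) \<alpha> z) \<partial>lebesgue_on refQ) =
        ennreal (k\<^sup>2) * (\<integral>\<^sup>+ z. ennreal ((h z)\<^sup>2 * jacobi_weight (- \<beta>) \<alpha> z) \<partial>lebesgue_on refQ)"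
      if "h \<in> borel_measurable (lebesgue_on refQ)" for h \<alpha>
    proof -
      have e: "ennreal ((k * h z)\<^sup>2 * jacobi_weight (- \<beta>) \<alpha> z) = ennreal (k\<^sup>2) * ennreal ((h z)\<^sup>2 * jacobi_weight (- \<beta>) \<alpha> z)" for z
        by (subst ennreal_mult[symmetric]) (simp_all add: power_mult_distrib mult.assoc)
      have "(\<lambda>z. ennreal ((h z)\<^sup>2 * jacobi_weight (- \<beta>) \<alpha> z)) \<in> borel_measurable (lebesgue_on refQ)"
        using that jacobi_weight_measurable_refQ[of "- \<beta>" \<alpha>] by measurable
      then show ?thesis unfolding e by (rule nn_integral_cmult)
    qed
    have "Hkb_norm_ref 1 (- \<beta>) (bubble \<beta> (\<lambda>z. k * q z)) = enn_sqrt (ennreal (k\<^sup>2) * A0 + ennreal (k\<^sup>2) * A1 + ennreal (k\<^sup>2) * A2)"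
      unfolding sobolev_norm_1[OF open_refQ kd] bubble_cmult[OF sm] sc[OF m(1)] sc[OF m(2)] sc[OF m(3)]
      by (simp only: A0_def A1_def A2_def)
    also have "ennreal (k\<^sup>2) * A0 + ennreal (k\<^sup>2) * A1 + ennreal (k\<^sup>2) * A2 = ennreal (k\<^sup>2) * ennreal r"
      unfolding r[symmetric] by (simp only: distrib_left)
    also have "\<dots> = ennreal (k\<^sup>2 * r)" using r0 by (simp add: ennreal_mult)
    finally show ?thesis .
  qed
  with 1 2 show ?thesis by blast
qed

section \<open>The error energy of a bubble\<close>

lemma refQ_box: "refQ = box (-1, -1) (1, 1)"
  by (auto simp: box_plane refQ_def)

lemma closure_refQ: "closure refQ = cbox (-1, -1) (1, 1)"
proof -
  have "(0, 0) \<in> (box (-1, -1) (1, 1) :: plane set)" by (simp add: box_plane)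
  then show ?thesis unfolding refQ_box by (intro closure_box) blast
qed

lemma H01_subset: "u \<in> H01_space S \<Longrightarrow> u \<in> Hk_space 1 S"
  by (simp add: H01_space_def)

text \<open>
  The finite element function agrees with a polynomial on the cell only, whereas smoothness is a property of
  functions on the whole plane.
\<close>
lemma has_weak_deriv_cong:
  assumes "has_weak_deriv S \<alpha> u g" "\<And>z. z \<in> S \<Longrightarrow> u z = u' z"
  shows "has_weak_deriv S \<alpha> u' g"
proof -
  have i: "integrable (lebesgue_on C) u \<longleftrightarrow> integrable (lebesgue_on C) u'" if "C \<subseteq> S" for C
    using that assms(2) by (intro Bochner_Integration.integrable_cong) (auto simp: space_restrict_space)
  have "locally_integrable S u" using assms(1) by (simp add: has_weak_deriv_def)
  then have "locally_integrable S u'" unfolding locally_integrable_def using i by blast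
  moreover have eq: "(LINT z|lebesgue_on S. u' z * h z) = (LINT z|lebesgue_on S. u z * h z)" for h
    using assms(2) by (intro Bochner_Integration.integral_cong) (auto simp: space_restrict_space)
  ultimately show ?thesis using assms(1) unfolding has_weak_deriv_def eq by blast
qed

lemma pdiff_second: "pdiff (2, 0) u = pdiff1 (pdiff1 u)" "pdiff (0, 2) u = pdiff2 (pdiff2 u)"
  by (simp_all add: pdiff_def numeral_2_eq_2)

lemma square_integrable_mono:
  assumes "square_integrable (lebesgue_on S) h" "A \<subseteq> S" "S \<in> sets lebesgue" "A \<in> sets lebesgue"
  shows "square_integrable (lebesgue_on A) h"
proof -
  have r: "restrict_space (lebesgue_on S) A = lebesgue_on A"
    using assms by (simp add: restrict_restrict_space Int_absorb1)
  have "A \<in> sets (lebesgue_on S)" using assms by (auto simp: sets_restrict_space)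
  then have "integrable (restrict_space (lebesgue_on S) A) (\<lambda>z. (h z)\<^sup>2)"
    using assms integrable_mult_indicator[of A "lebesgue_on S" "\<lambda>z. (h z)\<^sup>2"]
    by (subst integrable_restrict_space) (auto simp: square_integrable_def space_restrict_space Int_absorb2)
  moreover have "h \<in> borel_measurable (restrict_space (lebesgue_on S) A)"
    using measurable_restrict_space1[of h "lebesgue_on S" borel A] assms(1) unfolding square_integrable_def by blast
  ultimately show ?thesis unfolding r square_integrable_def by blast
qed

context affine_chart
begin

lemma cell_lebesgue [simp]: "cell \<in> sets lebesgue"
  using open_cell by auto

text \<open>
  The affine map is a homeomorphism of the plane and the square is the interior of its closure.
\<close>
lemma interior_cell: "interior (fwd ` closure refQ) = cell"
proof
  have "open (bwd ` interior (fwd ` closure refQ))"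
  proof -
    have "bwd ` A = fwd -` A" for A by (force intro: image_eqI[of _ _ "fwd _"])
    then show ?thesis by (simp add: open_vimage continuous_fwd)
  qed
  moreover have "bwd ` interior (fwd ` closure refQ) \<subseteq> closure refQ"
    using interior_subset[of "fwd ` closure refQ"] by auto
  ultimately have "bwd ` interior (fwd ` closure refQ) \<subseteq> interior (closure refQ)" by (simp add: interior_maximal)
  also have "interior (closure refQ) = refQ" unfolding closure_refQ by (simp add: refQ_box)
  finally show "interior (fwd ` closure refQ) \<subseteq> cell" by (auto simp: cell_iff)
  show "cell \<subseteq> interior (fwd ` closure refQ)"
    unfolding cell_def using closure_subset open_fwd_image[OF open_refQ] by (intro interior_maximal image_mono)
qed

lemma indicator_cell_fwd: "indicator cell (fwd z) = (indicator refQ z :: real)"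
  by (simp add: indicator_def cell_iff)

lemma cell_transfer:
  fixes h :: "plane \<Rightarrow> real"
  shows "h \<in> borel_measurable (lebesgue_on cell) \<Longrightarrow> (\<lambda>z. h (fwd z)) \<in> borel_measurable (lebesgue_on refQ)"
    and "integrable (lebesgue_on cell) h \<Longrightarrow> integrable (lebesgue_on refQ) (\<lambda>z. h (fwd z))"
    and "integrable (lebesgue_on cell) h \<Longrightarrow> (LINT z|lebesgue_on cell. h z) = jac * (LINT z|lebesgue_on refQ. h (fwd z))"
proof -
  have m: "(\<lambda>z. indicator cell z *\<^sub>R h z) \<in> borel_measurable lebesgue" if "h \<in> borel_measurable (lebesgue_on cell)"
    using that by (subst borel_measurable_restrict_space_iff[symmetric]) auto
  show "(\<lambda>z. h (fwd z)) \<in> borel_measurable (lebesgue_on refQ)" if "h \<in> borel_measurable (lebesgue_on cell)"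
    using measurable_comp_fwd[OF m[OF that]]
    by (subst borel_measurable_restrict_space_iff) (auto simp: indicator_cell_fwd)
  show "integrable (lebesgue_on refQ) (\<lambda>z. h (fwd z))" if h: "integrable (lebesgue_on cell) h"
  proof -
    have "integrable lebesgue (\<lambda>z. indicator cell z *\<^sub>R h z)" using h by (simp add: integrable_restrict_space)
    then have "integrable lebesgue (\<lambda>z. indicator cell (fwd z) *\<^sub>R h (fwd z))"
      using integrable_fwd[OF m[OF borel_measurable_integrable[OF h]]] by blast
    then show ?thesis unfolding indicator_cell_fwd by (simp add: integrable_restrict_space)
  qed
  show "(LINT z|lebesgue_on cell. h z) = jac * (LINT z|lebesgue_on refQ. h (fwd z))" if h: "integrable (lebesgue_on cell) h"
    using integral_fwd[OF m[OF borel_measurable_integrable[OF h]]]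
    unfolding indicator_cell_fwd by (simp add: integral_restrict_space)
qed

text \<open>
  The second derivatives of a transplanted polynomial are linear combinations of second derivatives in
  reference coordinates, and differentiation does not leave \<^const>\<open>Qpoly\<close>.
\<close>
lemma laplacian_pullback:
  assumes q: "q \<in> Qpoly p"
  obtains r where "r \<in> Qpoly p"
    "\<And>z. pdiff1 (pdiff1 (\<lambda>z. q (bwd z))) z + pdiff2 (pdiff2 (\<lambda>z. q (bwd z))) z = r (bwd z)"
proof -
  have lin: "(\<lambda>z. k * a z + l * b z) \<in> Qpoly p" if "a \<in> Qpoly p" "b \<in> Qpoly p" for a b k l
    using Qpoly_add_cmult[OF Qpoly_add_cmult[OF Qpoly_zero that(1)] that(2), of k l] by simp
  define r1 where "r1 = (\<lambda>z. m11 * pdiff1 q z + m21 * pdiff2 q z)"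
  define r2 where "r2 = (\<lambda>z. m12 * pdiff1 q z + m22 * pdiff2 q z)"
  have r12: "r1 \<in> Qpoly p" "r2 \<in> Qpoly p"
    unfolding r1_def r2_def by (intro lin Qpoly_pdiff1 Qpoly_pdiff2 q)+
  have P: "pdiff1 (\<lambda>z. q (bwd z)) = (\<lambda>z. r1 (bwd z))" "pdiff2 (\<lambda>z. q (bwd z)) = (\<lambda>z. r2 (bwd z))"
    using pdiff_bwd[OF Qpoly_smooth[OF q]] by (auto simp: r1_def r2_def)
  define s1 where "s1 = (\<lambda>z. m11 * pdiff1 r1 z + m21 * pdiff2 r1 z)"
  define s2 where "s2 = (\<lambda>z. m12 * pdiff1 r2 z + m22 * pdiff2 r2 z)"
  have s12: "s1 \<in> Qpoly p" "s2 \<in> Qpoly p"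
    unfolding s1_def s2_def by (intro lin Qpoly_pdiff1 Qpoly_pdiff2 r12)+
  show thesis
  proof
    show "(\<lambda>z. s1 z + 1 * s2 z) \<in> Qpoly p" by (rule Qpoly_add_cmult[OF s12])
    show "pdiff1 (pdiff1 (\<lambda>z. q (bwd z))) z + pdiff2 (pdiff2 (\<lambda>z. q (bwd z))) z = s1 (bwd z) + 1 * s2 (bwd z)" for z
      unfolding P pdiff_bwd(1)[OF Qpoly_smooth[OF r12(1)]] pdiff_bwd(2)[OF Qpoly_smooth[OF r12(2)]]
      by (simp add: s1_def s2_def)
  qed
qed

lemma smooth_bounded_cell:
  assumes "smooth h"
  obtains B where "\<And>z. z \<in> cell \<Longrightarrow> \<bar>h z\<bar> \<le> B"
proof -
  have "compact (h ` fwd ` cbox (-1, -1) (1, 1))"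
    by (intro compact_continuous_image continuous_fwd smooth_continuous assms) simp
  then have "bounded (h ` fwd ` cbox (-1, -1) (1, 1))" by (rule compact_imp_bounded)
  then obtain B where B: "\<forall>y\<in>h ` fwd ` cbox (-1, -1) (1, 1). norm y \<le> B" unfolding bounded_iff by blast
  have "cell \<subseteq> fwd ` cbox (-1, -1) (1, 1)"
    unfolding cell_def refQ_box by (intro image_mono box_subset_cbox)
  then have "\<bar>h z\<bar> \<le> B" if "z \<in> cell" for z using B that by fastforce
  then show thesis by (rule that)
qed

lemma smooth_square_integrable_cell:
  assumes h: "smooth h"
  shows "square_integrable (lebesgue_on cell) h"
proof -
  obtain B where B: "\<And>z. z \<in> cell \<Longrightarrow> \<bar>h z\<bar> \<le> B" using smooth_bounded_cell[OF h] by blast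
  have m: "h \<in> borel_measurable (lebesgue_on cell)"
    using smooth_continuous[OF h] open_cell by (intro continuous_imp_measurable_on_sets_lebesgue) auto
  have "bounded cell"
  proof -
    have "bounded (fwd ` cbox (-1, -1) (1, 1))"
      by (intro compact_imp_bounded compact_continuous_image continuous_fwd) simp
    then show ?thesis
      unfolding cell_def refQ_box by (rule bounded_subset) (intro image_mono box_subset_cbox)
  qed
  then have fin: "emeasure (lebesgue_on cell) cell < \<infinity>"
  proof -
    have "cell \<in> sets borel" using open_cell by simp
    then show ?thesis using emeasure_bounded_finite[OF \<open>bounded cell\<close>] by (simp add: emeasure_restrict_space)
  qed
  have "integrable (lebesgue_on cell) (\<lambda>z. (h z)\<^sup>2)"
  proof (rule integrableI_bounded_set[of cell _ _ "B\<^sup>2"])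
    show "AE z\<in>cell in lebesgue_on cell. norm ((h z)\<^sup>2) \<le> B\<^sup>2"
    proof (intro AE_I2 impI)
      fix z assume "z \<in> cell"
      from power_mono[OF B[OF this], of 2] show "norm ((h z)\<^sup>2) \<le> B\<^sup>2" by simp
    qed
    show "(\<lambda>z. (h z)\<^sup>2) \<in> borel_measurable (lebesgue_on cell)" using m by (rule borel_measurable_power)
    show "AE z in lebesgue_on cell. z \<notin> cell \<longrightarrow> (h z)\<^sup>2 = 0" by (rule AE_I2) (simp add: space_restrict_space)
  qed (use fin in \<open>auto simp: sets_restrict_space\<close>)
  with m show ?thesis by (simp add: square_integrable_def)
qed

text \<open>
  The bubble is not a test function, but it is a dominated limit of test functions supported in the cell.
\<close>
lemma cell_bubble_integration_by_parts:
  assumes h: "smooth h" and q: "smooth q" and \<beta>: "1/2 < \<beta>" "\<beta> < 1"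
  shows "(LINT z|lebesgue_on cell. h z * cell_bubble_dx \<beta> q z) = - (LINT z|lebesgue_on cell. pdiff1 h z * cell_bubble \<beta> q z)"
    and "(LINT z|lebesgue_on cell. h z * cell_bubble_dy \<beta> q z) = - (LINT z|lebesgue_on cell. pdiff2 h z * cell_bubble \<beta> q z)"
proof -
  obtain B where dom: "\<forall>n z. cell_approx_dominated_by (B * majorant \<beta> (bwd z)) \<beta> q n z"
    using cell_approx_dominated[OF q \<beta>] by blast
  have B: "\<bar>cell_approx \<beta> q n z\<bar> \<le> B * majorant \<beta> (bwd z)" "\<bar>pdiff1 (cell_approx \<beta> q n) z\<bar> \<le> B * majorant \<beta> (bwd z)"
    "\<bar>pdiff2 (cell_approx \<beta> q n) z\<bar> \<le> B * majorant \<beta> (bwd z)" for n z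
    using dom[rule_format, of z n] unfolding cell_approx_dominated_by_def by simp_all
  have cm: "k \<in> borel_measurable (lebesgue_on cell)" if "smooth k" for k
    using smooth_continuous[OF that] open_cell by (intro continuous_imp_measurable_on_sets_lebesgue) auto
  have lim: "(\<lambda>n. LINT z|lebesgue_on cell. k z * a n z) \<longlonglongrightarrow> (LINT z|lebesgue_on cell. k z * a' z)"
    if k: "smooth k" and a: "\<And>n. smooth (a n)" "\<And>z. (\<lambda>n. a n z) \<longlonglongrightarrow> a' z" "\<And>n z. \<bar>a n z\<bar> \<le> B * majorant \<beta> (bwd z)"
      and a': "a' \<in> borel_measurable (lebesgue_on cell)" for k a a'
  proof -
    obtain M where M: "\<And>z. z \<in> cell \<Longrightarrow> \<bar>k z\<bar> \<le> M" using smooth_bounded_cell[OF k] by blast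
    show ?thesis
    proof (rule integral_dominated_convergence)
      show "integrable (lebesgue_on cell) (\<lambda>z. M * (B * majorant \<beta> (bwd z)))"
        by (intro integrable_mult_right majorant_bwd_integrable_on \<beta>) simp
      show "(\<lambda>z. k z * a n z) \<in> borel_measurable (lebesgue_on cell)" for n
        by (intro borel_measurable_times cm k a)
      show "(\<lambda>z. k z * a' z) \<in> borel_measurable (lebesgue_on cell)"
        by (intro borel_measurable_times cm k a')
      show "AE z in lebesgue_on cell. (\<lambda>n. k z * a n z) \<longlonglongrightarrow> k z * a' z"
        by (intro AE_I2 tendsto_intros a)
      show "AE z in lebesgue_on cell. norm (k z * a n z) \<le> M * (B * majorant \<beta> (bwd z))" for n
      proof (rule AE_I2)
        fix z assume "z \<in> space (lebesgue_on cell)"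
        then have "\<bar>k z\<bar> \<le> M" by (intro M) (simp add: space_restrict_space)
        then show "norm (k z * a n z) \<le> M * (B * majorant \<beta> (bwd z))"
          unfolding real_norm_def abs_mult by (intro mult_mono a(3)) auto
      qed
    qed
  qed
  have sm: "smooth (cell_approx \<beta> q n)" for n by (rule test_function_smooth[OF cell_approx_test[OF q]])
  have m: "cell_bubble \<beta> q \<in> borel_measurable (lebesgue_on cell)" "cell_bubble_dx \<beta> q \<in> borel_measurable (lebesgue_on cell)"
    "cell_bubble_dy \<beta> q \<in> borel_measurable (lebesgue_on cell)"
    using cell_bubble_square_integrable[OF q \<beta> open_cell] by (simp_all add: square_integrable_def)
  have step: "(LINT z|lebesgue_on cell. h z * pdiff1 (cell_approx \<beta> q n) z) = - (LINT z|lebesgue_on cell. pdiff1 h z * cell_approx \<beta> q n z)"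
    "(LINT z|lebesgue_on cell. h z * pdiff2 (cell_approx \<beta> q n) z) = - (LINT z|lebesgue_on cell. pdiff2 h z * cell_approx \<beta> q n z)" for n
    using smooth_has_weak_deriv[OF h open_cell] cell_approx_test[OF q, of \<beta> n] by (auto simp: has_weak_deriv_def pdiff_simps)
  note L = cell_approx_limits[OF q]
  show "(LINT z|lebesgue_on cell. h z * cell_bubble_dx \<beta> q z) = - (LINT z|lebesgue_on cell. pdiff1 h z * cell_bubble \<beta> q z)"
    by (rule LIMSEQ_unique[OF lim[OF h smooth_pdiff1[OF sm] L(2) B(2) m(2), unfolded step]
          tendsto_minus[OF lim[OF smooth_pdiff1[OF h] sm L(1) B(1) m(1)]]])
  show "(LINT z|lebesgue_on cell. h z * cell_bubble_dy \<beta> q z) = - (LINT z|lebesgue_on cell. pdiff2 h z * cell_bubble \<beta> q z)"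
    by (rule LIMSEQ_unique[OF lim[OF h smooth_pdiff2[OF sm] L(3) B(3) m(3), unfolded step]
          tendsto_minus[OF lim[OF smooth_pdiff2[OF h] sm L(1) B(1) m(1)]]])
qed

text \<open>
  Since the bubble vanishes outside the cell, the weak formulation on \<open>\<Omega>\<close> reduces to integrals over the
  cell. There the finite element function is a polynomial and is integrated by parts against the bubble.
\<close>
lemma error_energy_cell_bubble:
  assumes \<Omega>: "open \<Omega>" "cell \<subseteq> \<Omega>" and f: "f \<in> L2_space \<Omega>" and u: "u \<in> H01_space \<Omega>"
    and weak: "\<forall>v\<in>H01_space \<Omega>. energy \<Omega> u v = (LINT x|lebesgue_on \<Omega>. f x * v x)"
    and qN: "qN \<in> Qpoly p" and uN: "\<And>z. z \<in> refQ \<Longrightarrow> uN (fwd z) = qN z"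
    and g: "smooth g" and \<beta>: "1/2 < \<beta>" "\<beta> < 1"
  shows "energy cell (\<lambda>x. u x - uN x) (cell_bubble \<beta> g) =
    jac * (LINT z|lebesgue_on refQ. (f (fwd z) + laplacian uN (fwd z)) * (g z * jacobi_weight \<beta> (0, 0) z))"
proof -
  define P where "P z = qN (bwd z)" for z
  have P: "smooth P" unfolding P_def[abs_def] by (intro smooth_bwd Qpoly_smooth[OF qN])
  have uNP: "uN z = P z" if "z \<in> cell" for z
    using uN[of "bwd z"] that by (simp add: P_def cell_iff)
  have lap: "laplacian uN z = pdiff1 (pdiff1 P) z + pdiff2 (pdiff2 P) z" if "z \<in> cell" for z
  proof -
    have "pdiff1 uN w = pdiff1 P w" "pdiff2 uN w = pdiff2 P w" if "w \<in> cell" for w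
      using pdiff_local[OF open_cell that uNP] by auto
    then have "pdiff1 (pdiff1 uN) z = pdiff1 (pdiff1 P) z" "pdiff2 (pdiff2 uN) z = pdiff2 (pdiff2 P) z"
      using pdiff_local(1)[OF open_cell that, of "pdiff1 uN" "pdiff1 P"] pdiff_local(2)[OF open_cell that, of "pdiff2 uN" "pdiff2 P"]
      by auto
    then show ?thesis by (simp add: laplacian_def pdiff_second)
  qed
  have \<Omega>l: "\<Omega> \<in> sets lebesgue" using \<Omega> by auto
  define u1 u2 where "u1 = weak_deriv \<Omega> (1, 0) u" and "u2 = weak_deriv \<Omega> (0, 1) u"
  have uH: "u \<in> Hk_space 1 \<Omega>" by (rule H01_subset[OF u])
  then have wd: "weakly_diff 1 \<Omega> u" by (simp add: Hk_space_def)
  have du: "has_weak_deriv \<Omega> (1, 0) u u1" "has_weak_deriv \<Omega> (0, 1) u u2"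
    using weakly_diff_1_derivs[OF wd \<Omega>(1)] by (simp_all add: u1_def u2_def)
  have squ: "square_integrable (lebesgue_on cell) u1" "square_integrable (lebesgue_on cell) u2"
    using H1_weak_deriv_square_integrable[OF uH \<Omega>(1)] square_integrable_mono[OF _ \<Omega>(2) \<Omega>l cell_lebesgue]
    by (simp_all add: u1_def u2_def)
  have sqf: "square_integrable (lebesgue_on cell) f"
    using f by (intro square_integrable_mono[OF _ \<Omega>(2) \<Omega>l cell_lebesgue]) (simp add: L2_space_def square_integrable_def)
  note sqV = cell_bubble_square_integrable[OF g \<beta> open_cell]
  note sqP = smooth_square_integrable_cell[OF smooth_pdiff1[OF P]] smooth_square_integrable_cell[OF smooth_pdiff2[OF P]]
    smooth_square_integrable_cell[OF smooth_pdiff1[OF smooth_pdiff1[OF P]]]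
    smooth_square_integrable_cell[OF smooth_pdiff2[OF smooth_pdiff2[OF P]]]
  note int = square_integrable_mult[OF squ(1) sqV(2)] square_integrable_mult[OF squ(2) sqV(3)]
    square_integrable_mult[OF sqP(1) sqV(2)] square_integrable_mult[OF sqP(2) sqV(3)]
    square_integrable_mult[OF sqP(3) sqV(1)] square_integrable_mult[OF sqP(4) sqV(1)] square_integrable_mult[OF sqf sqV(1)]
  have restrict: "(LINT z|lebesgue_on \<Omega>. k z) = (LINT z|lebesgue_on cell. k z)" if "\<And>z. z \<notin> cell \<Longrightarrow> k z = 0" for k :: "plane \<Rightarrow> real"
  proof -
    have "k z = 0" if "z \<notin> \<Omega>" for z using that \<Omega>(2) \<open>\<And>z. z \<notin> cell \<Longrightarrow> k z = 0\<close> by blast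
    then show ?thesis
      using integral_lebesgue_on_extend[OF \<Omega>l, of k] integral_lebesgue_on_extend[OF cell_lebesgue that] by simp
  qed
  note dV = cell_bubble_has_weak_deriv[OF g \<beta>]
  have "(LINT z|lebesgue_on \<Omega>. f z * cell_bubble \<beta> g z) = energy \<Omega> u (cell_bubble \<beta> g)"
    using weak cell_bubble_in_H01[OF g \<beta> \<Omega>] by simp
  also have "\<dots> = (LINT z|lebesgue_on \<Omega>. u1 z * cell_bubble_dx \<beta> g z + u2 z * cell_bubble_dy \<beta> g z)"
    by (rule energy_eq[OF \<Omega>(1) du dV[OF \<Omega>(1)]])
  also have "\<dots> = (LINT z|lebesgue_on cell. u1 z * cell_bubble_dx \<beta> g z + u2 z * cell_bubble_dy \<beta> g z)"
    by (rule restrict) (simp add: cell_bubble_outside)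
  also have "(LINT z|lebesgue_on \<Omega>. f z * cell_bubble \<beta> g z) = (LINT z|lebesgue_on cell. f z * cell_bubble \<beta> g z)"
    by (rule restrict) (simp add: cell_bubble_outside)
  finally have E1: "(LINT z|lebesgue_on cell. u1 z * cell_bubble_dx \<beta> g z + u2 z * cell_bubble_dy \<beta> g z) = (LINT z|lebesgue_on cell. f z * cell_bubble \<beta> g z)" by simp
  have dN: "has_weak_deriv cell (1, 0) uN (pdiff1 P)" "has_weak_deriv cell (0, 1) uN (pdiff2 P)"
    by (rule has_weak_deriv_cong[OF smooth_has_weak_deriv(1)[OF P open_cell]] has_weak_deriv_cong[OF smooth_has_weak_deriv(2)[OF P open_cell]];
        simp add: uNP)+
  have de: "has_weak_deriv cell (1, 0) (\<lambda>z. u z - uN z) (\<lambda>z. u1 z - pdiff1 P z)"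
    "has_weak_deriv cell (0, 1) (\<lambda>z. u z - uN z) (\<lambda>z. u2 z - pdiff2 P z)"
    by (rule has_weak_deriv_diff[OF has_weak_deriv_mono[OF du(1) \<Omega>(2,1) open_cell] dN(1) open_cell]
          has_weak_deriv_diff[OF has_weak_deriv_mono[OF du(2) \<Omega>(2,1) open_cell] dN(2) open_cell]; simp)+
  have "energy cell (\<lambda>x. u x - uN x) (cell_bubble \<beta> g) =
      (LINT z|lebesgue_on cell. (u1 z - pdiff1 P z) * cell_bubble_dx \<beta> g z + (u2 z - pdiff2 P z) * cell_bubble_dy \<beta> g z)"
    by (rule energy_eq[OF open_cell de dV[OF open_cell]])
  also have "\<dots> = (LINT z|lebesgue_on cell. u1 z * cell_bubble_dx \<beta> g z + u2 z * cell_bubble_dy \<beta> g z)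
      - (LINT z|lebesgue_on cell. pdiff1 P z * cell_bubble_dx \<beta> g z) - (LINT z|lebesgue_on cell. pdiff2 P z * cell_bubble_dy \<beta> g z)"
    using int by (simp add: left_diff_distrib)
  also have "\<dots> = (LINT z|lebesgue_on cell. f z * cell_bubble \<beta> g z) + (LINT z|lebesgue_on cell. pdiff1 (pdiff1 P) z * cell_bubble \<beta> g z)
      + (LINT z|lebesgue_on cell. pdiff2 (pdiff2 P) z * cell_bubble \<beta> g z)"
    unfolding E1 cell_bubble_integration_by_parts[OF smooth_pdiff1[OF P] g \<beta>] cell_bubble_integration_by_parts[OF smooth_pdiff2[OF P] g \<beta>] by simp
  also have "\<dots> = (LINT z|lebesgue_on cell. f z * cell_bubble \<beta> g z + pdiff1 (pdiff1 P) z * cell_bubble \<beta> g z + pdiff2 (pdiff2 P) z * cell_bubble \<beta> g z)"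
    using int by simp
  also have "\<dots> = jac * (LINT z|lebesgue_on refQ. f (fwd z) * cell_bubble \<beta> g (fwd z) + pdiff1 (pdiff1 P) (fwd z) * cell_bubble \<beta> g (fwd z)
      + pdiff2 (pdiff2 P) (fwd z) * cell_bubble \<beta> g (fwd z))"
    by (rule cell_transfer(3)) (use int in simp)
  also have "(LINT z|lebesgue_on refQ. f (fwd z) * cell_bubble \<beta> g (fwd z) + pdiff1 (pdiff1 P) (fwd z) * cell_bubble \<beta> g (fwd z)
      + pdiff2 (pdiff2 P) (fwd z) * cell_bubble \<beta> g (fwd z)) =
      (LINT z|lebesgue_on refQ. (f (fwd z) + laplacian uN (fwd z)) * (g z * jacobi_weight \<beta> (0, 0) z))"
  proof (rule Bochner_Integration.integral_cong[OF refl])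
    fix z assume "z \<in> space (lebesgue_on refQ)"
    then have z: "z \<in> refQ" by (simp add: space_refQ)
    have "cell_bubble \<beta> g (fwd z) = g z * jacobi_weight \<beta> (0, 0) z"
      using z by (simp add: cell_bubble_def bubble_def jacobi_weight_def gap_def case_prod_beta)
    then show "f (fwd z) * cell_bubble \<beta> g (fwd z) + pdiff1 (pdiff1 P) (fwd z) * cell_bubble \<beta> g (fwd z)
      + pdiff2 (pdiff2 P) (fwd z) * cell_bubble \<beta> g (fwd z) = (f (fwd z) + laplacian uN (fwd z)) * (g z * jacobi_weight \<beta> (0, 0) z)"
      using lap[of "fwd z"] z by (simp add: cell_iff distrib_right)
  qed
  finally show ?thesis .
qed

end

section \<open>The efficiency estimate on one element\<close>

text \<open>
  If \<open>sqrt N > a + sqrt D\<close> then \<open>N = sqrt N * sqrt N\<close> exceeds \<open>a * sqrt N + sqrt D * sqrt N\<close>, which is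
  at least \<open>a * sqrt N + D\<close>.
\<close>
lemma quadratic_absorption:
  fixes x a D N :: real
  assumes "0 \<le> N" "0 \<le> D" "0 \<le> a" and "N \<le> a * sqrt N + D"
  shows "sqrt N \<le> a + sqrt D"
proof (rule ccontr)
  assume "\<not> ?thesis"
  then have gt: "sqrt N > a + sqrt D" by simp
  then have pos: "sqrt N > 0" using assms(2,3) by (smt (verit) real_sqrt_ge_zero)
  have "D = sqrt D * sqrt D" using assms(2) by simp
  also have "\<dots> \<le> sqrt D * sqrt N"
  proof (rule mult_left_mono)
    show "sqrt D \<le> sqrt N" using gt assms(3) by linarith
  qed (use assms(2) in simp)
  finally have "a * sqrt N + D \<le> (a + sqrt D) * sqrt N" by (simp add: distrib_right)
  also have "\<dots> < sqrt N * sqrt N" using gt pos by (rule mult_strict_right_mono)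
  also have "\<dots> = N" using assms(1) by simp
  finally show False using assms(4) by simp
qed

text \<open>
  The residual \<open>g\<close> is tested against its own bubble. With \<open>N\<close> and \<open>D\<close> the weighted square integrals of
  \<open>g\<close> and of \<open>d = f\<^sub>p - f\<close>, and \<open>X\<close> the error energy of the bubble divided by the Jacobian, the identity
  \<open>N = X + \<integral> d * g * w\<close> and \<open>2 * d * g \<le> d\<^sup>2 + g\<^sup>2\<close> give \<open>N \<le> 2 * X + D\<close>. The norm bound for the
  bubble makes \<open>X\<close> linear in \<open>sqrt N\<close>.
\<close>
lemma (in affine_chart) residual_bound:
  assumes \<Omega>: "open \<Omega>" "cell \<subseteq> \<Omega>" and f: "f \<in> L2_space \<Omega>" and u: "u \<in> H01_space \<Omega>"
    and weak: "\<forall>v\<in>H01_space \<Omega>. energy \<Omega> u v = (LINT x|lebesgue_on \<Omega>. f x * v x)"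
    and p: "1 \<le> p" and qN: "qN \<in> Qpoly p" and uN: "\<And>z. z \<in> refQ \<Longrightarrow> uN (fwd z) = qN z"
    and \<beta>: "1/2 < \<beta>" "\<beta> < 1"
    and K: "interior K = cell"
  shows "eta_B fwd \<beta> p f uN \<le> ennreal (8 / jac + 1) *
      (local_error_norm fwd K \<beta> (\<lambda>x. u x - uN x)
        + ennreal (1 / real p) * Hkb_norm fwd 0 \<beta> (\<lambda>x. data_approx fwd \<beta> p f x - f x))"
proof -
  let ?w = "jacobi_weight \<beta> (0, 0)"
  define fp where "fp = jacobi_projection \<beta> p (\<lambda>z. f (fwd z))"
  have \<Omega>l: "\<Omega> \<in> sets lebesgue" using \<Omega> by auto
  have sqf: "square_integrable (lebesgue_on cell) f"
    using f by (intro square_integrable_mono[OF _ \<Omega>(2) \<Omega>l cell_lebesgue]) (simp add: L2_space_def square_integrable_def)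
  then have sqF: "square_integrable (lebesgue_on refQ) (\<lambda>z. f (fwd z))"
    unfolding square_integrable_def using cell_transfer(1)[of f] cell_transfer(2)[of "\<lambda>z. (f z)\<^sup>2"] by blast
  have fpQ: "fp \<in> Qpoly p" unfolding fp_def using \<beta> by (intro jacobi_projection_mem sqF) simp
  obtain r where r: "r \<in> Qpoly p"
    "\<And>z. pdiff1 (pdiff1 (\<lambda>z. qN (bwd z))) z + pdiff2 (pdiff2 (\<lambda>z. qN (bwd z))) z = r (bwd z)"
    using laplacian_pullback[OF qN] by blast
  have lap: "laplacian uN (fwd z) = r z" if z: "z \<in> refQ" for z
  proof -
    have e: "uN w = qN (bwd w)" if "w \<in> cell" for w using uN[of "bwd w"] that by (simp add: cell_iff)
    have c: "fwd z \<in> cell" using z by (simp add: cell_iff)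
    have "pdiff1 uN w = pdiff1 (\<lambda>z. qN (bwd z)) w" "pdiff2 uN w = pdiff2 (\<lambda>z. qN (bwd z)) w" if "w \<in> cell" for w
      using pdiff_local[OF open_cell that e] by auto
    from pdiff_local(1)[OF open_cell c this(1)] pdiff_local(2)[OF open_cell c this(2)]
    show ?thesis using r(2)[of "fwd z"] by (simp add: laplacian_def pdiff_second)
  qed
  define g where "g z = fp z + r z" for z
  have gQ: "g \<in> Qpoly p" using Qpoly_add_cmult[OF fpQ r(1), of 1] by (simp add: g_def[abs_def])
  have gs: "smooth g" by (rule Qpoly_smooth[OF gQ])
  have sqg: "square_integrable (lebesgue_on refQ) g" by (rule smooth_square_integrable_refQ[OF gs])
  define d where "d z = fp z - f (fwd z)" for z
  have sqd: "square_integrable (lebesgue_on refQ) d"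
    using square_integrable_add[OF smooth_square_integrable_refQ[OF Qpoly_smooth[OF fpQ]] sqF, of "-1"]
    by (simp add: d_def[abs_def])
  have b0: "0 \<le> \<beta>" using \<beta> by simp
  note ig = weighted_square_integrable[OF sqg b0] and id = weighted_square_integrable[OF sqd b0]
  define N where "N = (LINT z|lebesgue_on refQ. (g z)\<^sup>2 * ?w z)"
  define D where "D = (LINT z|lebesgue_on refQ. (d z)\<^sup>2 * ?w z)"
  have N0: "0 \<le> N" and D0: "0 \<le> D" unfolding N_def D_def by (intro integral_nonneg_AE AE_I2; simp)+
  have nnN: "(\<integral>\<^sup>+ z. ennreal ((g z)\<^sup>2 * ?w z) \<partial>lebesgue_on refQ) = ennreal N"
    unfolding N_def using ig by (intro nn_integral_eq_integral) auto
  have nnD: "(\<integral>\<^sup>+ z. ennreal ((d z)\<^sup>2 * ?w z) \<partial>lebesgue_on refQ) = ennreal D"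
    unfolding D_def using id by (intro nn_integral_eq_integral) auto
  have da: "data_approx fwd \<beta> p f (fwd z) = fp z" for z
    by (simp add: data_approx_def inv_fwd fp_def comp_def)
  have "Hkb_norm fwd 0 \<beta> (\<lambda>x. data_approx fwd \<beta> p f x + laplacian uN x) =
      enn_sqrt (\<integral>\<^sup>+ z. ennreal ((g z)\<^sup>2 * ?w z) \<partial>lebesgue_on refQ)"
    unfolding Hkb_norm_def sobolev_norm_0
    by (intro arg_cong[where f = enn_sqrt] nn_integral_cong) (simp add: space_refQ da lap g_def)
  then have eta: "eta_B fwd \<beta> p f uN = ennreal (1 / real p) * ennreal (sqrt N)"
    unfolding eta_B_def nnN using N0 by (simp add: enn_sqrt_ennreal)
  have "Hkb_norm fwd 0 \<beta> (\<lambda>x. data_approx fwd \<beta> p f x - f x) =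
      enn_sqrt (\<integral>\<^sup>+ z. ennreal ((d z)\<^sup>2 * ?w z) \<partial>lebesgue_on refQ)"
    unfolding Hkb_norm_def sobolev_norm_0
    by (intro arg_cong[where f = enn_sqrt] nn_integral_cong) (simp add: da d_def)
  then have osc: "Hkb_norm fwd 0 \<beta> (\<lambda>x. data_approx fwd \<beta> p f x - f x) = ennreal (sqrt D)"
    unfolding nnD using D0 by (simp add: enn_sqrt_ennreal)
  define T where "T = local_error_norm fwd K \<beta> (\<lambda>x. u x - uN x)"
  have jp: "0 < jac" by (rule jac_pos)
  have pp: "1 \<le> real p" using p by simp
  show ?thesis
  proof (cases "T = top")
    case True
    have "ennreal (8 / jac + 1) * top = top" using jp by (simp add: ennreal_mult_top add_pos_pos)
    then show ?thesis using True by (simp add: T_def)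
  next
    case False
    then obtain \<tau> where \<tau>: "T = ennreal \<tau>" "0 \<le> \<tau>" by (cases T) auto
    define X where "X = (LINT z|lebesgue_on refQ. (f (fwd z) + laplacian uN (fwd z)) * (g z * ?w z))"
    obtain s where s: "N \<le> s" "s \<le> 16 * (real p)\<^sup>2 * N"
      and norm: "\<And>k. Hkb_norm_ref 1 (- \<beta>) (bubble \<beta> (\<lambda>z. k * g z)) = enn_sqrt (ennreal (k\<^sup>2 * s))"
      using bubble_norm[OF gQ p \<beta>, folded N_def] by blast
    have pullF: "cell_bubble \<beta> q \<circ> fwd = bubble \<beta> q" for q by (auto simp: cell_bubble_def)
    have XT: "jac * X \<le> \<tau> * (4 * real p * sqrt N)"
    \<comment> \<open>a null residual cannot be normalised; in that case \<open>g\<close> vanishes almost everywhere\<close>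
    proof (cases "N = 0")
      case True
      then have "AE z in lebesgue_on refQ. (g z)\<^sup>2 * ?w z = 0"
        using integral_nonneg_eq_0_iff_AE[OF ig] by (simp add: N_def)
      then have "AE z in lebesgue_on refQ. (f (fwd z) + laplacian uN (fwd z)) * (g z * ?w z) = 0"
        by eventually_elim auto
      then have "X = 0" unfolding X_def by (rule integral_eq_zero_AE)
      then show ?thesis using True by simp
    next
      case False
      then have s0: "0 < s" using N0 s by simp
      \<comment> \<open>the factor that normalises the bubble to norm one, as the supremum requires\<close>
      define k where "k = 1 / sqrt s"
      have k: "0 < k" "k\<^sup>2 * s = 1" using s0 by (simp_all add: k_def power_divide)
      have ks: "smooth (\<lambda>z. k * g z)" by (intro smooth_mult smooth_const gs)
      have "Hkb_norm fwd 1 (- \<beta>) (cell_bubble \<beta> (\<lambda>z. k * g z)) = 1"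
        unfolding Hkb_norm_def pullF norm k(2) using enn_sqrt_ennreal[of 1] by simp
      moreover have "cell_bubble \<beta> (\<lambda>z. k * g z) \<in> Hkb_space fwd 1 (- \<beta>)"
        unfolding Hkb_space_def mem_Collect_eq pullF by (rule bubble_in_Hkb[OF ks \<beta>])
      ultimately have "ennreal \<bar>energy cell (\<lambda>x. u x - uN x) (cell_bubble \<beta> (\<lambda>z. k * g z))\<bar> \<le> T"
        unfolding T_def local_error_norm_def K by (intro SUP_upper) blast
      then have "\<bar>energy cell (\<lambda>x. u x - uN x) (cell_bubble \<beta> (\<lambda>z. k * g z))\<bar> \<le> \<tau>"
        unfolding \<tau>(1) using \<tau>(2) by (simp add: ennreal_le_iff)
      moreover have "energy cell (\<lambda>x. u x - uN x) (cell_bubble \<beta> (\<lambda>z. k * g z)) = k * (jac * X)"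
      proof -
        have e: "(f (fwd z) + laplacian uN (fwd z)) * (k * g z * ?w z) = k * ((f (fwd z) + laplacian uN (fwd z)) * (g z * ?w z))" for z
          by (simp only: ac_simps)
        have "energy cell (\<lambda>x. u x - uN x) (cell_bubble \<beta> (\<lambda>z. k * g z)) =
            jac * (LINT z|lebesgue_on refQ. (f (fwd z) + laplacian uN (fwd z)) * (k * g z * ?w z))"
          by (rule error_energy_cell_bubble[OF \<Omega> f u weak qN uN ks \<beta>])
        also have "\<dots> = jac * (k * X)" unfolding e X_def by (simp only: integral_mult_right_zero)
        finally show ?thesis by simp
      qed
      ultimately have "k * (jac * X) \<le> \<tau>" by simp
      then have "jac * X \<le> \<tau> * sqrt s" using s0 by (simp add: k_def field_simps)
      also have "\<dots> \<le> \<tau> * (4 * real p * sqrt N)"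
      proof (rule mult_left_mono[OF _ \<tau>(2)])
        have "sqrt s \<le> sqrt (16 * (real p)\<^sup>2 * N)" using s(2) by (rule real_sqrt_le_mono)
        also have "\<dots> = 4 * real p * sqrt N"
          using real_sqrt_abs[of "4 * real p"] by (simp add: real_sqrt_mult)
        finally show "sqrt s \<le> 4 * real p * sqrt N" .
      qed
      finally show ?thesis .
    qed
    have NX: "N \<le> 2 * X + D"
    proof -
      have wle: "integrable (lebesgue_on refQ) (\<lambda>z. h z * g z * ?w z)" if h: "square_integrable (lebesgue_on refQ) h" for h
      proof (rule Bochner_Integration.integrable_bound[OF square_integrable_mult[OF h sqg]])
        show "(\<lambda>z. h z * g z * ?w z) \<in> borel_measurable (lebesgue_on refQ)"
          using h sqg by (intro borel_measurable_times jacobi_weight_measurable_refQ) (simp_all add: square_integrable_def)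
        show "AE z in lebesgue_on refQ. norm (h z * g z * ?w z) \<le> norm (h z * g z)"
          by (rule AE_I2) (auto simp: space_refQ abs_mult intro!: mult_left_le jacobi_weight_le_1 b0)
      qed
      have Xd: "X = (LINT z|lebesgue_on refQ. (g z)\<^sup>2 * ?w z - d z * g z * ?w z)"
        unfolding X_def
      proof (rule Bochner_Integration.integral_cong[OF refl])
        fix z assume "z \<in> space (lebesgue_on refQ)"
        then have "laplacian uN (fwd z) = r z" by (simp add: space_refQ lap)
        then show "(f (fwd z) + laplacian uN (fwd z)) * (g z * ?w z) = (g z)\<^sup>2 * ?w z - d z * g z * ?w z"
          by (simp add: d_def g_def power2_eq_square algebra_simps)
      qed
      also have "\<dots> = N - (LINT z|lebesgue_on refQ. d z * g z * ?w z)"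
        unfolding N_def using ig wle[OF sqd] by (rule Bochner_Integration.integral_diff)
      finally have Xe: "X = N - (LINT z|lebesgue_on refQ. d z * g z * ?w z)" .
      have "(LINT z|lebesgue_on refQ. d z * g z * ?w z) \<le> (LINT z|lebesgue_on refQ. 1/2 * ((d z)\<^sup>2 * ?w z) + 1/2 * ((g z)\<^sup>2 * ?w z))"
      proof (rule integral_mono[OF wle[OF sqd]])
        show "integrable (lebesgue_on refQ) (\<lambda>z. 1/2 * ((d z)\<^sup>2 * ?w z) + 1/2 * ((g z)\<^sup>2 * ?w z))"
          by (intro Bochner_Integration.integrable_add integrable_mult_right ig id)
        fix z
        have "d z * g z * ?w z \<le> (1/2 * (d z)\<^sup>2 + 1/2 * (g z)\<^sup>2) * ?w z"
          using sum_squares_bound[of "d z" "g z"] by (intro mult_right_mono) auto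
        then show "d z * g z * ?w z \<le> 1/2 * ((d z)\<^sup>2 * ?w z) + 1/2 * ((g z)\<^sup>2 * ?w z)"
          by (simp add: distrib_right)
      qed
      also have "\<dots> = 1/2 * D + 1/2 * N"
        unfolding D_def N_def using id ig by simp
      finally show ?thesis using Xe by simp
    qed
    have "X \<le> (4 * real p * \<tau> / jac) * sqrt N"
      using XT jp by (simp add: field_simps)
    then have "N \<le> (8 * real p * \<tau> / jac) * sqrt N + D" using NX by simp
    then have "sqrt N \<le> 8 * real p * \<tau> / jac + sqrt D"
      using N0 D0 \<tau>(2) jp by (intro quadratic_absorption) auto
    then have "1 / real p * sqrt N \<le> 1 / real p * (8 * real p * \<tau> / jac + sqrt D)"
      by (intro mult_left_mono) auto
    also have "\<dots> = 8 / jac * \<tau> + 1 / real p * sqrt D"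
      using pp jp by (simp add: distrib_left)
    also have "\<dots> \<le> (8 / jac + 1) * (\<tau> + 1 / real p * sqrt D)"
    proof -
      have "0 \<le> 8 / jac * (1 / real p * sqrt D)" "0 \<le> 1 / real p * sqrt D"
        using jp D0 by auto
      moreover have "(x + 1) * (\<tau> + y) = x * \<tau> + x * y + \<tau> + y" for x y by (simp add: algebra_simps)
      ultimately show ?thesis using \<tau>(2) by simp
    qed
    finally have "ennreal (1 / real p * sqrt N) \<le> ennreal ((8 / jac + 1) * (\<tau> + 1 / real p * sqrt D))"
      by (rule ennreal_leI)
    also have "\<dots> = ennreal (8 / jac + 1) * (ennreal \<tau> + ennreal (1 / real p) * ennreal (sqrt D))"
    proof -
      have "0 \<le> 8 / jac + 1" "0 \<le> 1 / real p * sqrt D" using jp D0 by simp_all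
      then have "ennreal ((8 / jac + 1) * (\<tau> + 1 / real p * sqrt D)) = ennreal (8 / jac + 1) * (ennreal \<tau> + ennreal (1 / real p * sqrt D))"
        using \<tau>(2) by (simp only: ennreal_mult ennreal_plus add_nonneg_nonneg)
      also have "ennreal (1 / real p * sqrt D) = ennreal (1 / real p) * ennreal (sqrt D)"
        by (rule ennreal_mult) (use D0 in simp_all)
      finally show ?thesis .
    qed
    also have "ennreal (1 / real p * sqrt N) = ennreal (1 / real p) * ennreal (sqrt N)"
      by (rule ennreal_mult) (use N0 in simp_all)
    finally show ?thesis unfolding eta osc T_def[symmetric] \<tau>(1) .
  qed
qed

theorem theorem4p2:
  fixes F :: "plane set \<Rightarrow> plane \<Rightarrow> plane"
  assumes F: "\<And>K. parallelogram K \<Longrightarrow> affine_bijection (F K) K"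
  shows "\<exists>C :: plane set \<Rightarrow> real. (\<forall>K. C K > 0) \<and>
    (\<forall>(\<Omega> :: plane set) (T :: plane set set) (p :: plane set \<Rightarrow> nat) (C\<^sub>0 :: real)
        (f :: plane \<Rightarrow> real) (\<delta> :: real) (\<beta> :: real) (s :: real)
        (u :: plane \<Rightarrow> real) (u\<^sub>N :: plane \<Rightarrow> real) (e :: plane \<Rightarrow> real).
      polygonal_domain \<Omega> \<and>
      admissible_partition \<Omega> T \<and>
      (\<forall>K\<in>T. p K \<ge> 1) \<and>
      comparable_degrees T p C\<^sub>0 \<and>
      f \<in> L2_space \<Omega> \<and>
      0 < \<delta> \<and> \<delta> < 1/4 \<and> \<beta> = 1/2 + \<delta> \<and>
      u \<in> H01_space \<Omega> \<and>
      (\<forall>v\<in>H01_space \<Omega>. energy \<Omega> u v = (LINT x|lebesgue_on \<Omega>. f x * v x)) \<and>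
      u\<^sub>N \<in> S0_space F \<Omega> T p \<and>
      (\<forall>v\<in>S0_space F \<Omega> T p. energy \<Omega> u\<^sub>N v = (LINT x|lebesgue_on \<Omega>. f x * v x)) \<and>
      e = (\<lambda>x. u x - u\<^sub>N x) \<and>
      u \<in> Hr_space (1 + s) \<Omega> \<and> s \<ge> (1 - \<beta>) / 2
      \<longrightarrow>
      (\<forall>K\<in>T.
        eta_B (F K) \<beta> (p K) f u\<^sub>N
          \<le> ennreal (C K) *
             (local_error_norm (F K) K \<beta> e
              + ennreal (1 / real (p K)) *
                Hkb_norm (F K) 0 \<beta> (\<lambda>x. data_approx (F K) \<beta> (p K) f x - f x))))"
proof -
  have "\<exists>C > 0. parallelogram K \<longrightarrow>
      (\<exists>a b c d s t. affine_chart a b c d \<and> F K = affine_chart.fwd a b c d s t \<and> C = 8 / affine_chart.jac a b c d + 1)" for K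
  proof (cases "parallelogram K")
    case True
    obtain a b c d s t where ch: "affine_chart a b c d" and FK: "F K = affine_chart.fwd a b c d s t"
      using affine_bijection_chart[OF F[OF True]] by blast
    have "0 < 8 / affine_chart.jac a b c d + 1"
      using affine_chart.jac_pos[OF ch] by (simp add: add_pos_pos)
    then show ?thesis using ch FK by blast
  next
    case False
    then show ?thesis by (intro exI[of _ 1]) simp
  qed
  then obtain C where Cpos: "\<And>K. C K > 0" and C: "\<And>K. parallelogram K \<Longrightarrow>
      \<exists>a b c d s t. affine_chart a b c d \<and> F K = affine_chart.fwd a b c d s t \<and> C K = 8 / affine_chart.jac a b c d + 1"
    by metis
  show ?thesis
  proof (intro exI[of _ C] conjI allI impI ballI, goal_cases)
    case (1 K)
    show ?case by (rule Cpos)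
  next
    case (2 \<Omega> T p C\<^sub>0 f \<delta> \<beta> s' u u\<^sub>N e K)
    then have K: "K \<in> T" and \<Omega>: "open \<Omega>" and T: "admissible_partition \<Omega> T" and p: "1 \<le> p K"
      and f: "f \<in> L2_space \<Omega>" and \<beta>: "1/2 < \<beta>" "\<beta> < 1" and u: "u \<in> H01_space \<Omega>"
      and weak: "\<forall>v\<in>H01_space \<Omega>. energy \<Omega> u v = (LINT x|lebesgue_on \<Omega>. f x * v x)"
      and uN: "u\<^sub>N \<in> S0_space F \<Omega> T p" and e: "e = (\<lambda>x. u x - u\<^sub>N x)"
      by (auto simp: polygonal_domain_def)
    have par: "parallelogram K" and sub: "interior K \<subseteq> \<Omega>" using T K by (auto simp: admissible_partition_def)
    obtain a b c d s t where ch: "affine_chart a b c d" and FK: "F K = affine_chart.fwd a b c d s t"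
      and CK: "C K = 8 / affine_chart.jac a b c d + 1" using C[OF par] by blast
    interpret affine_chart a b c d s t by (rule ch)
    have "K = fwd ` closure refQ" using F[OF par] unfolding affine_bijection_def FK by blast
    then have int: "interior K = cell" using interior_cell by simp
    obtain q where q: "q \<in> Qpoly (p K)" "\<forall>z\<in>closure refQ. u\<^sub>N (F K z) = q z"
      using uN K unfolding S0_space_def by blast
    have uNq: "u\<^sub>N (fwd z) = q z" if "z \<in> refQ" for z
      using q(2) that closure_subset[of refQ] unfolding FK by blast
    have cs: "cell \<subseteq> \<Omega>" using sub int by simp
    show ?case
      unfolding FK CK e by (rule residual_bound[OF \<Omega> cs f u weak p q(1) uNq \<beta> int])
  qed
qed

end
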